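(* There is a universal constant $K$ such that the following holds. Let $n\ge m\ge 1$ be integers, let $Y\in\mathbb{R}^{n\times m}$ be any matrix, let $s\ge 1$ be an integer, let $r>0$, and let $\ell$ be an $l$-Lipschitz loss bounded by $b$. Let $\overline S\subset[n]\times[m]$ be a fixed subset of size $2s$, split uniformly at random into a training set $S$ and a test set $T=\overline S\setminus S$, each of size $s$. Let $\overline p$ denote the smoothed empirical marginals of $\overline S$, and let $\hat X_S\in\arg\min\{\hat L_S(X):X\in\mathcal{W}_r[\overline p]\}$. Then, in expectation over the random split of $\overline S$ into $S$ and $T$, $$\mathbf{E}\big[\hat L_T(\hat X_S)\big]\le \mathbf{E}\Big[\inf_{X\in\mathcal{W}_r[\overline p]}\hat L_T(X)\Big]+K\left(l\,\sqrt{\frac{rn\log^{1/2}(n)}{s}}+\frac{b}{\sqrt s}\right).$$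
   Context: The smoothed empirical marginals of $\overline S$ are $\overline p^r(i)=\frac12\left(\frac{\#\{j:(i,j)\in\overline S\}}{2s}+\frac1n\right)$ and $\overline p^c(j)=\frac12\left(\frac{\#\{i:(i,j)\in\overline S\}}{2s}+\frac1m\right)$. $\|\cdot\|_{\mathrm{tr}}$ is the trace-norm (sum of singular values). For nonnegative weight vectors $q^r\in\mathbb{R}^n$, $q^c\in\mathbb{R}^m$, the weighted trace-norm of $X\in\mathbb{R}^{n\times m}$ is $\|X\|_{\mathrm{tr}(q^r,q^c)}=\|\mathrm{diag}(q^r)^{1/2}\,X\,\mathrm{diag}(q^c)^{1/2}\|_{\mathrm{tr}}$, and $\mathcal{W}_r[q]=\{X\in\mathbb{R}^{n\times m}:\|X\|_{\mathrm{tr}(q^r,q^c)}\le\sqrt r\}$ (in $\mathcal{W}_r$, the subscript $r$ is the number $r>0$; in $q^r$ the superscript $r$ stands for "row"). A loss is a function $\ell:\mathbb{R}\times\mathbb{R}\to\mathbb{R}$; it is $l$-Lipschitz if $|\ell(x,y)-\ell(x',y)|\le l|x-x'|$ for all $x,x',y$, and bounded by $b$ if $|\ell(x,y)|\le b$ for all $x,y$. For a set $A$ of $s$ index pairs, $\hat L_A(X)=\frac1s\sum_{(i,j)\in A}\ell(X_{ij},Y_{ij})$. $\hat X_S$ is any choice of minimizer. $\log^{1/2}(n)=\sqrt{\log n}$. *)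

theory Defs
  imports
    "HOL-Probability.Probability_Mass_Function"
    "Jordan_Normal_Form.Char_Poly"
begin

unbundle no vec_syntax

text \<open>Rows and columns are indexed from \<open>0\<close>, so \<open>[n]\<close> is rendered as \<open>{..<n}\<close>.\<close>

text \<open>
  The eigenvalues of \<open>A\<^sup>T A\<close>, listed with multiplicity, are the roots of its characteristic
  polynomial. They are all real and nonnegative, and their square roots are the singular values
  of \<open>A\<close>. When \<open>A\<close> has more columns than rows this pads the singular values with zeros.
\<close>

definition singular_values :: "real mat \<Rightarrow> real multiset" where
  "singular_values A = image_mset sqrt (proots (char_poly (transpose_mat A * A)))"

definition trace_norm :: "real mat \<Rightarrow> real" where
  "trace_norm A = \<Sum>\<^sub># (singular_values A)"

text \<open>The square root of a nonnegative diagonal matrix is taken entrywise.\<close>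

definition weighted_trace_norm :: "real Matrix.vec \<Rightarrow> real Matrix.vec \<Rightarrow> real mat \<Rightarrow> real" where
  "weighted_trace_norm qr qc X =
     trace_norm (mat_diag (dim_vec qr) (\<lambda>i. sqrt (qr $ i)) * X *
                 mat_diag (dim_vec qc) (\<lambda>j. sqrt (qc $ j)))"

definition weighted_ball :: "real \<Rightarrow> real Matrix.vec \<Rightarrow> real Matrix.vec \<Rightarrow> real mat set" where
  "weighted_ball r qr qc =
     {X \<in> carrier_mat (dim_vec qr) (dim_vec qc). weighted_trace_norm qr qc X \<le> sqrt r}"

text \<open>The sample size is read off the sample: \<open>card S\<close> is \<open>2s\<close> in the marginals, \<open>card A\<close> is \<open>s\<close> in the empirical loss.\<close>

definition smoothed_row_marginal :: "nat \<Rightarrow> (nat \<times> nat) set \<Rightarrow> real Matrix.vec" where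
  "smoothed_row_marginal n S =
     Matrix.vec n (\<lambda>i. 1 / 2 * (real (card {j. (i, j) \<in> S}) / real (card S) + 1 / real n))"

definition smoothed_col_marginal :: "nat \<Rightarrow> (nat \<times> nat) set \<Rightarrow> real Matrix.vec" where
  "smoothed_col_marginal m S =
     Matrix.vec m (\<lambda>j. 1 / 2 * (real (card {i. (i, j) \<in> S}) / real (card S) + 1 / real m))"

definition lipschitz_loss :: "real \<Rightarrow> (real \<Rightarrow> real \<Rightarrow> real) \<Rightarrow> bool" where
  "lipschitz_loss l loss \<longleftrightarrow> (\<forall>x x' y. \<bar>loss x y - loss x' y\<bar> \<le> l * \<bar>x - x'\<bar>)"

definition bounded_loss :: "real \<Rightarrow> (real \<Rightarrow> real \<Rightarrow> real) \<Rightarrow> bool" where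
  "bounded_loss b loss \<longleftrightarrow> (\<forall>x y. \<bar>loss x y\<bar> \<le> b)"

definition empirical_loss ::
    "(real \<Rightarrow> real \<Rightarrow> real) \<Rightarrow> real mat \<Rightarrow> (nat \<times> nat) set \<Rightarrow> real mat \<Rightarrow> real" where
  "empirical_loss loss Y A X =
     1 / real (card A) * (\<Sum>(i, j)\<in>A. loss (X $$ (i, j)) (Y $$ (i, j)))"

text \<open>The training part of a uniformly random split of \<open>U\<close>; the test part is its complement in \<open>U\<close>.\<close>

definition random_split :: "nat \<Rightarrow> 'a set \<Rightarrow> 'a set pmf" where
  "random_split s U = pmf_of_set {S. S \<subseteq> U \<and> card S = s}"

end

(*
  Comparing the training minimiser with an arbitrary competitor bounds the excess risk by the expected
  suprema over W of L_T - L_S and L_S - L_T. A random split of the sample arises from a random matching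
  and independent fair signs on the matched pairs, so both suprema are Rademacher averages.
  Contraction removes the loss, and trace-norm duality leaves the expected spectral norm of the matrix
  with entries +-1 / sqrt (p_i q_j) on s cells. Its rows and columns have squared norm at most
  R^2 = 8 s n, and its expected norm is O(R (ln n)^(1/4)): entries above R / (ln n)^(1/4) are so few per
  row and column that the Schur test suffices; after rescaling, the others are at most 1 and the row
  and column sums of squares are at most p ~ ln n. For these, following Bandeira and van Handel, the
  expected trace of (Q Q^T)^p is a sum over even closed walks, and grouping walks by pattern compares
  it with the same trace for the 4p x 4p matrix of independent signs, whose norm is O(sqrt p) by a net
  argument.
*)
theory Submission
  imports Defs "Jordan_Normal_Form.Schur_Decomposition"
begin

section \<open>Random signs and random splits\<close>

no_notation m_inv (\<open>(\<open>open_block notation=\<open>prefix inv\<close>\<close>inv\<index> _)\<close> [81] 80)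

text \<open>The exponent 1/4 of the logarithm is the obstacle: general matrix concentration would
  cost sqrt (ln n). The threshold R / (ln n)^(1/4) is where two costs meet. Entries below it,
  rescaled to at most 1, yield norm (R / (ln n)^(1/4)) * O(sqrt (ln n)); entries above it have row
  and column sums at most R * (ln n)^(1/4), the same order. Smoothing acts twice. Marginals of at
  least 1 / (2 n) give R^2 its bound, and their positivity bounds every entry over W, so that the
  suprema are finite. The size 4 p of the comparison matrix leaves room for fresh labels: a walk of
  2 p steps has used at most 2 p of them, so at least 2 p remain, more than the row bound p. At this
  size a net has exp (O(p)) points, which a moment of order 2 p turns into a constant factor of the
  norm; the factor n of the trace is absorbed likewise, since n is at most exp p. Averages over
  signs and splits are kept as finite sums, compared with the number of their terms.\<close>

definition signs :: "'i set \<Rightarrow> ('i \<Rightarrow> real) set" where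
  "signs I = I \<rightarrow>\<^sub>E {- 1, 1}"

lemma finite_signs [simp]: "finite I \<Longrightarrow> finite (signs I)"
  by (simp add: signs_def finite_PiE)

lemma card_signs: "finite I \<Longrightarrow> card (signs I) = 2 ^ card I"
  by (simp add: signs_def card_PiE numeral_2_eq_2)

lemma signs_cases: "\<epsilon> \<in> signs I \<Longrightarrow> i \<in> I \<Longrightarrow> \<epsilon> i = - 1 \<or> \<epsilon> i = 1"
  by (auto simp: signs_def PiE_def Pi_def)

lemma sum_signs_insert:
  assumes "finite I" "e \<notin> I"
  shows "(\<Sum>\<epsilon>\<in>signs (insert e I). F \<epsilon>) = (\<Sum>\<epsilon>\<in>signs I. F (\<epsilon>(e := - 1)) + F (\<epsilon>(e := 1)))"
proof -
  have inj: "inj_on (\<lambda>(y, g). g(e := y)) ({- 1, 1} \<times> signs I)"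
    using inj_combinator[OF assms(2), of "\<lambda>_. {- 1, 1::real}"] by (simp add: signs_def)
  have "signs (insert e I) = (\<lambda>(y, g). g(e := y)) ` ({- 1, 1} \<times> signs I)"
    unfolding signs_def by (rule PiE_insert_eq)
  then have "(\<Sum>\<epsilon>\<in>signs (insert e I). F \<epsilon>) = (\<Sum>(y, g)\<in>{- 1, 1} \<times> signs I. F (g(e := y)))"
    by (simp add: sum.reindex[OF inj, unfolded case_prod_unfold] case_prod_unfold)
  also have "\<dots> = (\<Sum>y\<in>{- 1, 1}. \<Sum>g\<in>signs I. F (g(e := y)))"
    using assms by (simp add: sum.cartesian_product)
  finally show ?thesis by (simp add: sum.distrib)
qed

lemma bij_betw_signs:
  assumes "inj_on \<alpha> K"
  shows "bij_betw (\<lambda>\<epsilon>. restrict (\<epsilon> \<circ> \<alpha>) K) (signs (\<alpha> ` K)) (signs K)"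
proof (rule bij_betw_byWitness[of _ "\<lambda>\<delta>. restrict (\<delta> \<circ> inv_into K \<alpha>) (\<alpha> ` K)"])
  show "\<forall>\<epsilon>\<in>signs (\<alpha> ` K). restrict (restrict (\<epsilon> \<circ> \<alpha>) K \<circ> inv_into K \<alpha>) (\<alpha> ` K) = \<epsilon>"
    by (auto simp: signs_def fun_eq_iff inv_into_f_f[OF assms] restrict_def PiE_def extensional_def)
  show "\<forall>\<delta>\<in>signs K. restrict (restrict (\<delta> \<circ> inv_into K \<alpha>) (\<alpha> ` K) \<circ> \<alpha>) K = \<delta>"
    by (auto simp: signs_def fun_eq_iff inv_into_f_f[OF assms] restrict_def PiE_def extensional_def)
qed (auto simp: signs_def inv_into_f_f[OF assms] PiE_def Pi_def)

section \<open>Contraction for Rademacher averages\<close>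

lemma bounded_lincomb:
  fixes f :: "'i \<Rightarrow> 'x \<Rightarrow> real"
  assumes "finite I" and "bounded (A ` W)" and "\<And>i. i \<in> I \<Longrightarrow> bounded (f i ` W)"
  shows "bounded ((\<lambda>x. A x + (\<Sum>i\<in>I. c i * f i x)) ` W)"
  using assms
proof (induct I rule: finite_induct)
  case (insert i I)
  have "\<And>j. j \<in> I \<Longrightarrow> bounded (f j ` W)" using insert by auto
  note IH = insert(3)[OF insert(4) this]
  have "bounded ((\<lambda>x. c i * f i x) ` W)"
    using bounded_scaling[of "f i ` W" "c i"] insert by (simp add: image_image)
  then have "bounded ((\<lambda>x. c i * f i x + (A x + (\<Sum>i\<in>I. c i * f i x))) ` W)"
    using IH by (rule bounded_plus_comp)
  with insert(1,2) show ?case by (simp add: add.left_commute)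
qed simp

text \<open>For near-maximisers \<open>x\<close> and \<open>y\<close> of the two suprema on the
  left, the sign of \<open>g x - g y\<close> decides which of them is charged to the supremum with
  \<open>- g\<close> and which to the one with \<open>+ g\<close>. Boundedness makes every
  \<open>SUP\<close> here a genuine least upper bound.\<close>

lemma contraction_step:
  fixes a f g :: "'x \<Rightarrow> real"
  assumes "W \<noteq> {}"
    and lip: "\<And>x y. x \<in> W \<Longrightarrow> y \<in> W \<Longrightarrow> \<bar>f x - f y\<bar> \<le> \<bar>g x - g y\<bar>"
    and bd: "bounded (a ` W)" "bounded (g ` W)"
  shows "(SUP x\<in>W. a x - f x) + (SUP x\<in>W. a x + f x) \<le> (SUP x\<in>W. a x - g x) + (SUP x\<in>W. a x + g x)"
proof -
  define R where "R = (SUP x\<in>W. a x - g x) + (SUP x\<in>W. a x + g x)"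
  have up: "a x - g x \<le> (SUP x\<in>W. a x - g x)" "a x + g x \<le> (SUP x\<in>W. a x + g x)" if "x \<in> W" for x
    using that bounded_plus_comp[OF bd] bounded_minus_comp[OF bd]
    by (auto intro!: cSUP_upper dest: bounded_imp_bdd_above)
  have pair: "(a x - f x) + (a y + f y) \<le> R" if "x \<in> W" "y \<in> W" for x y
    using lip[OF that] up[OF that(1)] up[OF that(2)] unfolding R_def by linarith
  have "(SUP x\<in>W. a x - f x) \<le> R - (SUP x\<in>W. a x + f x)"
  proof (rule cSUP_least[OF \<open>W \<noteq> {}\<close>])
    fix x assume "x \<in> W"
    then have "(SUP y\<in>W. a y + f y) \<le> R - (a x - f x)"
      using pair[of x] by (intro cSUP_least[OF \<open>W \<noteq> {}\<close>]) (simp add: algebra_simps)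
    then show "a x - f x \<le> R - (SUP y\<in>W. a y + f y)" by linarith
  qed
  then show ?thesis unfolding R_def by linarith
qed

text \<open>The Ledoux-Talagrand contraction principle, with constant 1 because no absolute value
  stands outside the sum. The free offset \<open>a\<close> absorbs signs already exposed: the
  induction hypothesis serves both \<open>a - f e\<close> and \<open>a + f e\<close>, after which
  only the sign of \<open>e\<close> is left for exchanging \<open>f e\<close> with
  \<open>g e\<close>.\<close>

lemma rademacher_contraction:
  fixes f g :: "'i \<Rightarrow> 'x \<Rightarrow> real"
  assumes "finite I" and "W \<noteq> {}"
    and "\<And>i x y. i \<in> I \<Longrightarrow> x \<in> W \<Longrightarrow> y \<in> W \<Longrightarrow> \<bar>f i x - f i y\<bar> \<le> \<bar>g i x - g i y\<bar>"
    and "\<And>i. i \<in> I \<Longrightarrow> bounded (f i ` W)" "\<And>i. i \<in> I \<Longrightarrow> bounded (g i ` W)" "bounded (a ` W)"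
  shows "(\<Sum>\<epsilon>\<in>signs I. SUP x\<in>W. a x + (\<Sum>i\<in>I. \<epsilon> i * f i x))
      \<le> (\<Sum>\<epsilon>\<in>signs I. SUP x\<in>W. a x + (\<Sum>i\<in>I. \<epsilon> i * g i x))"
  using assms
proof (induct I arbitrary: a rule: finite_induct)
  case empty
  then show ?case by simp
next
  case (insert e I a)
  have upd: "a x + (\<Sum>i\<in>insert e I. (\<epsilon>(e := t)) i * h i x) = (a x + t * h e x) + (\<Sum>i\<in>I. \<epsilon> i * h i x)"
    for \<epsilon> t x and h :: "'i \<Rightarrow> 'x \<Rightarrow> real"
  proof -
    have "(\<Sum>i\<in>I. (\<epsilon>(e := t)) i * h i x) = (\<Sum>i\<in>I. \<epsilon> i * h i x)"
      using insert(2) by (intro sum.cong) auto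
    then show ?thesis using insert(1,2) by simp
  qed
  have bd: "bounded ((\<lambda>x. a x - f e x) ` W)" "bounded ((\<lambda>x. a x + f e x) ` W)"
    using insert by (auto intro!: bounded_plus_comp bounded_minus_comp)
  have "(\<Sum>\<epsilon>\<in>signs (insert e I). SUP x\<in>W. a x + (\<Sum>i\<in>insert e I. \<epsilon> i * f i x))
      = (\<Sum>\<epsilon>\<in>signs I. SUP x\<in>W. (a x - f e x) + (\<Sum>i\<in>I. \<epsilon> i * f i x))
        + (\<Sum>\<epsilon>\<in>signs I. SUP x\<in>W. (a x + f e x) + (\<Sum>i\<in>I. \<epsilon> i * f i x))"
    unfolding sum_signs_insert[OF insert(1,2)] upd by (simp add: sum.distrib)
  also have "\<dots> \<le> (\<Sum>\<epsilon>\<in>signs I. SUP x\<in>W. (a x - f e x) + (\<Sum>i\<in>I. \<epsilon> i * g i x))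
        + (\<Sum>\<epsilon>\<in>signs I. SUP x\<in>W. (a x + f e x) + (\<Sum>i\<in>I. \<epsilon> i * g i x))"
    using insert bd by (intro add_mono insert(3)) auto
  also have "\<dots> = (\<Sum>\<epsilon>\<in>signs I. (SUP x\<in>W. (a x + (\<Sum>i\<in>I. \<epsilon> i * g i x)) - f e x)
        + (SUP x\<in>W. (a x + (\<Sum>i\<in>I. \<epsilon> i * g i x)) + f e x))"
    by (simp add: sum.distrib add_ac diff_add_eq)
  also have "\<dots> \<le> (\<Sum>\<epsilon>\<in>signs I. (SUP x\<in>W. (a x + (\<Sum>i\<in>I. \<epsilon> i * g i x)) - g e x)
        + (SUP x\<in>W. (a x + (\<Sum>i\<in>I. \<epsilon> i * g i x)) + g e x))"
    using insert by (intro sum_mono contraction_step bounded_lincomb) auto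
  also have "\<dots> = (\<Sum>\<epsilon>\<in>signs (insert e I). SUP x\<in>W. a x + (\<Sum>i\<in>insert e I. \<epsilon> i * g i x))"
    unfolding sum_signs_insert[OF insert(1,2)] upd by (simp add: algebra_simps)
  finally show ?case .
qed

section \<open>Random subsets from random permutations\<close>

lemma ex_permutes_image:
  assumes U: "finite U" and A: "A \<subseteq> U" "B \<subseteq> U" "card A = card B"
  shows "\<exists>\<rho>. \<rho> permutes U \<and> \<rho> ` A = B"
proof -
  have fin: "finite A" "finite B" using U A finite_subset by auto
  have "card (U - A) = card (U - B)"
    using U A fin by (simp add: card_Diff_subset)
  then obtain g where g: "bij_betw g (U - A) (U - B)"
    using U by (metis finite_Diff finite_same_card_bij)
  obtain f where f: "bij_betw f A B"
    using fin A(3) by (metis finite_same_card_bij)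
  define \<rho> where "\<rho> x = (if x \<in> A then f x else if x \<in> U then g x else x)" for x
  have 1: "bij_betw \<rho> A B" using f by (simp add: \<rho>_def cong: bij_betw_cong)
  have 2: "bij_betw \<rho> (U - A) (U - B)"
    using g bij_betw_cong[of "U - A" \<rho> g "U - B"] by (simp add: \<rho>_def)
  have "bij_betw \<rho> (A \<union> (U - A)) (B \<union> (U - B))"
    by (rule bij_betw_combine[OF 1 2]) auto
  then have "bij_betw \<rho> U U" using A by (simp add: Un_absorb1)
  then have "\<rho> permutes U"
    using A by (intro bij_imp_permutes) (auto simp: \<rho>_def)
  moreover have "\<rho> ` A = B" using 1 by (simp add: bij_betw_def)
  ultimately show ?thesis by blast
qed

text \<open>Averaging over permutations forgets which set was moved: right composition with a
  permutation carrying \<open>A\<close> to \<open>S\<close> leaves the sum unchanged. For a fixed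
  permutation, taking images is a bijection on the subsets of that size. The double sum is evaluated
  in both orders.\<close>

lemma sum_permutes_subset:
  fixes h :: "'a set \<Rightarrow> real"
  assumes U: "finite U" and A: "A \<subseteq> U"
  shows "real (card {S. S \<subseteq> U \<and> card S = card A}) * (\<Sum>\<pi> | \<pi> permutes U. h (\<pi> ` A))
    = real (card {\<pi>. \<pi> permutes U}) * (\<Sum>S | S \<subseteq> U \<and> card S = card A. h S)"
proof -
  let ?\<S> = "{S. S \<subseteq> U \<and> card S = card A}"
  have eq: "(\<Sum>\<pi> | \<pi> permutes U. h (\<pi> ` S)) = (\<Sum>\<pi> | \<pi> permutes U. h (\<pi> ` A))" if "S \<in> ?\<S>" for S
  proof -
    have "S \<subseteq> U" "card A = card S" using that by auto
    from ex_permutes_image[OF U A this] obtain \<rho> where \<rho>: "\<rho> permutes U" "\<rho> ` A = S"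
      by blast
    show ?thesis
      using sum_permutations_compose_right[OF \<rho>(1), of "\<lambda>\<pi>. h (\<pi> ` A)"]
      by (simp add: \<rho>(2)[symmetric] image_comp)
  qed
  have "real (card ?\<S>) * (\<Sum>\<pi> | \<pi> permutes U. h (\<pi> ` A)) = (\<Sum>S\<in>?\<S>. \<Sum>\<pi> | \<pi> permutes U. h (\<pi> ` S))"
    using eq by simp
  also have "\<dots> = (\<Sum>\<pi> | \<pi> permutes U. \<Sum>S\<in>?\<S>. h (\<pi> ` S))"
    by (rule sum.swap)
  also have "\<dots> = (\<Sum>\<pi> | \<pi> permutes U. \<Sum>S\<in>?\<S>. h S)"
  proof (rule sum.cong[OF refl])
    fix \<pi> assume "\<pi> \<in> {\<pi>. \<pi> permutes U}"
    then have \<pi>: "\<pi> permutes U" by simp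
    have c: "card (\<pi> ` S) = card S" "card (inv \<pi> ` S) = card S" for S
      using permutes_inj[OF \<pi>] permutes_inj[OF permutes_inv[OF \<pi>]]
      by (auto intro!: card_image inj_on_subset[of _ UNIV])
    have inv_in: "inv \<pi> x \<in> U \<longleftrightarrow> x \<in> U" for x
      by (rule permutes_in_image[OF permutes_inv[OF \<pi>]])
    have "bij_betw ((`) \<pi>) ?\<S> ?\<S>"
      by (rule bij_betw_byWitness[of _ "(`) (inv \<pi>)"])
        (auto simp: c image_comp inv_in permutes_inv_o[OF \<pi>] permutes_in_image[OF \<pi>])
    then show "(\<Sum>S\<in>?\<S>. h (\<pi> ` S)) = (\<Sum>S\<in>?\<S>. h S)"
      by (rule sum.reindex_bij_betw)
  qed
  finally show ?thesis by simp
qed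

text \<open>A uniformly random \<open>s\<close>-subset of \<open>U\<close> arises by choosing a random matching of \<open>U\<close> and
  then one point of each matched pair by a fair coin.\<close>

lemma sum_subsets_le_matching:
  fixes h :: "'a set \<Rightarrow> real"
  assumes U: "finite U" "card U = 2 * s"
    and bd: "\<And>K \<theta>. K \<subseteq> U \<Longrightarrow> card K = s \<Longrightarrow> bij_betw \<theta> K (U - K) \<Longrightarrow>
      (\<Sum>\<epsilon>\<in>signs K. h ({k \<in> K. \<epsilon> k = 1} \<union> \<theta> ` {k \<in> K. \<epsilon> k = - 1})) \<le> 2 ^ s * B"
  shows "(\<Sum>S | S \<subseteq> U \<and> card S = s. h S) \<le> real (card {S. S \<subseteq> U \<and> card S = s}) * B"
proof -
  let ?N = "real (card {S. S \<subseteq> U \<and> card S = s})"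
  let ?P = "{\<pi>. \<pi> permutes U}"
  obtain K where K: "K \<subseteq> U" "card K = s"
    using obtain_subset_with_card_n[of s U] U by auto
  have finK: "finite K" using K U finite_subset by blast
  have "card (U - K) = card K" using U K finK by (simp add: card_Diff_subset)
  then obtain \<theta> where \<theta>: "bij_betw \<theta> K (U - K)"
    using U finK by (metis finite_Diff finite_same_card_bij)
  define A where "A \<delta> = {k \<in> K. \<delta> k = 1} \<union> \<theta> ` {k \<in> K. \<delta> k = - 1}" for \<delta> :: "'a \<Rightarrow> real"
  have A: "A \<delta> \<subseteq> U" "card (A \<delta>) = s" if "\<delta> \<in> signs K" for \<delta>
  proof -
    have im: "\<theta> ` {k \<in> K. \<delta> k = - 1} \<subseteq> U - K" using \<theta> by (auto simp: bij_betw_def)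
    then show "A \<delta> \<subseteq> U" using K by (auto simp: A_def)
    have "card (A \<delta>) = card {k \<in> K. \<delta> k = 1} + card (\<theta> ` {k \<in> K. \<delta> k = - 1})"
      unfolding A_def using im finK by (intro card_Un_disjoint) auto
    also have "card (\<theta> ` {k \<in> K. \<delta> k = - 1}) = card {k \<in> K. \<delta> k = - 1}"
      using \<theta> by (intro card_image) (auto simp: bij_betw_def inj_on_def)
    also have "card {k \<in> K. \<delta> k = 1} + card {k \<in> K. \<delta> k = - 1}
        = card ({k \<in> K. \<delta> k = 1} \<union> {k \<in> K. \<delta> k = - 1})"
      using finK by (intro card_Un_disjoint[symmetric]) auto
    also have "{k \<in> K. \<delta> k = 1} \<union> {k \<in> K. \<delta> k = - 1} = K"
      using signs_cases[OF that] by auto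
    finally show "card (A \<delta>) = s" using K by simp
  qed
  have main: "(\<Sum>\<delta>\<in>signs K. h (\<pi> ` A \<delta>)) \<le> 2 ^ s * B" if "\<pi> permutes U" for \<pi>
  proof -
    have inj: "inj \<pi>" using that by (rule permutes_inj)
    have inv: "inv \<pi> (\<pi> x) = x" "\<pi> (inv \<pi> x) = x" for x
      using permutes_inverses[OF that] by auto
    \<comment> \<open>The matching conjugated by \<open>\<pi>\<close>: the set that it builds from
      signs on the image of \<open>K\<close> is the image under \<open>\<pi>\<close> of the set that
      \<open>\<theta>\<close> builds from the pulled-back signs.\<close>
    define \<theta>' where "\<theta>' = \<pi> \<circ> \<theta> \<circ> inv \<pi>"
    have "bij_betw (inv \<pi>) (\<pi> ` K) K"
      by (rule bij_betw_byWitness[of _ \<pi>]) (auto simp: inv)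
    moreover have "bij_betw \<pi> (U - K) (U - \<pi> ` K)"
    proof -
      have "\<pi> ` (U - K) = U - \<pi> ` K"
        using inj permutes_image[OF that] by (simp add: image_set_diff)
      then show ?thesis using inj by (auto simp: bij_betw_def inj_on_def)
    qed
    ultimately have \<theta>': "bij_betw \<theta>' (\<pi> ` K) (U - \<pi> ` K)"
      unfolding \<theta>'_def using \<theta> by (auto intro: bij_betw_trans)
    have "\<pi> ` K \<subseteq> U" "card (\<pi> ` K) = s"
      using K permutes_image[OF that] inj by (auto simp: card_image inj_on_subset[of \<pi> UNIV])
    from bd[OF this \<theta>']
    have "(\<Sum>\<epsilon>\<in>signs (\<pi> ` K). h ({k \<in> \<pi> ` K. \<epsilon> k = 1} \<union> \<theta>' ` {k \<in> \<pi> ` K. \<epsilon> k = - 1})) \<le> 2 ^ s * B" .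
    also have "(\<Sum>\<epsilon>\<in>signs (\<pi> ` K). h ({k \<in> \<pi> ` K. \<epsilon> k = 1} \<union> \<theta>' ` {k \<in> \<pi> ` K. \<epsilon> k = - 1}))
        = (\<Sum>\<epsilon>\<in>signs (\<pi> ` K). h (\<pi> ` A (restrict (\<epsilon> \<circ> \<pi>) K)))"
    proof (intro sum.cong refl arg_cong[of _ _ h])
      fix \<epsilon> :: "'a \<Rightarrow> real"
      have 1: "{k \<in> \<pi> ` K. \<epsilon> k = t} = \<pi> ` {k \<in> K. restrict (\<epsilon> \<circ> \<pi>) K k = t}" for t by auto
      show "{k \<in> \<pi> ` K. \<epsilon> k = 1} \<union> \<theta>' ` {k \<in> \<pi> ` K. \<epsilon> k = - 1} = \<pi> ` A (restrict (\<epsilon> \<circ> \<pi>) K)"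
        unfolding 1 A_def image_Un \<theta>'_def image_comp by (simp add: o_def inv)
    qed
    also have "\<dots> = (\<Sum>\<delta>\<in>signs K. h (\<pi> ` A \<delta>))"
      by (rule sum.reindex_bij_betw[OF bij_betw_signs[OF inj_on_subset[OF inj subset_UNIV]]])
    finally show ?thesis .
  qed
  have P: "card ?P > 0" using U finite_permutations by (auto simp: card_gt_0_iff intro: permutes_id)
  \<comment> \<open>Both normalisations, \<open>2 ^ s\<close> sign patterns and
    \<open>card ?P\<close> permutations, are multiplied out. For each fixed \<open>\<delta>\<close>
    the set \<open>A \<delta>\<close> has size \<open>s\<close>, so a random permutation already
    spreads it uniformly.\<close>
  have "2 ^ s * (real (card ?P) * (\<Sum>S | S \<subseteq> U \<and> card S = s. h S))
      = (\<Sum>\<delta>\<in>signs K. ?N * (\<Sum>\<pi>\<in>?P. h (\<pi> ` A \<delta>)))"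
  proof -
    have "?N * (\<Sum>\<pi>\<in>?P. h (\<pi> ` A \<delta>)) = real (card ?P) * (\<Sum>S | S \<subseteq> U \<and> card S = s. h S)"
      if "\<delta> \<in> signs K" for \<delta>
      using sum_permutes_subset[OF U(1) A(1)[OF that], of h] A(2)[OF that] by simp
    then show ?thesis using finK K by (simp add: card_signs)
  qed
  also have "\<dots> = ?N * (\<Sum>\<pi>\<in>?P. \<Sum>\<delta>\<in>signs K. h (\<pi> ` A \<delta>))"
    unfolding sum_distrib_left[symmetric] by (subst sum.swap) simp
  also have "\<dots> \<le> ?N * (\<Sum>\<pi>\<in>?P. 2 ^ s * B)"
    by (intro mult_left_mono sum_mono main) auto
  also have "\<dots> = 2 ^ s * (real (card ?P) * (?N * B))" by simp
  finally show ?thesis using P by simp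
qed

section \<open>Duality for the trace norm\<close>

unbundle no inner_syntax

text \<open>The Hermitian form of an eigenvector, \<open>L\<close> in the proof, is its own
  conjugate by symmetry of \<open>S\<close>, and it equals \<open>z\<close> times a positive
  real.\<close>

lemma symmetric_mat_root_real:
  fixes S :: "real mat"
  assumes S: "S \<in> carrier_mat n n" and sym: "transpose_mat S = S"
    and root: "poly (char_poly (map_mat complex_of_real S)) z = 0"
  shows "Im z = 0"
proof -
  let ?A = "map_mat complex_of_real S"
  have A: "?A \<in> carrier_mat n n" using S by simp
  have sij: "S $$ (i, j) = S $$ (j, i)" if "i < n" "j < n" for i j
    using arg_cong[OF sym, of "\<lambda>M. M $$ (i, j)"] S that by simp
  from eigenvalue_root_char_poly[OF A] root have "eigenvalue ?A z" by simp
  then obtain v where "eigenvector ?A v z" unfolding eigenvalue_def by blast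
  then have v: "v \<in> carrier_vec n" "v \<noteq> 0\<^sub>v n" "?A *\<^sub>v v = z \<cdot>\<^sub>v v"
    using A unfolding eigenvector_def by auto
  have Av: "(\<Sum>j<n. complex_of_real (S $$ (i, j)) * v $ j) = z * v $ i" if "i < n" for i
  proof -
    have "(?A *\<^sub>v v) $ i = (\<Sum>j<n. complex_of_real (S $$ (i, j)) * v $ j)"
      using that S v(1) by (simp add: scalar_prod_def atLeast0LessThan)
    then show ?thesis using v that by simp
  qed
  define R where "R = (\<Sum>i<n. (cmod (v $ i))\<^sup>2)"
  define L where "L = (\<Sum>i<n. \<Sum>j<n. cnj (v $ i) * (complex_of_real (S $$ (i, j)) * v $ j))"
  have L1: "L = z * complex_of_real R"
  proof -
    have "L = (\<Sum>i<n. cnj (v $ i) * (z * v $ i))"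
      unfolding L_def sum_distrib_left[symmetric] using Av by simp
    also have "\<dots> = (\<Sum>i<n. z * complex_of_real ((cmod (v $ i))\<^sup>2))"
      by (intro sum.cong refl) (simp add: complex_norm_square[symmetric] mult.commute mult.left_commute)
    finally show ?thesis by (simp add: R_def sum_distrib_left)
  qed
  have "cnj L = (\<Sum>i<n. \<Sum>j<n. cnj (v $ j) * (complex_of_real (S $$ (j, i)) * v $ i))"
    unfolding L_def cnj_sum by (intro sum.cong refl) (simp add: sij)
  also have "\<dots> = L" unfolding L_def by (rule sum.swap)
  finally have "cnj L = L" .
  then have "cnj z * R = z * R" unfolding L1 by simp
  moreover have "R > 0"
  proof -
    from v obtain i where "i < n" "v $ i \<noteq> 0"
      by (metis carrier_vecD eq_vecI index_zero_vec(1) index_zero_vec(2))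
    then show ?thesis unfolding R_def by (intro sum_pos2[of _ i]) auto
  qed
  ultimately have "cnj z = z" by simp
  then show ?thesis by (simp add: complex_eq_iff)
qed

text \<open>Over the complex numbers the polynomial factors and its roots are real; the embedding of
  real polynomials is injective, so the factorisation descends.\<close>

lemma symmetric_char_poly_splits:
  fixes S :: "real mat"
  assumes S: "S \<in> carrier_mat n n" and sym: "transpose_mat S = S"
  shows "\<exists>es. char_poly S = (\<Prod>e\<leftarrow>es. [:- e, 1:])"
proof -
  let ?A = "map_mat complex_of_real S"
  have A: "?A \<in> carrier_mat n n" using S by simp
  obtain zs where zs: "char_poly ?A = (\<Prod>a\<leftarrow>zs. [:- a, 1:])"
    using char_poly_factorized[OF A] by blast
  have "poly (char_poly ?A) z = 0" if "z \<in> set zs" for z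
    using that unfolding zs by (induct zs) auto
  then have re: "complex_of_real (Re z) = z" if "z \<in> set zs" for z
    using symmetric_mat_root_real[OF S sym] that by (simp add: complex_eq_iff)
  interpret h: map_poly_inj_comm_ring_hom complex_of_real ..
  have "map_poly complex_of_real (char_poly S) = char_poly ?A"
    by (rule of_real_hom.char_poly_hom[OF S, symmetric])
  also have "\<dots> = (\<Prod>a\<leftarrow>map (complex_of_real \<circ> Re) zs. [:- a, 1:])"
    unfolding zs by (intro arg_cong[of _ _ prod_list]) (simp add: re)
  also have "\<dots> = map_poly complex_of_real (\<Prod>e\<leftarrow>map Re zs. [:- e, 1:])"
    by (simp add: h.hom_prod_list o_def)
  finally have "char_poly S = (\<Prod>e\<leftarrow>map Re zs. [:- e, 1:])"
    by simp
  then show ?thesis by blast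
qed

text \<open>Gram-Schmidt applied to a basis that starts with \<open>v\<close> leaves
  \<open>v\<close> in front; the normalised vectors are the columns, and \<open>c\<close> is the
  reciprocal of the norm of \<open>v\<close>.\<close>

lemma orthogonal_mat_first_col:
  fixes v :: "real Matrix.vec"
  assumes v: "v \<in> carrier_vec n" and v0: "v \<noteq> 0\<^sub>v n"
  shows "\<exists>W \<in> carrier_mat n n. \<exists>c. transpose_mat W * W = 1\<^sub>m n \<and> col W 0 = c \<cdot>\<^sub>v v"
proof -
  have n: "n \<noteq> 0" using v v0 by (metis carrier_vecD eq_vecI index_zero_vec(2) not_less_zero)
  interpret cof_vec_space n "TYPE(real)" .
  define b where "b = basis_completion v"
  define ws where "ws = gram_schmidt n b"
  have b: "distinct b" "\<not> lin_dep (set b)" "set b \<subseteq> carrier_vec n" "hd b = v" "length b = n"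
    using basis_completion[OF v v0] unfolding b_def by auto
  then obtain vs where bv: "b = v # vs" using n by (cases b) auto
  have ws: "set ws \<subseteq> carrier_vec n" "corthogonal ws" "length ws = n"
    using gram_schmidt_result[OF b(3,1,2) refl, folded ws_def] b(5) by auto
  have hdws: "hd ws = v" using gram_schmidt_hd[OF v, of vs] unfolding ws_def bv .
  have wsc: "ws ! i \<in> carrier_vec n" if "i < n" for i using ws that by auto
  have orth: "(ws ! i \<bullet> ws ! j = 0) = (i \<noteq> j)" if "i < n" "j < n" for i j
    using corthogonalD[OF ws(2), of i j] ws(3) that by (simp add: conjugate_vec_def vec_eq_iff)
  define c where "c i = 1 / sqrt (ws ! i \<bullet> ws ! i)" for i
  have cc: "c i * c i * (ws ! i \<bullet> ws ! i) = 1" if "i < n" for i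
  proof -
    have "ws ! i \<bullet> ws ! i \<ge> 0" by (auto simp: scalar_prod_def intro: sum_nonneg)
    then show ?thesis using orth[OF that that] by (simp add: c_def)
  qed
  define us where "us = map (\<lambda>i. c i \<cdot>\<^sub>v ws ! i) [0..<n]"
  define W where "W = mat_of_cols n us"
  have W: "W \<in> carrier_mat n n" unfolding W_def us_def by (simp add: mat_of_cols_def)
  have colW: "col W i = c i \<cdot>\<^sub>v ws ! i" if "i < n" for i
    unfolding W_def using that wsc[OF that] by (subst col_mat_of_cols) (auto simp: us_def)
  have "transpose_mat W * W = 1\<^sub>m n"
  proof (rule eq_matI)
    fix i j assume ij: "i < dim_row (1\<^sub>m n :: real mat)" "j < dim_col (1\<^sub>m n :: real mat)"
    then have "(transpose_mat W * W) $$ (i, j) = c i * c j * (ws ! i \<bullet> ws ! j)"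
      using W wsc colW smult_scalar_prod_distrib[of "ws ! i" n "c j \<cdot>\<^sub>v ws ! j" "c i"]
        scalar_prod_smult_distrib[of "ws ! i" n "ws ! j" "c j"] by simp
    then show "(transpose_mat W * W) $$ (i, j) = 1\<^sub>m n $$ (i, j)"
      using orth[of i j] cc[of i] ij by (cases "i = j") auto
  qed (use W in auto)
  moreover have "col W 0 = c 0 \<cdot>\<^sub>v v"
    using colW[of 0] n hdws ws(3) hd_conv_nth[of ws] by (cases ws) auto
  ultimately show ?thesis using W by blast
qed

text \<open>Deflation along the list of roots: an orthogonal matrix whose first column is an
  eigenvector turns \<open>S\<close> into a block matrix with \<open>e\<close> and a smaller
  symmetric \<open>S3\<close>, and cancelling the factor of \<open>e\<close> leaves the remaining
  roots to \<open>S3\<close>. Since the list is given in advance, the diagonal shows every root with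
  its multiplicity, as \<open>singular_values\<close> counts them.\<close>

lemma spectral_theorem:
  fixes S :: "real mat"
  assumes "S \<in> carrier_mat n n" and "transpose_mat S = S"
    and "char_poly S = (\<Prod>e\<leftarrow>es. [:- e, 1:])"
  shows "\<exists>P \<in> carrier_mat n n. transpose_mat P * P = 1\<^sub>m n \<and>
    transpose_mat P * S * P = mat_diag n (\<lambda>i. es ! i) \<and> length es = n"
  using assms
proof (induct es arbitrary: n S)
  case Nil
  then have "n = 0" using degree_monic_char_poly[of S n] by simp
  with Nil show ?case by (intro bexI[of _ "1\<^sub>m n"]) (auto simp: mat_diag_def)
next
  case (Cons e es n S)
  note S = Cons(2) and sym = Cons(3) and cp = Cons(4)
  define k where "k = n - 1"
  have root: "poly (char_poly S) e = 0" unfolding cp by simp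
  have ev: "eigenvalue S e" using root eigenvalue_root_char_poly[OF S] by simp
  then obtain v where "eigenvector S v e" unfolding eigenvalue_def by blast
  then have v: "v \<in> carrier_vec n" "v \<noteq> 0\<^sub>v n" and Sv: "S *\<^sub>v v = e \<cdot>\<^sub>v v"
    using S unfolding eigenvector_def by auto
  have n: "n = Suc k" unfolding k_def
    using v by (metis Suc_diff_1 carrier_vecD eq_vecI index_zero_vec(2) not_gr_zero not_less_zero)
  obtain W c where W: "W \<in> carrier_mat n n" and WW: "transpose_mat W * W = 1\<^sub>m n"
    and W0: "col W 0 = c \<cdot>\<^sub>v v"
    using orthogonal_mat_first_col[OF v] by blast
  have Wt: "transpose_mat W \<in> carrier_mat n n" using W by simp
  define S' where "S' = transpose_mat W * S * W"
  have S': "S' \<in> carrier_mat n n" unfolding S'_def using W S by simp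
  have symS': "transpose_mat S' = S'"
    unfolding S'_def using W S sym
      transpose_mult[of "transpose_mat W * S" n n W n] transpose_mult[of "transpose_mat W" n n S n]
    by (simp add: assoc_mult_mat[of _ n n _ n _ n])
  have WW2: "W * transpose_mat W = 1\<^sub>m n"
    by (rule mat_mult_left_right_inverse[OF Wt W WW])
  have "similar_mat_wit S' S (transpose_mat W) W"
    by (rule similar_mat_witI[OF WW WW2 _ S' S Wt W]) (simp add: S'_def)
  then have cpS': "char_poly S' = char_poly S"
    using char_poly_similar unfolding similar_mat_def by blast
  have col0: "S' $$ (i, 0) = (if i = 0 then e else 0)" if i: "i < n" for i
  proof -
    have "S' $$ (i, 0) = (transpose_mat W * (S * W)) $$ (i, 0)"
      unfolding S'_def using W S by (simp add: assoc_mult_mat[of _ n n _ n _ n])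
    also have "\<dots> = col W i \<bullet> (S *\<^sub>v col W 0)"
      using W S i n by (simp add: mult_mat_vec_def)
    also have "S *\<^sub>v col W 0 = e \<cdot>\<^sub>v col W 0"
      unfolding W0 using S v Sv by (simp add: mult_mat_vec smult_smult_assoc ac_simps)
    also have "col W i \<bullet> (e \<cdot>\<^sub>v col W 0) = e * (transpose_mat W * W) $$ (i, 0)"
      using W i n by simp
    finally show ?thesis unfolding WW using i n by simp
  qed
  have row0: "S' $$ (0, i) = (if i = 0 then e else 0)" if i: "i < n" for i
    using col0[OF i] arg_cong[OF symS', of "\<lambda>M. M $$ (0, i)"] S' i n by simp
  define S3 where "S3 = mat k k (\<lambda>(i, j). S' $$ (Suc i, Suc j))"
  define A1 where "A1 = mat 1 1 (\<lambda>_. e)"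
  have A1: "A1 \<in> carrier_mat 1 1" and S3: "S3 \<in> carrier_mat k k"
    by (auto simp: S3_def A1_def)
  have block: "S' = four_block_mat A1 (0\<^sub>m 1 k) (0\<^sub>m k 1) S3"
    by (rule eq_matI) (use S' n col0 row0 in \<open>auto simp: A1_def S3_def four_block_mat_def Let_def\<close>)
  have symS3: "transpose_mat S3 = S3"
  proof (rule eq_matI)
    fix i j assume "i < dim_row S3" "j < dim_col S3"
    then show "transpose_mat S3 $$ (i, j) = S3 $$ (i, j)"
      using arg_cong[OF symS', of "\<lambda>M. M $$ (Suc i, Suc j)"] S' n by (simp add: S3_def)
  qed (auto simp: S3_def)
  have "char_poly S' = char_poly A1 * char_poly S3"
    unfolding block by (rule char_poly_four_block_zeros_col[OF A1 _ S3]) simp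
  moreover have "char_poly A1 = [:- e, 1:]"
    by (simp add: A1_def char_poly_defs det_def sign_def)
  ultimately have "[:- e, 1:] * char_poly S3 = [:- e, 1:] * (\<Prod>e\<leftarrow>es. [:- e, 1:])"
    using cpS' cp by simp
  then have cp3: "char_poly S3 = (\<Prod>e\<leftarrow>es. [:- e, 1:])"
    by (metis mult_cancel_left pCons_eq_0_iff zero_neq_one)
  obtain P3 where P3: "P3 \<in> carrier_mat k k" and PP3: "transpose_mat P3 * P3 = 1\<^sub>m k"
    and D3: "transpose_mat P3 * S3 * P3 = mat_diag k (\<lambda>i. es ! i)" and len: "length es = k"
    using Cons(1)[OF S3 symS3 cp3] by blast
  define B where "B = four_block_mat (1\<^sub>m 1) (0\<^sub>m 1 k) (0\<^sub>m k 1) P3"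
  have B: "B \<in> carrier_mat n n" unfolding B_def n using P3 by auto
  have Bt: "transpose_mat B = four_block_mat (1\<^sub>m 1) (0\<^sub>m 1 k) (0\<^sub>m k 1) (transpose_mat P3)"
    unfolding B_def using P3 by (subst transpose_four_block_mat[of _ 1 1 _ k _ k]) auto
  have BB: "transpose_mat B * B = 1\<^sub>m n"
    unfolding Bt unfolding B_def
    by (subst mult_four_block_mat[of _ 1 1 _ k _ k _ _ 1 _ k])
      (use P3 PP3 in \<open>auto simp: n four_block_one_mat\<close>)
  have BSB: "transpose_mat B * S' * B = mat_diag n (\<lambda>i. (e # es) ! i)"
  proof -
    have "transpose_mat B * S' * B
        = four_block_mat A1 (0\<^sub>m 1 k) (0\<^sub>m k 1) (transpose_mat P3 * S3 * P3)"
      unfolding Bt block unfolding B_def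
      apply (subst mult_four_block_mat[of _ 1 1 _ k _ k _ _ 1 _ k])
      using P3 A1 S3 apply (auto)
      apply (subst mult_four_block_mat[of _ 1 1 _ k _ k _ _ 1 _ k])
      using P3 A1 S3 by auto
    also have "\<dots> = mat_diag n (\<lambda>i. (e # es) ! i)"
      unfolding D3
      by (rule eq_matI) (auto simp: A1_def n four_block_mat_def Let_def mat_diag_def)
    finally show ?thesis .
  qed
  have "transpose_mat (W * B) * (W * B) = transpose_mat B * (transpose_mat W * W) * B"
    using W B by (simp add: transpose_mult[of _ n n] assoc_mult_mat[of _ n n _ n _ n])
  then have 1: "transpose_mat (W * B) * (W * B) = 1\<^sub>m n" using WW BB B by simp
  have "transpose_mat (W * B) * S * (W * B) = transpose_mat B * S' * B"
    unfolding S'_def using W B S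
    by (simp add: transpose_mult[of _ n n] assoc_mult_mat[of _ n n _ n _ n])
  then show ?case using 1 BSB W B len n by (intro bexI[of _ "W * B"]) auto
qed


text \<open>Only the diagonal entries of \<open>P\<^sup>T A\<^sup>T A P\<close> and \<open>P\<^sup>T R\<^sup>T A P\<close> matter, with \<open>P\<close> the
  orthogonal matrix diagonalising \<open>A\<^sup>T A\<close>.\<close>

lemma trace_norm_duality:
  fixes A :: "real mat" and R :: "nat \<Rightarrow> nat \<Rightarrow> real"
  assumes A: "A \<in> carrier_mat n m"
    and bil: "\<And>u v. (\<Sum>i<n. (u i)\<^sup>2) \<le> 1 \<Longrightarrow> (\<Sum>j<m. (v j)\<^sup>2) \<le> 1 \<Longrightarrow>
      (\<Sum>i<n. \<Sum>j<m. R i j * u i * v j) \<le> B"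
  shows "(\<Sum>i<n. \<Sum>j<m. R i j * A $$ (i, j)) \<le> B * trace_norm A"
proof -
  define S where "S = transpose_mat A * A"
  have S: "S \<in> carrier_mat m m" and symS: "transpose_mat S = S"
    using A transpose_mult[of "transpose_mat A" m n A m] by (auto simp: S_def)
  obtain es where es: "char_poly S = (\<Prod>e\<leftarrow>es. [:- e, 1:])"
    using symmetric_char_poly_splits[OF S symS] by blast
  obtain P where P: "P \<in> carrier_mat m m" and PP: "transpose_mat P * P = 1\<^sub>m m"
    and D: "transpose_mat P * S * P = mat_diag m (\<lambda>i. es ! i)" and len: "length es = m"
    using spectral_theorem[OF S symS es] by blast
  have Pt: "transpose_mat P \<in> carrier_mat m m" using P by simp
  have PP2: "P * transpose_mat P = 1\<^sub>m m"
    by (rule mat_mult_left_right_inverse[OF Pt P PP])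
  have "proots (char_poly S) = mset es"
    unfolding es
  proof (induct es)
    case (Cons e es)
    have "(\<Prod>e\<leftarrow>es. [:- e, 1:]) \<noteq> (0 :: real poly)" by (auto simp: prod_list_zero_iff)
    then show ?case using Cons by (simp add: proots_mult del: mult_pCons_left)
  qed simp
  then have tn: "trace_norm A = (\<Sum>k<m. sqrt (es ! k))"
    unfolding trace_norm_def singular_values_def S_def[symmetric]
    by (simp flip: mset_map add: sum_mset_sum_list sum_list_sum_nth len atLeast0LessThan)
  define w where "w k i = P $$ (i, k)" for k i
  have wnorm: "(\<Sum>j<m. (w k j)\<^sup>2) = 1" if "k < m" for k
    using arg_cong[OF PP, of "\<lambda>M. M $$ (k, k)"] P that
    by (simp add: scalar_prod_def w_def power2_eq_square atLeast0LessThan)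
  have worth: "(\<Sum>k<m. w k j * w k j') = (if j = j' then 1 else 0)" if "j < m" "j' < m" for j j'
    using arg_cong[OF PP2, of "\<lambda>M. M $$ (j, j')"] P that
    by (simp add: scalar_prod_def w_def atLeast0LessThan)
  \<comment> \<open>The image under \<open>A\<close> of the eigenvector \<open>w k\<close>; its
    squared norm is \<open>es ! k\<close>. Writing \<open>A\<close> as the sum of the products of
    \<open>z k\<close> and \<open>w k\<close> is a singular value decomposition with unnormalised
    left vectors.\<close>
  define z where "z k i = (\<Sum>j<m. A $$ (i, j) * w k j)" for k i
  have znorm: "(\<Sum>i<n. (z k i)\<^sup>2) = es ! k" if k: "k < m" for k
  proof -
    have "transpose_mat P * S * P = transpose_mat (A * P) * (A * P)"
      unfolding S_def using A P transpose_mult[OF A P]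
      by (simp add: assoc_mult_mat[of _ m m _ m _ m] assoc_mult_mat[of _ m m _ n _ m]
          assoc_mult_mat[of _ m n _ m _ m])
    then have "es ! k = col (A * P) k \<bullet> col (A * P) k"
      using arg_cong[OF D, of "\<lambda>M. M $$ (k, k)"] A P k by (simp add: mat_diag_def)
    also have "\<dots> = (\<Sum>i<n. (z k i)\<^sup>2)"
      using A P k by (simp add: scalar_prod_def z_def w_def power2_eq_square atLeast0LessThan)
    finally show ?thesis by simp
  qed
  have expand: "(\<Sum>k<m. z k i * w k j) = A $$ (i, j)" if "j < m" for i j
  proof -
    have "(\<Sum>k<m. z k i * w k j) = (\<Sum>j'<m. A $$ (i, j') * (\<Sum>k<m. w k j' * w k j))"
      unfolding z_def sum_distrib_right sum_distrib_left
      by (subst sum.swap) (simp add: mult.assoc)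
    also have "\<dots> = (\<Sum>j'<m. if j' = j then A $$ (i, j') else 0)"
      using that by (intro sum.cong refl) (simp add: worth)
    finally show ?thesis using that by simp
  qed
  have bound: "(\<Sum>i<n. \<Sum>j<m. R i j * z k i * w k j) \<le> B * sqrt (es ! k)" if k: "k < m" for k
  proof (cases "es ! k = 0")
    \<comment> \<open>A zero singular value offers no left vector to normalise, but then
      \<open>z k\<close> itself vanishes.\<close>
    case True
    have "z k i = 0" if "i < n" for i
      using znorm[OF k] True that by (simp add: sum_nonneg_eq_0_iff)
    then show ?thesis using True by simp
  next
    case False
    have pos: "es ! k > 0" using False znorm[OF k] by (metis less_eq_real_def sum_nonneg zero_le_power2)
    define u where "u i = z k i / sqrt (es ! k)" for i
    have "(\<Sum>i<n. (u i)\<^sup>2) = (\<Sum>i<n. (z k i)\<^sup>2) / es ! k"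
      using pos by (simp add: u_def power_divide sum_divide_distrib)
    then have "(\<Sum>i<n. (u i)\<^sup>2) \<le> 1" using znorm[OF k] pos by simp
    from bil[OF this, of "w k"] wnorm[OF k]
    have "(\<Sum>i<n. \<Sum>j<m. R i j * u i * w k j) \<le> B" by simp
    moreover have "(\<Sum>i<n. \<Sum>j<m. R i j * z k i * w k j)
        = sqrt (es ! k) * (\<Sum>i<n. \<Sum>j<m. R i j * u i * w k j)"
      unfolding sum_distrib_left using pos by (intro sum.cong refl) (simp add: u_def)
    ultimately show ?thesis using pos
      by (simp add: mult.commute mult_right_mono)
  qed
  have "(\<Sum>i<n. \<Sum>j<m. R i j * A $$ (i, j)) = (\<Sum>i<n. \<Sum>j<m. \<Sum>k<m. R i j * z k i * w k j)"
    by (intro sum.cong refl) (simp add: expand[symmetric] sum_distrib_left mult.assoc)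
  also have "\<dots> = (\<Sum>i<n. \<Sum>k<m. \<Sum>j<m. R i j * z k i * w k j)"
    by (intro sum.cong refl sum.swap)
  also have "\<dots> = (\<Sum>k<m. \<Sum>i<n. \<Sum>j<m. R i j * z k i * w k j)"
    by (rule sum.swap)
  also have "\<dots> \<le> (\<Sum>k<m. B * sqrt (es ! k))"
    by (intro sum_mono bound) simp
  finally show ?thesis by (simp add: tn sum_distrib_left)
qed

section \<open>The trace method\<close>

definition words :: "nat \<Rightarrow> nat \<Rightarrow> nat list set" where
  "words n L = {w. set w \<subseteq> {..<n} \<and> length w = L}"

lemma finite_words [simp]: "finite (words n L)"
  unfolding words_def by (rule finite_lists_length_eq) simp

lemma sum_words_Suc: "(\<Sum>w\<in>words n (Suc L). F w) = (\<Sum>w\<in>words n L. \<Sum>x<n. F (x # w))"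
proof -
  have "(\<Sum>w\<in>words n (Suc L). F w) = (\<Sum>z\<in>words n L \<times> {..<n}. F (snd z # fst z))"
    unfolding words_def lists_length_Suc_eq by (subst sum.reindex) (auto simp: inj_on_def case_prod_unfold)
  then show ?thesis by (simp add: sum.cartesian_product case_prod_unfold)
qed

text \<open>A word is read as a walk in the complete bipartite graph that alternates between columns and
  rows; the last letter is a row. Edges are listed as pairs (row, column).\<close>

fun edges :: "nat list \<Rightarrow> (nat \<times> nat) list" where
  "edges (x # y # w) = (if odd (length w) then (x, y) else (y, x)) # edges (y # w)"
| "edges w = []"

text \<open>The starting point is written at both ends, hence \<open>2 * p + 1\<close> letters for
  \<open>2 * p\<close> steps; odd length makes both ends rows.\<close>

definition closed_walks :: "nat \<Rightarrow> nat \<Rightarrow> nat list set" where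
  "closed_walks n p = {w \<in> words n (2 * p + 1). hd w = last w}"

lemma finite_closed_walks [simp]: "finite (closed_walks n p)"
  by (simp add: closed_walks_def)

text \<open>The trace of the \<open>p\<close>-th power of \<open>Q Q\<^sup>T\<close>.\<close>

definition trace_pow :: "nat \<Rightarrow> nat \<Rightarrow> (nat \<times> nat \<Rightarrow> real) \<Rightarrow> real" where
  "trace_pow n p Q = (\<Sum>w\<in>closed_walks n p. prod_list (map Q (edges w)))"

definition lin :: "nat \<Rightarrow> (nat \<times> nat \<Rightarrow> real) \<Rightarrow> (nat \<Rightarrow> real) \<Rightarrow> nat \<Rightarrow> real" where
  "lin n Q f = (\<lambda>i. \<Sum>j<n. Q (i, j) * f j)"

definition linT :: "nat \<Rightarrow> (nat \<times> nat \<Rightarrow> real) \<Rightarrow> (nat \<Rightarrow> real) \<Rightarrow> nat \<Rightarrow> real" where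
  "linT n Q f = (\<lambda>j. \<Sum>i<n. Q (i, j) * f i)"

definition gram :: "nat \<Rightarrow> (nat \<times> nat \<Rightarrow> real) \<Rightarrow> (nat \<Rightarrow> real) \<Rightarrow> nat \<Rightarrow> real" where
  "gram n Q f = lin n Q (linT n Q f)"

definition ip :: "nat \<Rightarrow> (nat \<Rightarrow> real) \<Rightarrow> (nat \<Rightarrow> real) \<Rightarrow> real" where
  "ip n f g = (\<Sum>i<n. f i * g i)"

abbreviation unit_fun :: "nat \<Rightarrow> nat \<Rightarrow> real" where
  "unit_fun y \<equiv> (\<lambda>x. if x = y then 1 else 0)"

text \<open>Unfolding one factor Q Q^T puts a step to a column and a step back to a row in front of
  the walk; \<open>f\<close> is evaluated where the walk ends.\<close>

lemma gram_pow_walks: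
  "x < n \<Longrightarrow> (gram n Q ^^ p) f x
    = (\<Sum>w\<in>words n (2 * p). prod_list (map Q (edges (x # w))) * f (last (x # w)))"
proof (induct p arbitrary: x)
  case 0
  have "words n 0 = {[]}" by (auto simp: words_def)
  then show ?case by simp
next
  case (Suc p)
  have "(gram n Q ^^ Suc p) f x = (\<Sum>y<n. Q (x, y) * (\<Sum>z<n. Q (z, y) * (gram n Q ^^ p) f z))"
    by (simp add: gram_def lin_def linT_def)
  also have "\<dots> = (\<Sum>y<n. Q (x, y) * (\<Sum>z<n. Q (z, y) *
      (\<Sum>w\<in>words n (2 * p). prod_list (map Q (edges (z # w))) * f (last (z # w)))))"
    using Suc(1) by simp
  also have "\<dots> = (\<Sum>y<n. \<Sum>z<n. \<Sum>w\<in>words n (2 * p). Q (x, y) * Q (z, y) *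
      (prod_list (map Q (edges (z # w))) * f (last (z # w))))"
    by (simp add: sum_distrib_left mult.assoc)
  also have "\<dots> = (\<Sum>y<n. \<Sum>w\<in>words n (2 * p). \<Sum>z<n. Q (x, y) * Q (z, y) *
      (prod_list (map Q (edges (z # w))) * f (last (z # w))))"
    by (intro sum.cong[OF refl] sum.swap)
  also have "\<dots> = (\<Sum>w\<in>words n (2 * p). \<Sum>y<n. \<Sum>z<n. Q (x, y) * Q (z, y) *
      (prod_list (map Q (edges (z # w))) * f (last (z # w))))"
    by (rule sum.swap)
  also have "\<dots> = (\<Sum>w\<in>words n (2 * p). \<Sum>z<n. \<Sum>y<n. Q (x, y) * Q (z, y) *
      (prod_list (map Q (edges (z # w))) * f (last (z # w))))"
    by (intro sum.cong[OF refl] sum.swap)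
  also have "\<dots> = (\<Sum>w\<in>words n (2 * p). \<Sum>z<n. \<Sum>y<n.
      prod_list (map Q (edges (x # y # z # w))) * f (last (x # y # z # w)))"
    by (intro sum.cong[OF refl]) (auto simp: words_def)
  also have "\<dots> = (\<Sum>w\<in>words n (2 * Suc p). prod_list (map Q (edges (x # w))) * f (last (x # w)))"
    by (simp add: sum_words_Suc)
  finally show ?case .
qed

lemma trace_pow_gram: "trace_pow n p Q = (\<Sum>y<n. (gram n Q ^^ p) (unit_fun y) y)"
proof -
  have "trace_pow n p Q = (\<Sum>w\<in>words n (Suc (2 * p)). if hd w = last w then prod_list (map Q (edges w)) else 0)"
    unfolding trace_pow_def closed_walks_def by (simp add: sum.inter_filter)
  also have "\<dots> = (\<Sum>y<n. \<Sum>w\<in>words n (2 * p). prod_list (map Q (edges (y # w))) * unit_fun y (last (y # w)))"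
    unfolding sum_words_Suc by (subst sum.swap) (auto intro!: sum.cong)
  also have "\<dots> = (\<Sum>y<n. (gram n Q ^^ p) (unit_fun y) y)"
    by (intro sum.cong[OF refl] gram_pow_walks[symmetric]) simp
  finally show ?thesis .
qed

lemma gram_pow_linear:
  assumes "x < n"
  shows "(gram n Q ^^ p) f x = (\<Sum>y<n. f y * (gram n Q ^^ p) (unit_fun y) x)"
proof -
  have last: "last (x # w) < n" if "w \<in> words n (2 * p)" for w
  proof -
    have "last (x # w) \<in> set (x # w)" by (rule last_in_set) simp
    also have "\<dots> \<subseteq> {..<n}" using that assms by (auto simp: words_def)
    finally show ?thesis by simp
  qed
  have "(\<Sum>y<n. f y * (gram n Q ^^ p) (unit_fun y) x)
      = (\<Sum>w\<in>words n (2 * p). \<Sum>y<n. f y * (prod_list (map Q (edges (x # w))) * unit_fun y (last (x # w))))"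
    unfolding gram_pow_walks[OF assms] sum_distrib_left by (rule sum.swap)
  also have "\<dots> = (\<Sum>w\<in>words n (2 * p). prod_list (map Q (edges (x # w))) * f (last (x # w)))"
  proof (rule sum.cong[OF refl])
    fix w assume "w \<in> words n (2 * p)"
    have "(\<Sum>y<n. f y * (prod_list (map Q (edges (x # w))) * unit_fun y (last (x # w))))
        = (\<Sum>y<n. if last (x # w) = y then prod_list (map Q (edges (x # w))) * f y else 0)"
      by (intro sum.cong[OF refl]) simp
    also have "\<dots> = prod_list (map Q (edges (x # w))) * f (last (x # w))"
      using last[OF \<open>w \<in> words n (2 * p)\<close>] by (subst sum.delta') auto
    finally show "(\<Sum>y<n. f y * (prod_list (map Q (edges (x # w))) * unit_fun y (last (x # w))))
        = prod_list (map Q (edges (x # w))) * f (last (x # w))" .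
  qed
  finally show ?thesis using gram_pow_walks[OF assms] by simp
qed

section \<open>Bilinear forms against traces\<close>

lemma ip_commute: "ip n f g = ip n g f"
  by (simp add: ip_def mult.commute)

lemma ip_self: "ip n f f = (\<Sum>i<n. (f i)\<^sup>2)"
  by (simp add: ip_def power2_eq_square)

lemma ip_self_nonneg: "ip n f f \<ge> 0"
  by (simp add: ip_self sum_nonneg)

lemma ip_Cauchy_Schwarz: "(ip n f g)\<^sup>2 \<le> ip n f f * ip n g g"
  unfolding ip_self unfolding ip_def by (rule Cauchy_Schwarz_ineq_sum)

lemma ip_lin: "ip n f (lin n Q g) = (\<Sum>i<n. \<Sum>j<n. Q (i, j) * f i * g j)"
  by (simp add: ip_def lin_def sum_distrib_left ac_simps)

lemma ip_linT: "ip n (linT n Q f) g = (\<Sum>i<n. \<Sum>j<n. Q (i, j) * f i * g j)"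
  unfolding ip_def linT_def sum_distrib_right by (rule sum.swap)

lemma ip_gram: "ip n f (gram n Q g) = ip n (linT n Q f) (linT n Q g)"
  by (simp add: gram_def ip_lin ip_linT)

lemma ip_gram_commute: "ip n f (gram n Q g) = ip n (gram n Q f) g"
  by (metis ip_gram ip_commute)

lemma ip_gram_pow: "ip n f ((gram n Q ^^ (p + q)) g) = ip n ((gram n Q ^^ p) f) ((gram n Q ^^ q) g)"
proof (induct p arbitrary: f)
  case (Suc p)
  have "ip n f ((gram n Q ^^ (Suc p + q)) g) = ip n (gram n Q f) ((gram n Q ^^ (p + q)) g)"
    by (simp add: ip_gram_commute)
  also have "\<dots> = ip n ((gram n Q ^^ p) (gram n Q f)) ((gram n Q ^^ q) g)" by (rule Suc)
  finally show ?case by (simp add: funpow_swap1)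
qed simp

lemma ip_unit_fun: "y < n \<Longrightarrow> ip n (unit_fun y) g = g y"
  by (simp add: ip_def if_distrib[of "\<lambda>c. c * _"] cong: if_cong)

text \<open>Repeated squaring takes the place of eigenvalues. With G = Q Q^T, Cauchy-Schwarz bounds
  the squared form by <u, G u>, and each further use doubles the exponent of G, whence the powers of
  two. At the end <u, G^(2 q) u> is the squared norm of G^q u, at most the sum of the squared
  entries of G^q, which is the trace of G^(2 q); this halving accounts for the
  \<open>Suc\<close>.\<close>

lemma bilinear_pow_le_trace_pow:
  assumes u: "(\<Sum>i<n. (u i)\<^sup>2) \<le> 1" and v: "(\<Sum>i<n. (v i)\<^sup>2) \<le> 1"
  shows "(\<Sum>i<n. \<Sum>j<n. Q (i, j) * u i * v j) ^ (2 * 2 ^ Suc k) \<le> trace_pow n (2 ^ Suc k) Q"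
proof -
  let ?G = "\<lambda>p. gram n Q ^^ p"
  have u': "ip n u u \<le> 1" and v': "ip n v v \<le> 1" using u v by (auto simp: ip_self)
  have "(\<Sum>i<n. \<Sum>j<n. Q (i, j) * u i * v j)\<^sup>2 = (ip n (linT n Q u) v)\<^sup>2"
    by (simp add: ip_linT)
  also have "\<dots> \<le> ip n (linT n Q u) (linT n Q u) * ip n v v" by (rule ip_Cauchy_Schwarz)
  also have "\<dots> \<le> ip n (linT n Q u) (linT n Q u)"
    using mult_left_mono[OF v' ip_self_nonneg] by simp
  also have "\<dots> = ip n u (?G 1 u)" by (simp add: ip_gram)
  finally have 1: "(\<Sum>i<n. \<Sum>j<n. Q (i, j) * u i * v j)\<^sup>2 \<le> ip n u (?G 1 u)" .
  have 2: "((\<Sum>i<n. \<Sum>j<n. Q (i, j) * u i * v j)\<^sup>2) ^ (2 ^ k) \<le> ip n u (?G (2 ^ k) u)" for k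
  proof (induct k)
    case 0
    then show ?case using 1 by simp
  next
    case (Suc k)
    have "((\<Sum>i<n. \<Sum>j<n. Q (i, j) * u i * v j)\<^sup>2) ^ (2 ^ Suc k)
        = (((\<Sum>i<n. \<Sum>j<n. Q (i, j) * u i * v j)\<^sup>2) ^ (2 ^ k))\<^sup>2"
      by (simp add: mult.commute flip: power_mult)
    also have "\<dots> \<le> (ip n u (?G (2 ^ k) u))\<^sup>2"
      by (intro power_mono Suc) simp
    also have "\<dots> \<le> ip n u u * ip n (?G (2 ^ k) u) (?G (2 ^ k) u)" by (rule ip_Cauchy_Schwarz)
    also have "\<dots> \<le> ip n (?G (2 ^ k) u) (?G (2 ^ k) u)"
      using mult_right_mono[OF u' ip_self_nonneg] by simp
    also have "\<dots> = ip n u (?G (2 ^ Suc k) u)"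
      by (simp add: ip_gram_pow[symmetric] mult_2)
    finally show ?case .
  qed
  let ?q = "2 ^ k :: nat"
  have "ip n u (?G (2 ^ Suc k) u) = (\<Sum>x<n. (?G ?q u x)\<^sup>2)"
    by (simp add: mult_2 ip_gram_pow ip_self)
  also have "\<dots> \<le> (\<Sum>x<n. \<Sum>y<n. (?G ?q (unit_fun y) x)\<^sup>2)"
  proof (rule sum_mono)
    fix x assume "x \<in> {..<n}"
    then have "(?G ?q u x)\<^sup>2 = (\<Sum>y<n. u y * ?G ?q (unit_fun y) x)\<^sup>2"
      using gram_pow_linear[of x n ?q Q u] by simp
    also have "\<dots> \<le> (\<Sum>y<n. (u y)\<^sup>2) * (\<Sum>y<n. (?G ?q (unit_fun y) x)\<^sup>2)"
      by (rule Cauchy_Schwarz_ineq_sum)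
    also have "\<dots> \<le> (\<Sum>y<n. (?G ?q (unit_fun y) x)\<^sup>2)"
      using mult_right_mono[OF u, of "\<Sum>y<n. (?G ?q (unit_fun y) x)\<^sup>2"] by (simp add: sum_nonneg)
    finally show "(?G ?q u x)\<^sup>2 \<le> (\<Sum>y<n. (?G ?q (unit_fun y) x)\<^sup>2)" .
  qed
  also have "\<dots> = (\<Sum>y<n. ip n (?G ?q (unit_fun y)) (?G ?q (unit_fun y)))"
    unfolding ip_self by (rule sum.swap)
  also have "\<dots> = (\<Sum>y<n. ?G (?q + ?q) (unit_fun y) y)"
    unfolding ip_gram_pow[symmetric] by (intro sum.cong[OF refl] ip_unit_fun) simp
  also have "\<dots> = trace_pow n (2 ^ Suc k) Q"
    by (simp add: trace_pow_gram mult_2)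
  finally show ?thesis using 2[of "Suc k"] by (simp add: power_mult)
qed

text \<open>\<open>K\<close> bounds the squared operator norm, hence each of the \<open>n\<close>
  diagonal entries of the \<open>p\<close>-th power of Q Q^T is at most
  \<open>K ^ p\<close>.\<close>

lemma trace_pow_le:
  assumes bil: "\<And>f g. (\<Sum>i<n. \<Sum>j<n. Q (i, j) * f i * g j)\<^sup>2 \<le> K * (\<Sum>i<n. (f i)\<^sup>2) * (\<Sum>j<n. (g j)\<^sup>2)"
    and K: "K \<ge> 0"
  shows "trace_pow n p Q \<le> real n * K ^ p"
proof -
  have bil': "(\<Sum>i<n. \<Sum>j<n. Q (i, j) * f i * g j)\<^sup>2 \<le> K * ip n f f * ip n g g" for f g
    using bil by (simp add: ip_self)
  \<comment> \<open>Testing the form against \<open>linT n Q f\<close> or \<open>lin n Q f\<close>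
    itself gives x^2 <= K * y * x for the squared norm x of that vector; one factor x
    cancels.\<close>
  have cancel: "x \<le> K * y" if "x\<^sup>2 \<le> K * y * x" "x \<ge> 0" "y \<ge> 0" for x y
  proof (cases "x = 0")
    case False
    then have "x * x \<le> K * y * x" "x > 0" using that by (auto simp: power2_eq_square)
    then show ?thesis by (rule mult_right_le_imp_le)
  qed (use that K in simp)
  have T: "ip n (linT n Q f) (linT n Q f) \<le> K * ip n f f" for f
  proof (intro cancel ip_self_nonneg)
    show "(ip n (linT n Q f) (linT n Q f))\<^sup>2 \<le> K * ip n f f * ip n (linT n Q f) (linT n Q f)"
      using bil'[of f "linT n Q f"] unfolding ip_linT[of n Q f "linT n Q f", symmetric] .
  qed
  have L: "ip n (lin n Q f) (lin n Q f) \<le> K * ip n f f" for f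
  proof (intro cancel ip_self_nonneg)
    show "(ip n (lin n Q f) (lin n Q f))\<^sup>2 \<le> K * ip n f f * ip n (lin n Q f) (lin n Q f)"
      using bil'[of "lin n Q f" f] unfolding ip_lin[of n "lin n Q f" Q f, symmetric] by (simp only: mult_ac)
  qed
  have G: "ip n (gram n Q f) (gram n Q f) \<le> K\<^sup>2 * ip n f f" for f
    using L[of "linT n Q f"] mult_left_mono[OF T[of f] K]
    by (simp add: gram_def power2_eq_square mult.assoc)
  have P: "ip n ((gram n Q ^^ p) f) ((gram n Q ^^ p) f) \<le> (K ^ p)\<^sup>2 * ip n f f" for f
  proof (induct p)
    case (Suc p)
    have "ip n ((gram n Q ^^ Suc p) f) ((gram n Q ^^ Suc p) f) \<le> K\<^sup>2 * ip n ((gram n Q ^^ p) f) ((gram n Q ^^ p) f)"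
      using G by simp
    also have "\<dots> \<le> K\<^sup>2 * ((K ^ p)\<^sup>2 * ip n f f)" using Suc by (intro mult_left_mono) auto
    finally show ?case by (simp add: power2_eq_square ac_simps)
  qed simp
  have "(gram n Q ^^ p) (unit_fun y) y \<le> K ^ p" if y: "y < n" for y
  proof (rule power2_le_imp_le)
    have "((gram n Q ^^ p) (unit_fun y) y)\<^sup>2 \<le> ip n ((gram n Q ^^ p) (unit_fun y)) ((gram n Q ^^ p) (unit_fun y))"
      unfolding ip_self using y by (intro member_le_sum) auto
    also have "\<dots> \<le> (K ^ p)\<^sup>2 * ip n (unit_fun y) (unit_fun y)" by (rule P)
    finally show "((gram n Q ^^ p) (unit_fun y) y)\<^sup>2 \<le> (K ^ p)\<^sup>2" using y by (simp add: ip_unit_fun)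
  qed (use K in simp)
  then have "trace_pow n p Q \<le> real (card {..<n}) * K ^ p"
    unfolding trace_pow_gram by (intro sum_bounded_above) auto
  then show ?thesis by simp
qed

section \<open>Even walks and their patterns\<close>

lemma edges_map: "edges (map f w) = map (map_prod f f) (edges w)"
  by (induct w rule: edges.induct) auto

lemma set_edges: "e \<in> set (edges w) \<Longrightarrow> fst e \<in> set w \<and> snd e \<in> set w"
  by (induct w rule: edges.induct) (auto split: if_splits)

text \<open>These are the walks whose product of independent signs has nonzero mean.\<close>

definition even_walk :: "nat list \<Rightarrow> bool" where
  "even_walk w \<longleftrightarrow> (\<forall>e. even (count_list (edges w) e))"

lemma even_walk_map:
  assumes inj: "inj_on f (set w)" and ev: "even_walk w"
  shows "even_walk (map f w)"
  unfolding even_walk_def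
proof
  fix e
  show "even (count_list (edges (map f w)) e)"
  proof (cases "e \<in> set (edges (map f w))")
    case True
    then obtain e' where e': "e' \<in> set (edges w)" "e = map_prod f f e'"
      by (auto simp: edges_map)
    have "inj_on (map_prod f f) (set (edges w))"
      using inj set_edges[of _ w] by (auto simp: inj_on_def prod_eq_iff)
    from count_list_inj_map[OF this e'(1)]
    have "count_list (edges (map f w)) e = count_list (edges w) e'" by (simp add: edges_map e'(2))
    then show ?thesis using ev unfolding even_walk_def by metis
  next
    case False
    then show ?thesis using count_list_0_iff[of "edges (map f w)" e] by simp
  qed
qed

text \<open>Two words have the same pattern iff they differ by an injective relabelling.\<close>

definition pattern :: "nat list \<Rightarrow> nat \<times> (nat \<times> nat) set" where
  "pattern w = (length w, {(i, j). i < length w \<and> j < length w \<and> w ! i = w ! j})"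

lemma pattern_eq_iff:
  "pattern w = pattern w' \<longleftrightarrow> length w = length w' \<and>
    (\<forall>i<length w. \<forall>j<length w. (w ! i = w ! j) = (w' ! i = w' ! j))"
  unfolding pattern_def by (auto simp: set_eq_iff)

lemma pattern_Cons_iff:
  "pattern (x # w) = pattern (x' # w') \<longleftrightarrow> pattern w = pattern w' \<and>
    (\<forall>i<length w. (w ! i = x) = (w' ! i = x'))"
  unfolding pattern_eq_iff
  by (auto simp: All_less_Suc2 eq_commute[of x "w ! _"] eq_commute[of x' "w' ! _"])

text \<open>\<open>f x\<close> reads \<open>w'\<close> at some position where \<open>x\<close>
  stands in \<open>w\<close>; equality of patterns makes the choice immaterial and \<open>f\<close>
  injective.\<close>

lemma pattern_relabel:
  assumes "pattern w = pattern w'"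
  shows "\<exists>f. inj_on f (set w) \<and> w' = map f w"
proof -
  have len: "length w = length w'" and eq: "\<And>i j. i < length w \<Longrightarrow> j < length w \<Longrightarrow>
      (w ! i = w ! j) = (w' ! i = w' ! j)"
    using assms by (auto simp: pattern_eq_iff)
  define f where "f x = w' ! (SOME i. i < length w \<and> w ! i = x)" for x
  have f: "f (w ! i) = w' ! i" if "i < length w" for i
  proof -
    have "\<exists>j. j < length w \<and> w ! j = w ! i" using that by blast
    from someI_ex[OF this] show ?thesis unfolding f_def using eq that by blast
  qed
  have "w' = map f w" by (rule nth_equalityI) (auto simp: len f)
  moreover have "inj_on f (set w)"
    by (rule inj_onI) (metis f eq in_set_conv_nth)
  ultimately show ?thesis by blast
qed

lemma pattern_even_walk:
  assumes "pattern w = pattern w'" "even_walk w" shows "even_walk w'"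
  using pattern_relabel[OF assms(1)] even_walk_map assms(2) by auto

lemma pattern_closed:
  assumes "pattern w = pattern w'" "hd w = last w" "w \<noteq> []" shows "hd w' = last w'"
  using pattern_relabel[OF assms(1)] assms(2,3) by (auto simp: hd_map last_map)

text \<open>An even walk traverses each of its first-visit edges at least twice; hence the squares in the
  weight below.\<close>

fun new_edges :: "nat list \<Rightarrow> (nat \<times> nat) set" where
  "new_edges (x # y # w) = (if x \<in> set (y # w) then new_edges (y # w)
     else insert (if odd (length w) then (x, y) else (y, x)) (new_edges (y # w)))"
| "new_edges w = {}"

lemma new_edges_subset: "new_edges w \<subseteq> set (edges w)"
  by (induct w rule: new_edges.induct) auto

lemma finite_new_edges: "finite (new_edges w)"
  using new_edges_subset finite_subset by blast

definition new_weight :: "(nat \<times> nat \<Rightarrow> real) \<Rightarrow> nat list \<Rightarrow> real" where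
  "new_weight a w = (\<Prod>e\<in>new_edges w. (a e)\<^sup>2)"

lemma new_weight_nonneg: "new_weight a w \<ge> 0"
  unfolding new_weight_def by (simp add: prod_nonneg)

text \<open>Words grow at the front, so a walk is explored from its last letter. A fresh
  \<open>x\<close> is an endpoint of no edge of the tail, so its edge brings a factor of its own.
  Rows and columns share their labels here: a letter seen before on either side counts as
  old.\<close>

lemma new_weight_Cons:
  "new_weight a (x # y # w) = (if x \<in> set (y # w) then 1
     else (a (if odd (length w) then (x, y) else (y, x)))\<^sup>2) * new_weight a (y # w)"
proof (cases "x \<in> set (y # w)")
  case False
  then have "(if odd (length w) then (x, y) else (y, x)) \<notin> new_edges (y # w)"
    using new_edges_subset[of "y # w"] set_edges[of "(x, y)" "y # w"] set_edges[of "(y, x)" "y # w"]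
    by (auto split: if_splits)
  then show ?thesis using False finite_new_edges[of "y # w"]
    by (simp add: new_weight_def del: list.set)
qed (simp add: new_weight_def)

lemma prod_list_map_count:
  fixes f :: "'a \<Rightarrow> real"
  assumes "finite I" "set xs \<subseteq> I"
  shows "prod_list (map f xs) = (\<Prod>x\<in>I. f x ^ count_list xs x)"
  using assms(2)
proof (induct xs)
  case (Cons x xs)
  have "(\<Prod>y\<in>I. f y ^ count_list (x # xs) y) = (\<Prod>y\<in>I. (if x = y then f y else 1) * f y ^ count_list xs y)"
    by (intro prod.cong[OF refl]) simp
  also have "\<dots> = f x * (\<Prod>y\<in>I. f y ^ count_list xs y)"
    using Cons(2) assms(1) by (simp add: prod.distrib)
  finally show ?case using Cons by simp
qed simp

text \<open>Entries are at most 1, so all factors except two for each edge of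
  \<open>new_edges w\<close> may be dropped; two are present because a count that is even and
  nonzero is at least 2.\<close>

lemma even_walk_weight_le:
  assumes a: "\<And>e. 0 \<le> a e" "\<And>e. a e \<le> 1" and ev: "even_walk w"
  shows "prod_list (map a (edges w)) \<le> new_weight a w"
proof -
  let ?E = "set (edges w)" and ?c = "count_list (edges w)"
  have "prod_list (map a (edges w)) = (\<Prod>e\<in>?E. a e ^ ?c e)"
    by (rule prod_list_map_count) auto
  also have "\<dots> = (\<Prod>e\<in>?E - new_edges w. a e ^ ?c e) * (\<Prod>e\<in>new_edges w. a e ^ ?c e)"
    by (rule prod.subset_diff[OF new_edges_subset]) simp
  also have "\<dots> \<le> 1 * (\<Prod>e\<in>new_edges w. (a e)\<^sup>2)"
  proof (rule mult_mono)
    show "(\<Prod>e\<in>?E - new_edges w. a e ^ ?c e) \<le> 1"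
      using a by (intro prod_le_1) (auto intro: power_le_one)
    show "(\<Prod>e\<in>new_edges w. a e ^ ?c e) \<le> (\<Prod>e\<in>new_edges w. (a e)\<^sup>2)"
    proof (rule prod_mono)
      fix e assume "e \<in> new_edges w"
      then have "?c e \<noteq> 0" using new_edges_subset count_list_0_iff[of "edges w" e] by auto
      moreover have "even (?c e)" using ev unfolding even_walk_def by blast
      ultimately have "2 \<le> ?c e" by presburger
      then show "0 \<le> a e ^ ?c e \<and> a e ^ ?c e \<le> (a e)\<^sup>2"
        using a(1)[of e] a(2)[of e] by (auto intro: power_decreasing)
    qed
  qed (use a in \<open>auto intro!: prod_nonneg\<close>)
  finally show ?thesis by (simp add: new_weight_def)
qed

lemma sum_pattern_class_Cons:
  "(\<Sum>w\<in>words n (Suc (length w0)). if pattern w = pattern (x0 # w0) then F w else 0)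
    = (\<Sum>w\<in>words n (length w0). if pattern w = pattern w0
        then \<Sum>x<n. if \<forall>i<length w. (w ! i = x) = (w0 ! i = x0) then F (x # w) else 0 else 0)"
  unfolding sum_words_Suc pattern_Cons_iff by (intro sum.cong[OF refl]) (auto intro!: sum.cong)

text \<open>The pattern forces an old letter, so prepending it changes neither the number of words
  nor their weights.\<close>

lemma sum_pattern_class_old:
  assumes "x0 \<in> set w0"
  shows "(\<Sum>w\<in>words n (Suc (length w0)). if pattern w = pattern (x0 # w0) then new_weight a w else 0)
    = (\<Sum>w\<in>words n (length w0). if pattern w = pattern w0 then new_weight a w else 0)"
  unfolding sum_pattern_class_Cons
proof (rule sum.cong[OF refl], rule if_cong[OF refl _ refl])
  fix w assume w: "w \<in> words n (length w0)" and k: "pattern w = pattern w0"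
  obtain i where i: "i < length w0" "w0 ! i = x0" using assms by (auto simp: in_set_conv_nth)
  have len: "length w = length w0" using w by (simp add: words_def)
  have "(\<forall>j<length w. (w ! j = x) = (w0 ! j = x0)) = (w ! i = x)" for x
    using k i len by (auto simp: pattern_eq_iff)
  then have "(\<Sum>x<n. if \<forall>j<length w. (w ! j = x) = (w0 ! j = x0) then new_weight a (x # w) else 0)
      = (\<Sum>x<n. if w ! i = x then new_weight a (x # w) else 0)" by simp
  also have "\<dots> = new_weight a (w ! i # w)"
  proof -
    have "w ! i \<in> set w" using i len by simp
    then show ?thesis using w by (subst sum.delta') (auto simp: words_def)
  qed
  also have "\<dots> = new_weight a w"
  proof -
    obtain y v where "w = y # v" using i len by (cases w) auto
    moreover have "w ! i \<in> set w" using i len by simp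
    ultimately show ?thesis by (simp only: new_weight_Cons if_True mult_1)
  qed
  finally show "(\<Sum>x<n. if \<forall>j<length w. (w ! j = x) = (w0 ! j = x0) then new_weight a (x # w) else 0)
      = new_weight a w" .
qed

lemma fresh_iff:
  assumes "x0 \<notin> set w0" "length w = length w0"
  shows "(\<forall>i<length w. (w ! i = x) = (w0 ! i = x0)) \<longleftrightarrow> x \<notin> set w"
  using assms by (metis in_set_conv_nth)

text \<open>The words of a pattern are built up from their last letter, which has \<open>n\<close>
  choices against \<open>r\<close>: this is the ratio in the claim. An old letter is forced on both
  sides. A fresh letter contributes a row or column sum of squares, at most \<open>D\<close>, on the
  left, and at least \<open>r - M\<close>, hence at least \<open>D\<close>, choices on the
  right.\<close>

lemma pattern_class_comparison:
  assumes row: "\<And>i. (\<Sum>j<n. (a (i, j))\<^sup>2) \<le> D" and col: "\<And>j. (\<Sum>i<n. (a (i, j))\<^sup>2) \<le> D"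
    and r: "D + real M \<le> real r" and D: "D \<ge> 0"
  shows "w0 \<noteq> [] \<Longrightarrow> length w0 \<le> Suc M \<Longrightarrow>
    real r * (\<Sum>w\<in>words n (length w0). if pattern w = pattern w0 then new_weight a w else 0)
    \<le> real n * (\<Sum>w\<in>words r (length w0). if pattern w = pattern w0 then new_weight (\<lambda>_. 1) w else 0)"
proof (induct w0)
  case (Cons x0 w0)
  consider "w0 = []" | "w0 \<noteq> []" "x0 \<in> set w0" | "w0 \<noteq> []" "x0 \<notin> set w0" by blast
  then show ?case
  proof cases
    case 1
    have 0: "words k 0 = {[]}" for k by (auto simp: words_def)
    have "(\<Sum>w\<in>words k (length (x0 # w0)). if pattern w = pattern (x0 # w0) then new_weight c w else 0) = real k"
      for k c
      unfolding 1 by (simp add: sum_words_Suc 0 pattern_eq_iff new_weight_def)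
    then show ?thesis by simp
  next
    case 2
    then show ?thesis using Cons by (simp add: sum_pattern_class_old)
  next
    case 3
    note IH = Cons(1)[OF 3(1)]
    have up: "(\<Sum>x<n. if \<forall>i<length w. (w ! i = x) = (w0 ! i = x0) then new_weight a (x # w) else 0)
        \<le> D * new_weight a w" if "w \<in> words n (length w0)" for w
    proof -
      have len: "length w = length w0" using that by (simp add: words_def)
      obtain y v where w: "w = y # v" using 3(1) len by (cases w) auto
      have "(\<Sum>x<n. if \<forall>i<length w. (w ! i = x) = (w0 ! i = x0) then new_weight a (x # w) else 0)
          \<le> (\<Sum>x<n. (a (if odd (length v) then (x, y) else (y, x)))\<^sup>2 * new_weight a w)"
        unfolding fresh_iff[OF 3(2) len]
        by (intro sum_mono) (auto simp: w new_weight_Cons new_weight_nonneg simp del: list.set)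
      also have "\<dots> = (\<Sum>x<n. (a (if odd (length v) then (x, y) else (y, x)))\<^sup>2) * new_weight a w"
        by (simp add: sum_distrib_right)
      also have "\<dots> \<le> D * new_weight a w"
        using row[of y] col[of y]
        by (cases "odd (length v)") (auto intro!: mult_right_mono new_weight_nonneg)
      finally show ?thesis .
    qed
    have low: "(\<Sum>x<r. if \<forall>i<length w. (w ! i = x) = (w0 ! i = x0) then new_weight (\<lambda>_. 1) (x # w) else 0)
        \<ge> D * new_weight (\<lambda>_. 1) w" if "w \<in> words r (length w0)" for w
    proof -
      have len: "length w = length w0" using that by (simp add: words_def)
      have "(\<Sum>x<r. if \<forall>i<length w. (w ! i = x) = (w0 ! i = x0) then new_weight (\<lambda>_. 1) (x # w) else 0)
          = real (card ({..<r} - set w))"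
        unfolding fresh_iff[OF 3(2) len] by (simp add: new_weight_def sum.If_cases set_diff_eq Int_def)
      moreover have "r - card (set w) \<le> card ({..<r} - set w)"
        using diff_card_le_card_Diff[of "set w" "{..<r}"] by simp
      \<comment> \<open>\<open>Suc M\<close> in the assumption includes the letter being prepended,
        so the tail occupies at most \<open>M\<close> labels.\<close>
      moreover have "card (set w) \<le> M" using card_length[of w] len Cons(3) by simp
      ultimately show ?thesis using r by (simp add: new_weight_def)
    qed
    let ?F = "\<lambda>n a. (\<Sum>w\<in>words n (length w0). if pattern w = pattern w0 then new_weight a w else 0)"
    have "real r * (\<Sum>w\<in>words n (Suc (length w0)). if pattern w = pattern (x0 # w0) then new_weight a w else 0)
        \<le> real r * (\<Sum>w\<in>words n (length w0). if pattern w = pattern w0 then D * new_weight a w else 0)"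
      unfolding sum_pattern_class_Cons using up by (intro mult_left_mono sum_mono) auto
    also have "\<dots> = D * (real r * ?F n a)"
      by (simp add: sum_distrib_left if_distrib[of "\<lambda>x. _ * x"] mult.left_commute cong: if_cong)
    also have "\<dots> \<le> D * (real n * ?F r (\<lambda>_. 1))"
      using IH Cons(3) D by (intro mult_left_mono) auto
    also have "\<dots> = real n * (\<Sum>w\<in>words r (length w0). if pattern w = pattern w0 then D * new_weight (\<lambda>_. 1) w else 0)"
      by (simp add: sum_distrib_left if_distrib[of "\<lambda>x. _ * x"] mult.left_commute cong: if_cong)
    also have "\<dots> \<le> real n * (\<Sum>w\<in>words r (Suc (length w0)). if pattern w = pattern (x0 # w0) then new_weight (\<lambda>_. 1) w else 0)"
      unfolding sum_pattern_class_Cons using low by (intro mult_left_mono sum_mono) auto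
    finally show ?thesis by simp
  qed
qed simp

text \<open>Being closed and being even depend on the pattern only, so the walks fall into whole
  pattern classes, which are compared one at a time. On the right all weights are 1 and the sum is a
  count.\<close>

lemma even_closed_walks_comparison:
  assumes row: "\<And>i. (\<Sum>j<n. (a (i, j))\<^sup>2) \<le> D" and col: "\<And>j. (\<Sum>i<n. (a (i, j))\<^sup>2) \<le> D"
    and r: "D + real (2 * p) \<le> real r" and D: "D \<ge> 0"
  shows "real r * (\<Sum>w | w \<in> closed_walks n p \<and> even_walk w. new_weight a w)
    \<le> real n * real (card {w \<in> closed_walks r p. even_walk w})"
proof -
  let ?L = "2 * p + 1"
  let ?A = "\<lambda>n. {w \<in> closed_walks n p. even_walk w}"
  have fin: "finite (?A n)" for n by simp
  have cls: "{w \<in> ?A k. pattern w = pattern w0} = {w \<in> words k ?L. pattern w = pattern w0}"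
    if "w0 \<in> ?A n" for k w0
  proof -
    have w0: "w0 \<noteq> []" "hd w0 = last w0" "even_walk w0" using that by (auto simp: closed_walks_def words_def)
    show ?thesis
      using w0 pattern_even_walk[OF sym] pattern_closed[OF sym] by (auto simp: closed_walks_def)
  qed
  have class_le: "real r * (\<Sum>w | w \<in> ?A n \<and> pattern w = t. new_weight a w)
      \<le> real n * real (card {w \<in> ?A r. pattern w = t})" if "t \<in> pattern ` ?A n" for t
  proof -
    from that obtain w0 where w0: "w0 \<in> ?A n" "t = pattern w0" by auto
    then have len: "length w0 = ?L" by (auto simp: closed_walks_def words_def)
    have "real r * (\<Sum>w\<in>words n (length w0). if pattern w = pattern w0 then new_weight a w else 0)
        \<le> real n * (\<Sum>w\<in>words r (length w0). if pattern w = pattern w0 then new_weight (\<lambda>_. 1) w else 0)"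
      by (rule pattern_class_comparison[OF row col r D]) (use len in auto)
    then show ?thesis
      unfolding w0(2) cls[OF w0(1)] len by (simp add: new_weight_def sum.inter_filter flip: sum.inter_filter)
  qed
  have "real r * (\<Sum>w\<in>?A n. new_weight a w)
      = (\<Sum>t\<in>pattern ` ?A n. real r * (\<Sum>w | w \<in> ?A n \<and> pattern w = t. new_weight a w))"
    by (subst sum.image_gen[OF fin, of _ n pattern]) (simp add: sum_distrib_left)
  also have "\<dots> \<le> (\<Sum>t\<in>pattern ` ?A n. real n * real (card {w \<in> ?A r. pattern w = t}))"
    by (rule sum_mono[OF class_le])
  also have "\<dots> = real n * real (\<Sum>t\<in>pattern ` ?A n. card {w \<in> ?A r. pattern w = t})"
    by (simp add: sum_distrib_left)
  also have "(\<Sum>t\<in>pattern ` ?A n. card {w \<in> ?A r. pattern w = t})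
      = card (\<Union>t\<in>pattern ` ?A n. {w \<in> ?A r. pattern w = t})"
    by (intro card_UN_disjoint[symmetric]) auto
  \<comment> \<open>Walks over \<open>r\<close> letters whose pattern does not occur over
    \<open>n\<close> letters are added here.\<close>
  also have "real n * real \<dots> \<le> real n * real (card (?A r))"
    using fin by (intro mult_left_mono of_nat_mono card_mono) auto
  finally show ?thesis by simp
qed

section \<open>Averaging traces over signs\<close>

lemma sum_signs_prod_list:
  assumes I: "finite I" "set es \<subseteq> I"
  shows "(\<Sum>\<epsilon>\<in>signs I. prod_list (map \<epsilon> es)) = (if \<forall>e. even (count_list es e) then 2 ^ card I else 0)"
proof -
  have "(\<Sum>\<epsilon>\<in>signs I. prod_list (map \<epsilon> es)) = (\<Sum>\<epsilon>\<in>signs I. \<Prod>e\<in>I. \<epsilon> e ^ count_list es e)"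
    by (simp add: prod_list_map_count[OF I])
  \<comment> \<open>Independence in finite form: the sum over sign patterns of a product over cells
    is a product of sums over single signs.\<close>
  also have "\<dots> = (\<Prod>e\<in>I. \<Sum>y\<in>{- 1, 1}. y ^ count_list es e)"
    unfolding signs_def using I by (subst prod_sum_PiE) auto
  also have "\<dots> = (\<Prod>e\<in>I. if even (count_list es e) then 2 else 0)"
    by (intro prod.cong[OF refl]) auto
  also have "\<dots> = (if \<forall>e. even (count_list es e) then 2 ^ card I else 0)"
  proof (cases "\<forall>e. even (count_list es e)")
    case False
    then obtain e where "odd (count_list es e)" by blast
    moreover from this have "e \<in> I" using I count_list_0_iff[of es e] by fastforce
    ultimately show ?thesis using I False by (auto intro!: prod_zero)
  qed simp
  finally show ?thesis .
qed

lemma sum_signs_trace_pow: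
  assumes I: "finite I" and a: "\<And>e. e \<notin> I \<Longrightarrow> a e = 0"
  shows "(\<Sum>\<epsilon>\<in>signs I. trace_pow n p (\<lambda>e. \<epsilon> e * a e))
    = 2 ^ card I * (\<Sum>w | w \<in> closed_walks n p \<and> even_walk w. prod_list (map a (edges w)))"
proof -
  have *: "(\<Sum>\<epsilon>\<in>signs I. prod_list (map (\<lambda>e. \<epsilon> e * a e) es))
      = (if \<forall>e. even (count_list es e) then 2 ^ card I * prod_list (map a es) else 0)" for es
  proof (cases "set es \<subseteq> I")
    case True
    have "prod_list (map (\<lambda>e. \<epsilon> e * a e) es) = prod_list (map \<epsilon> es) * prod_list (map a es)" for \<epsilon>
      by (induct es) auto
    then show ?thesis using sum_signs_prod_list[OF I True] by (simp add: sum_distrib_right[symmetric])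
  next
    case False
    \<comment> \<open>A walk that leaves \<open>I\<close> meets a zero entry, so the unspecified
      value of \<open>\<epsilon>\<close> outside \<open>I\<close> has no effect.\<close>
    then obtain e where e: "e \<in> set es" "a e = 0" using a by auto
    then have "prod_list (map (\<lambda>e. \<epsilon> e * a e) es) = 0" "prod_list (map a es) = 0" for \<epsilon>
      by (force simp: prod_list_zero_iff)+
    then show ?thesis by (simp only: if_cancel mult_zero_right sum.neutral_const)
  qed
  have "(\<Sum>\<epsilon>\<in>signs I. trace_pow n p (\<lambda>e. \<epsilon> e * a e))
      = (\<Sum>w\<in>closed_walks n p. \<Sum>\<epsilon>\<in>signs I. prod_list (map (\<lambda>e. \<epsilon> e * a e) (edges w)))"
    unfolding trace_pow_def by (rule sum.swap)
  also have "\<dots> = (\<Sum>w\<in>closed_walks n p. if even_walk w then 2 ^ card I * prod_list (map a (edges w)) else 0)"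
    unfolding * even_walk_def ..
  also have "\<dots> = 2 ^ card I * (\<Sum>w | w \<in> closed_walks n p \<and> even_walk w. prod_list (map a (edges w)))"
    by (subst sum.inter_filter[symmetric]) (auto simp: sum_distrib_left)
  finally show ?thesis .
qed

text \<open>For the matrix of independent signs the mean trace is exactly the number of even closed
  walks over \<open>r\<close> letters. The analytic bound \<open>G\<close> on that trace thus counts
  these walks without combinatorics, and the comparison of pattern classes carries the count over to
  the weights \<open>a\<close> at the price n / r.\<close>

lemma trace_pow_comparison:
  assumes I: "finite I" and a: "\<And>e. e \<notin> I \<Longrightarrow> a e = 0" "\<And>e. 0 \<le> a e" "\<And>e. a e \<le> 1"
    and row: "\<And>i. (\<Sum>j<n. (a (i, j))\<^sup>2) \<le> D" and col: "\<And>j. (\<Sum>i<n. (a (i, j))\<^sup>2) \<le> D"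
    and r: "D + real (2 * p) \<le> real r" and D: "D \<ge> 0"
    and G: "(\<Sum>\<epsilon>\<in>signs ({..<r} \<times> {..<r}). trace_pow r p \<epsilon>) \<le> 2 ^ (r * r) * (real r * B)" and "r > 0"
  shows "(\<Sum>\<epsilon>\<in>signs I. trace_pow n p (\<lambda>e. \<epsilon> e * a e)) \<le> 2 ^ card I * (real n * B)"
proof -
  let ?J = "{..<r} \<times> {..<r}"
  let ?one = "\<lambda>e. if e \<in> ?J then 1 else 0 :: real"
  have edgesJ: "set (edges w) \<subseteq> ?J" if "w \<in> closed_walks r p" for w
  proof
    fix e assume "e \<in> set (edges w)"
    from set_edges[OF this] show "e \<in> ?J" using that by (auto simp: closed_walks_def words_def mem_Times_iff)
  qed
  have one: "prod_list (map ?one (edges w)) = 1" if "w \<in> closed_walks r p" for w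
  proof -
    have "map ?one (edges w) = map (\<lambda>_. 1) (edges w)" using edgesJ[OF that] by (intro map_cong) auto
    then show ?thesis by (simp add: map_replicate_const)
  qed
  have "trace_pow r p (\<lambda>e. \<epsilon> e * ?one e) = trace_pow r p \<epsilon>" for \<epsilon>
    unfolding trace_pow_def using edgesJ
    by (intro sum.cong[OF refl] arg_cong[of _ _ prod_list] map_cong[OF refl]) auto
  then have "(\<Sum>\<epsilon>\<in>signs ?J. trace_pow r p \<epsilon>)
      = 2 ^ card ?J * (\<Sum>w | w \<in> closed_walks r p \<and> even_walk w. prod_list (map ?one (edges w)))"
    using sum_signs_trace_pow[of ?J ?one r p] by simp
  also have "(\<Sum>w | w \<in> closed_walks r p \<and> even_walk w. prod_list (map ?one (edges w)))
      = real (card {w \<in> closed_walks r p. even_walk w})"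
    using one by simp
  finally have card_le: "real (card {w \<in> closed_walks r p. even_walk w}) \<le> real r * B"
    using G by simp
  have "(\<Sum>w | w \<in> closed_walks n p \<and> even_walk w. prod_list (map a (edges w)))
      \<le> (\<Sum>w | w \<in> closed_walks n p \<and> even_walk w. new_weight a w)"
    using a by (intro sum_mono even_walk_weight_le) auto
  moreover have "real r * (\<Sum>w | w \<in> closed_walks n p \<and> even_walk w. new_weight a w) \<le> real n * (real r * B)"
    using even_closed_walks_comparison[OF row col r D] mult_left_mono[OF card_le, of "real n"] by linarith
  ultimately have "(\<Sum>w | w \<in> closed_walks n p \<and> even_walk w. prod_list (map a (edges w))) \<le> real n * B"
    using \<open>r > 0\<close> by (simp add: mult.left_commute)
  then have "2 ^ card I * (\<Sum>w | w \<in> closed_walks n p \<and> even_walk w. prod_list (map a (edges w)))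
      \<le> 2 ^ card I * (real n * B)" by (rule mult_left_mono) simp
  then show ?thesis using sum_signs_trace_pow[OF I a(1)] by simp
qed

section \<open>Norms of random sign matrices\<close>

definition bilin :: "nat \<Rightarrow> (nat \<times> nat \<Rightarrow> real) \<Rightarrow> (nat \<Rightarrow> real) \<Rightarrow> (nat \<Rightarrow> real) \<Rightarrow> real" where
  "bilin n Q u v = (\<Sum>i<n. \<Sum>j<n. Q (i, j) * u i * v j)"

definition ball2 :: "nat \<Rightarrow> real \<Rightarrow> (nat \<Rightarrow> real) set" where
  "ball2 n s = {u. (\<Sum>i<n. (u i)\<^sup>2) \<le> s\<^sup>2}"

lemma bilin_add_left: "bilin n Q (\<lambda>i. u i + u' i) v = bilin n Q u v + bilin n Q u' v"
  by (simp add: bilin_def algebra_simps sum.distrib)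

lemma bilin_add_right: "bilin n Q u (\<lambda>i. v i + v' i) = bilin n Q u v + bilin n Q u v'"
  by (simp add: bilin_def algebra_simps sum.distrib)

lemma bilin_scale: "bilin n Q (\<lambda>i. s * u i) (\<lambda>i. t * v i) = s * t * bilin n Q u v"
  by (simp add: bilin_def sum_distrib_left algebra_simps)

lemma bilin_uminus: "bilin n Q (\<lambda>i. - u i) v = - bilin n Q u v"
  by (simp add: bilin_def sum_negf)

lemma bilin_le_scaled:
  assumes K: "\<And>u v. u \<in> ball2 n 1 \<Longrightarrow> v \<in> ball2 n 1 \<Longrightarrow> bilin n Q u v \<le> K"
    and u: "u \<in> ball2 n s" and v: "v \<in> ball2 n t" and "s > 0" "t > 0"
  shows "bilin n Q u v \<le> s * t * K"
proof -
  have unit: "(\<lambda>i. (1 / s) * w i) \<in> ball2 n 1" if "w \<in> ball2 n s" "s > 0" for w s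
    using that by (simp add: ball2_def power_mult_distrib power_divide flip: sum_divide_distrib)
  have "bilin n Q u v = s * t * bilin n Q (\<lambda>i. (1 / s) * u i) (\<lambda>i. (1 / t) * v i)"
    unfolding bilin_scale using assms(4,5) by simp
  also have "\<dots> \<le> s * t * K"
    using assms unit by (intro mult_left_mono K) auto
  finally show ?thesis .
qed

lemma bilin_sq_le:
  assumes K: "\<And>u v. u \<in> ball2 n 1 \<Longrightarrow> v \<in> ball2 n 1 \<Longrightarrow> bilin n Q u v \<le> K"
  shows "(bilin n Q f g)\<^sup>2 \<le> K\<^sup>2 * (\<Sum>i<n. (f i)\<^sup>2) * (\<Sum>i<n. (g i)\<^sup>2)"
proof -
  let ?F = "\<Sum>i<n. (f i)\<^sup>2" and ?G = "\<Sum>i<n. (g i)\<^sup>2"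
  have nn: "?F \<ge> 0" "?G \<ge> 0" by (auto intro: sum_nonneg)
  show ?thesis
  proof (cases "?F = 0 \<or> ?G = 0")
    case True
    then have "(\<forall>i<n. f i = 0) \<or> (\<forall>i<n. g i = 0)" by (auto simp: sum_nonneg_eq_0_iff)
    then have "bilin n Q f g = 0" by (auto simp: bilin_def)
    then show ?thesis using nn by simp
  next
    case False
    then have pos: "sqrt ?F > 0" "sqrt ?G > 0" using nn by auto
    have f: "f \<in> ball2 n (sqrt ?F)" "(\<lambda>i. - f i) \<in> ball2 n (sqrt ?F)" and g: "g \<in> ball2 n (sqrt ?G)"
      using nn by (auto simp: ball2_def)
    have "bilin n Q f g \<le> sqrt ?F * sqrt ?G * K" "- bilin n Q f g \<le> sqrt ?F * sqrt ?G * K"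
      using bilin_le_scaled[OF K f(1) g pos] bilin_le_scaled[OF K f(2) g pos]
      by (simp_all add: bilin_uminus)
    then have "(bilin n Q f g)\<^sup>2 \<le> (sqrt ?F * sqrt ?G * K)\<^sup>2"
      by (intro power2_le_iff_abs_le[THEN iffD2]) auto
    then show ?thesis using nn by (simp add: power_mult_distrib mult_ac)
  qed
qed

text \<open>The grid of mesh 1 / (4 sqrt r) inside the unit ball, stored as integer vectors.
  Rounding each of the \<open>r\<close> coordinates by at most one mesh moves a point by at most 1 /
  4.\<close>

definition net :: "nat \<Rightarrow> (nat \<Rightarrow> int) set" where
  "net r = {z \<in> {..<r} \<rightarrow>\<^sub>E UNIV. (\<Sum>i<r. (z i)\<^sup>2) \<le> 16 * int r}"

definition net_point :: "nat \<Rightarrow> (nat \<Rightarrow> int) \<Rightarrow> nat \<Rightarrow> real" where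
  "net_point r z i = real_of_int (z i) / (4 * sqrt (real r))"

lemma abs_le_square_int: "\<bar>k\<bar> \<le> k\<^sup>2" for k :: int
proof (cases "k = 0")
  case False
  then have "\<bar>k\<bar> * 1 \<le> \<bar>k\<bar> * \<bar>k\<bar>" by (intro mult_left_mono) auto
  then show ?thesis by (simp add: power2_eq_square)
qed simp

lemma net_subset: "net r \<subseteq> {..<r} \<rightarrow>\<^sub>E {- int (16 * r)..int (16 * r)}"
proof
  fix z assume z: "z \<in> net r"
  have "\<bar>z i\<bar> \<le> 16 * int r" if "i < r" for i
  proof -
    have "(z i)\<^sup>2 \<le> (\<Sum>i<r. (z i)\<^sup>2)" using that by (intro member_le_sum) auto
    then show ?thesis using abs_le_square_int[of "z i"] z unfolding net_def by auto
  qed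
  then show "z \<in> {..<r} \<rightarrow>\<^sub>E {- int (16 * r)..int (16 * r)}"
    using z by (auto simp: net_def PiE_def abs_le_iff minus_le_iff)
qed

lemma finite_net: "finite (net r)"
  by (rule finite_subset[OF net_subset]) (auto intro!: finite_PiE)

lemma sum_half_powers: "(\<Sum>k = - int M..int M. (1 / 2 :: real) ^ nat \<bar>k\<bar>) \<le> 3"
proof -
  have "(\<Sum>k = - int M..int M. (1 / 2 :: real) ^ nat \<bar>k\<bar>) = 3 - 2 * (1 / 2) ^ M"
  proof (induct M)
    case (Suc M)
    have "{- int (Suc M)..int (Suc M)} = insert (- int (Suc M)) (insert (int (Suc M)) {- int M..int M})"
      by auto
    then show ?case using Suc by (simp add: nat_add_distrib)
  qed simp
  also have "\<dots> \<le> 3" by simp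
  finally show ?thesis .
qed

text \<open>A generating-function count. Integers satisfy |k| <= k^2, so a net vector has l1-norm at
  most 16 r, and its weight, the product of (1 / 2)^|z i|, is at least 2^(-16 r). Over the whole box
  the weights sum to a product of \<open>r\<close> factors, each at most 3.\<close>

lemma card_net_le: "real (card (net r)) \<le> (3 * 2 ^ 16) ^ r"
proof -
  let ?R = "{- int (16 * r)..int (16 * r)}"
  have "real (card (net r)) = (\<Sum>z\<in>net r. 1)" by simp
  also have "\<dots> \<le> (\<Sum>z\<in>net r. 2 ^ (16 * r) * (\<Prod>i<r. (1 / 2) ^ nat \<bar>z i\<bar>))"
  proof (rule sum_mono)
    fix z assume z: "z \<in> net r"
    have "(\<Sum>i<r. \<bar>z i\<bar>) \<le> (\<Sum>i<r. (z i)\<^sup>2)" by (intro sum_mono abs_le_square_int)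
    then have "(\<Sum>i<r. \<bar>z i\<bar>) \<le> int (16 * r)" using z by (simp add: net_def)
    then have "int (\<Sum>i<r. nat \<bar>z i\<bar>) \<le> int (16 * r)" by simp
    then have le: "(\<Sum>i<r. nat \<bar>z i\<bar>) \<le> 16 * r" by (simp only: of_nat_le_iff)
    have "(\<Prod>i<r. (1 / 2 :: real) ^ nat \<bar>z i\<bar>) = (1 / 2) ^ (\<Sum>i<r. nat \<bar>z i\<bar>)"
      by (simp add: power_sum)
    also have "\<dots> \<ge> (1 / 2) ^ (16 * r)" using le by (intro power_decreasing) auto
    finally have "2 ^ (16 * r) * (1 / 2 :: real) ^ (16 * r) \<le> 2 ^ (16 * r) * (\<Prod>i<r. (1 / 2) ^ nat \<bar>z i\<bar>)"
      by (intro mult_left_mono) auto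
    then show "1 \<le> 2 ^ (16 * r) * (\<Prod>i<r. (1 / 2 :: real) ^ nat \<bar>z i\<bar>)"
      by (simp add: power_one_over)
  qed
  also have "\<dots> \<le> (\<Sum>z\<in>{..<r} \<rightarrow>\<^sub>E ?R. 2 ^ (16 * r) * (\<Prod>i<r. (1 / 2) ^ nat \<bar>z i\<bar>))"
  proof (rule sum_mono2)
    show "finite ({..<r} \<rightarrow>\<^sub>E ?R)" by (intro finite_PiE) simp_all
    show "net r \<subseteq> {..<r} \<rightarrow>\<^sub>E ?R" by (rule net_subset)
  qed (simp add: prod_nonneg)
  also have "\<dots> = 2 ^ (16 * r) * (\<Sum>k\<in>?R. (1 / 2) ^ nat \<bar>k\<bar>) ^ r"
  proof -
    have "(\<Sum>z\<in>{..<r} \<rightarrow>\<^sub>E ?R. \<Prod>i<r. (1 / 2 :: real) ^ nat \<bar>z i\<bar>)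
        = (\<Prod>i<r. \<Sum>k\<in>?R. (1 / 2) ^ nat \<bar>k\<bar>)"
      by (rule prod_sum_PiE[symmetric]) simp_all
    then show ?thesis by (simp only: sum_distrib_left[symmetric] prod_constant card_lessThan)
  qed
  also have "\<dots> \<le> 2 ^ (16 * r) * 3 ^ r"
    by (intro mult_left_mono power_mono sum_half_powers sum_nonneg) simp_all
  also have "\<dots> = (3 * 2 ^ 16) ^ r" unfolding power_mult power_mult_distrib by (rule mult.commute)
  finally show ?thesis .
qed

lemma net_point_in_ball2:
  assumes "z \<in> net r" shows "net_point r z \<in> ball2 r 1"
proof (cases "r = 0")
  case False
  have "(\<Sum>i<r. (net_point r z i)\<^sup>2) = real_of_int (\<Sum>i<r. (z i)\<^sup>2) / (16 * real r)"
    by (simp add: net_point_def power_divide power_mult_distrib sum_divide_distrib)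
  also have "\<dots> \<le> real_of_int (16 * int r) / (16 * real r)"
    using assms by (intro divide_right_mono) (auto simp: net_def simp del: of_int_sum)
  also have "\<dots> = 1" using False by simp
  finally show ?thesis by (simp add: ball2_def)
qed (simp add: ball2_def)

lemma net_approx:
  assumes u: "u \<in> ball2 r 1"
  shows "\<exists>z\<in>net r. (\<lambda>i. u i - net_point r z i) \<in> ball2 r (1 / 4)"
proof (cases "r = 0")
  case True
  then show ?thesis by (intro bexI[of _ "\<lambda>_. undefined"]) (auto simp: net_def ball2_def PiE_def)
next
  case False
  define q where "q = 4 * sqrt (real r)"
  have q: "q > 0" "q\<^sup>2 = 16 * real r" using False by (auto simp: q_def power_mult_distrib)
  \<comment> \<open>Rounding towards zero never enlarges a coordinate, so the rounded vector still
    meets the norm bound of the net.\<close>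
  define t where "t x = (if x \<ge> 0 then \<lfloor>x\<rfloor> else \<lceil>x\<rceil>)" for x :: real
  have t: "\<bar>real_of_int (t x)\<bar> \<le> \<bar>x\<bar>" "\<bar>x - real_of_int (t x)\<bar> \<le> 1" for x
  proof -
    have "\<bar>real_of_int (t x)\<bar> \<le> \<bar>x\<bar> \<and> \<bar>x - real_of_int (t x)\<bar> \<le> 1"
    proof (cases "x \<ge> 0")
      case True
      moreover from this have "real_of_int \<lfloor>x\<rfloor> \<ge> 0" by simp
      moreover have "t x = \<lfloor>x\<rfloor>" using True by (simp add: t_def)
      ultimately show ?thesis using floor_correct[of x] by (intro conjI) linarith+
    next
      case False
      moreover from this have "real_of_int \<lceil>x\<rceil> \<le> 0" by simp
      moreover have "t x = \<lceil>x\<rceil>" using False by (simp add: t_def)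
      ultimately show ?thesis using ceiling_correct[of x] by (intro conjI) linarith+
    qed
    then show "\<bar>real_of_int (t x)\<bar> \<le> \<bar>x\<bar>" "\<bar>x - real_of_int (t x)\<bar> \<le> 1" by auto
  qed
  define z where "z = restrict (\<lambda>i. t (q * u i)) {..<r}"
  have zi: "z i = t (q * u i)" if "i < r" for i using that by (simp add: z_def)
  have "real_of_int (\<Sum>i<r. (z i)\<^sup>2) = (\<Sum>i<r. (real_of_int (t (q * u i)))\<^sup>2)"
    by (simp add: zi)
  also have "\<dots> \<le> (\<Sum>i<r. (q * u i)\<^sup>2)"
    using t(1) by (intro sum_mono) (simp add: abs_le_square_iff)
  also have "\<dots> = q\<^sup>2 * (\<Sum>i<r. (u i)\<^sup>2)" by (simp add: power_mult_distrib sum_distrib_left)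
  also have "\<dots> \<le> q\<^sup>2 * 1" using u by (intro mult_left_mono) (auto simp: ball2_def)
  finally have "real_of_int (\<Sum>i<r. (z i)\<^sup>2) \<le> real_of_int (16 * int r)" using q by simp
  then have "z \<in> net r" unfolding net_def of_int_le_iff by (auto simp: z_def)
  moreover have "(\<lambda>i. u i - net_point r z i) \<in> ball2 r (1 / 4)"
  proof -
    have "(\<Sum>i<r. (u i - net_point r z i)\<^sup>2) \<le> (\<Sum>i<r. 1 / (16 * real r))"
    proof (rule sum_mono)
      fix i assume i: "i \<in> {..<r}"
      have "u i - net_point r z i = (q * u i - real_of_int (t (q * u i))) / q"
        unfolding net_point_def q_def[symmetric] using q i by (simp add: zi field_simps)
      then have "(u i - net_point r z i)\<^sup>2 = (q * u i - real_of_int (t (q * u i)))\<^sup>2 / q\<^sup>2"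
        by (simp add: power_divide)
      also have "\<dots> \<le> 1 / q\<^sup>2"
        using t(2)[of "q * u i"] by (intro divide_right_mono) (auto simp: abs_square_le_1)
      finally show "(u i - net_point r z i)\<^sup>2 \<le> 1 / (16 * real r)" using q by simp
    qed
    also have "\<dots> = (1 / 4)\<^sup>2" using False by (simp add: power2_eq_square)
    finally show ?thesis by (simp add: ball2_def)
  qed
  ultimately show ?thesis by blast
qed

text \<open>The supremum \<open>K\<close> of the bilinear form over the unit balls satisfies \<open>K \<le> m + K / 4 + K / 4\<close>,
  where \<open>m\<close> is its maximum over the net.\<close>

lemma bilin_le_net:
  assumes m: "\<And>z z'. z \<in> net r \<Longrightarrow> z' \<in> net r \<Longrightarrow> bilin r Q (net_point r z) (net_point r z') \<le> m"
    and u: "u \<in> ball2 r 1" and v: "v \<in> ball2 r 1"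
  shows "bilin r Q u v \<le> 2 * m"
proof -
  let ?S = "ball2 r 1 \<times> ball2 r 1"
  define K where "K = (SUP (u, v)\<in>?S. bilin r Q u v)"
  have ne: "?S \<noteq> {}" using u v by auto
  have "bilin r Q u v \<le> (\<Sum>i<r. \<Sum>j<r. \<bar>Q (i, j)\<bar>)" if "u \<in> ball2 r 1" "v \<in> ball2 r 1" for u v
    unfolding bilin_def
  proof (intro sum_mono)
    fix i j assume ij: "i \<in> {..<r}" "j \<in> {..<r}"
    have one: "\<bar>w k\<bar> \<le> 1" if "w \<in> ball2 r 1" "k < r" for w k
    proof -
      have "(w k)\<^sup>2 \<le> (\<Sum>i<r. (w i)\<^sup>2)" using that by (intro member_le_sum) auto
      then show ?thesis using that by (simp add: ball2_def flip: abs_square_le_1)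
    qed
    have "Q (i, j) * u i * v j \<le> \<bar>Q (i, j)\<bar> * (\<bar>u i\<bar> * \<bar>v j\<bar>)"
      by (metis abs_ge_self abs_mult mult.assoc)
    also have "\<dots> \<le> \<bar>Q (i, j)\<bar> * (1 * 1)"
      using one[OF that(1)] one[OF that(2)] ij by (intro mult_left_mono mult_mono) auto
    finally show "Q (i, j) * u i * v j \<le> \<bar>Q (i, j)\<bar>" by simp
  qed
  \<comment> \<open>The crude entrywise bound serves only to make the supremum \<open>K\<close>
    finite, so that \<open>K \<le> m + K / 2\<close> can be solved for \<open>K\<close>.\<close>
  then have "bdd_above ((\<lambda>(u, v). bilin r Q u v) ` ?S)" by (intro bdd_aboveI2) auto
  then have K: "bilin r Q u v \<le> K" if "u \<in> ball2 r 1" "v \<in> ball2 r 1" for u v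
    using that cSUP_upper[of "(u, v)" ?S "\<lambda>(u, v). bilin r Q u v"] by (simp add: K_def)
  have "K \<le> m + K / 2"
    unfolding K_def[symmetric]
  proof (subst K_def, rule cSUP_least[OF ne])
    fix x assume "x \<in> ?S"
    then obtain u v where x: "x = (u, v)" and u: "u \<in> ball2 r 1" and v: "v \<in> ball2 r 1" by auto
    obtain z where z: "z \<in> net r" "(\<lambda>i. u i - net_point r z i) \<in> ball2 r (1 / 4)"
      using net_approx[OF u] by blast
    obtain z' where z': "z' \<in> net r" "(\<lambda>i. v i - net_point r z' i) \<in> ball2 r (1 / 4)"
      using net_approx[OF v] by blast
    have "bilin r Q u v = bilin r Q (net_point r z) v + bilin r Q (\<lambda>i. u i - net_point r z i) v"
      by (simp flip: bilin_add_left)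
    also have "bilin r Q (net_point r z) v = bilin r Q (net_point r z) (net_point r z')
        + bilin r Q (net_point r z) (\<lambda>i. v i - net_point r z' i)"
      by (simp flip: bilin_add_right)
    also have "bilin r Q (net_point r z) (\<lambda>i. v i - net_point r z' i) \<le> 1 * (1 / 4) * K"
      by (rule bilin_le_scaled[OF K net_point_in_ball2[OF z(1)] z'(2)]) auto
    also have "bilin r Q (\<lambda>i. u i - net_point r z i) v \<le> 1 / 4 * 1 * K"
      by (rule bilin_le_scaled[OF K z(2) v]) auto
    also have "bilin r Q (net_point r z) (net_point r z') \<le> m" by (rule m[OF z(1) z'(1)])
    finally show "(case x of (u, v) \<Rightarrow> bilin r Q u v) \<le> m + K / 2" by (simp add: x)
  qed
  then show ?thesis using K[OF u v] by simp
qed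

section \<open>Moments of sums of independent signs\<close>

lemma exp_add_exp_minus_le: "exp x + exp (- x) \<le> 2 * exp (x\<^sup>2)" for x :: real
proof (cases "\<bar>x\<bar> \<le> 1")
  case True
  define y where "y = \<bar>x\<bar>"
  have y: "0 \<le> y" "y \<le> 1" using True by (auto simp: y_def)
  \<comment> \<open>On [0, 1] both exponentials lie below quadratics whose linear terms cancel;
    beyond 1 it suffices that |x| <= x^2. The optimal exponent x^2 / 2 would improve constants
    only.\<close>
  have "exp (- y) \<le> 1 / (1 + y)"
    using exp_ge_add_one_self[of y] y by (simp add: exp_minus inverse_eq_divide frac_le)
  also have "\<dots> \<le> 1 - y + y\<^sup>2"
  proof -
    have "(1 - y + y\<^sup>2) * (1 + y) = 1 + y ^ 3"
      by (simp add: algebra_simps power2_eq_square power3_eq_cube)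
    then have "1 \<le> (1 - y + y\<^sup>2) * (1 + y)" using y by simp
    then show ?thesis using y by (simp add: divide_le_eq)
  qed
  finally have "exp y + exp (- y) \<le> 2 * (1 + y\<^sup>2)" using exp_bound[of y] y by simp
  then have "exp x + exp (- x) \<le> 2 * (1 + x\<^sup>2)" by (auto simp: y_def abs_if split: if_splits)
  also have "\<dots> \<le> 2 * exp (x\<^sup>2)" by (intro mult_left_mono exp_ge_add_one_self) simp
  finally show ?thesis .
next
  case False
  then have "\<bar>x\<bar> \<le> x\<^sup>2"
    by (metis abs_ge_zero abs_mult_self_eq linorder_le_cases mult_right_mono mult_1 power2_eq_square)
  then have "exp x + exp (- x) \<le> exp (x\<^sup>2) + exp (x\<^sup>2)" by (intro add_mono) auto
  then show ?thesis unfolding mult_2 .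
qed

lemma sum_signs_exp_le:
  assumes J: "finite J" and c: "(\<Sum>e\<in>J. (c e)\<^sup>2) \<le> 1"
  shows "(\<Sum>\<epsilon>\<in>signs J. exp (t * (\<Sum>e\<in>J. \<epsilon> e * c e))) \<le> 2 ^ card J * exp (t\<^sup>2)"
proof -
  have "(\<Sum>\<epsilon>\<in>signs J. exp (t * (\<Sum>e\<in>J. \<epsilon> e * c e))) = (\<Sum>\<epsilon>\<in>signs J. \<Prod>e\<in>J. exp (\<epsilon> e * (t * c e)))"
    using J by (simp add: sum_distrib_left exp_sum mult.left_commute)
  also have "\<dots> = (\<Prod>e\<in>J. \<Sum>y\<in>{- 1, 1}. exp (y * (t * c e)))"
    unfolding signs_def using J by (subst prod_sum_PiE) auto
  also have "\<dots> \<le> (\<Prod>e\<in>J. 2 * exp ((t * c e)\<^sup>2))"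
    using exp_add_exp_minus_le by (intro prod_mono) (auto simp: add.commute add_nonneg_nonneg)
  also have "\<dots> = 2 ^ card J * exp (t\<^sup>2 * (\<Sum>e\<in>J. (c e)\<^sup>2))"
    using J by (simp add: prod.distrib exp_sum sum_distrib_left power_mult_distrib)
  also have "\<dots> \<le> 2 ^ card J * exp (t\<^sup>2)"
    using mult_left_mono[OF c, of "t\<^sup>2"] by simp
  finally show ?thesis .
qed

text \<open>One term of the series for exp |x| dominates the power; adding both exponentials removes
  the absolute value.\<close>

lemma even_power_le_exp: "x ^ (2 * p) \<le> fact (2 * p) * (exp x + exp (- x))" for x :: real
proof -
  have "\<bar>x\<bar> ^ (2 * p) /\<^sub>R fact (2 * p) \<le> exp \<bar>x\<bar>"
    unfolding exp_def using summable_exp_generic[of "\<bar>x\<bar>"] sum_le_suminf[of "\<lambda>n. \<bar>x\<bar> ^ n /\<^sub>R fact n" "{2 * p}"] by simp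
  moreover have "\<bar>x\<bar> ^ (2 * p) = x ^ (2 * p)" by (simp add: power_mult)
  ultimately have "x ^ (2 * p) \<le> fact (2 * p) * exp \<bar>x\<bar>" by (simp add: field_simps)
  also have "\<dots> \<le> fact (2 * p) * (exp x + exp (- x))" by (intro mult_left_mono) (auto simp: abs_if)
  finally show ?thesis .
qed

lemma sum_signs_power_le:
  assumes J: "finite J" and c: "(\<Sum>e\<in>J. (c e)\<^sup>2) \<le> 1" and p: "p > 0"
  shows "(\<Sum>\<epsilon>\<in>signs J. (\<Sum>e\<in>J. \<epsilon> e * c e) ^ (2 * p)) \<le> 2 ^ card J * (2 * (2 * real p) ^ p * exp (2 * real p))"
proof -
  \<comment> \<open>With t^2 = 2 p, the exponential moment exp (t^2) is exp (2 p), while the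
    factorial of 2 p divided by t^(2 p) is at most (2 p)^p. The moment is then O(p)^p.\<close>
  define t where "t = sqrt (2 * real p)"
  have t: "t\<^sup>2 = 2 * real p" "t > 0" using p by (auto simp: t_def)
  have tp: "t ^ (2 * p) = (2 * real p) ^ p" by (simp add: power_mult t)
  have fact: "fact (2 * p) \<le> (2 * real p) ^ p * t ^ (2 * p)"
  proof -
    have "fact (2 * p) \<le> real ((2 * p) ^ (2 * p))" by (rule fact_le_power)
    also have "\<dots> = (2 * real p) ^ (p + p)" unfolding mult_2[of p, symmetric] by simp
    finally show ?thesis unfolding tp power_add .
  qed
  let ?b = "\<lambda>\<epsilon>. \<Sum>e\<in>J. \<epsilon> e * c e"
  have "(?b \<epsilon>) ^ (2 * p) \<le> (2 * real p) ^ p * (exp (t * ?b \<epsilon>) + exp (- t * ?b \<epsilon>))" for \<epsilon>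
  proof -
    have "t ^ (2 * p) * (?b \<epsilon>) ^ (2 * p) = (t * ?b \<epsilon>) ^ (2 * p)" by (simp add: power_mult_distrib)
    also have "\<dots> \<le> fact (2 * p) * (exp (t * ?b \<epsilon>) + exp (- (t * ?b \<epsilon>)))" by (rule even_power_le_exp)
    also have "\<dots> \<le> (2 * real p) ^ p * t ^ (2 * p) * (exp (t * ?b \<epsilon>) + exp (- (t * ?b \<epsilon>)))"
      by (intro mult_right_mono fact) (simp add: add_nonneg_nonneg)
    finally have "t ^ (2 * p) * (?b \<epsilon>) ^ (2 * p) \<le> t ^ (2 * p) * ((2 * real p) ^ p * (exp (t * ?b \<epsilon>) + exp (- t * ?b \<epsilon>)))"
      by (simp add: ac_simps)
    then show ?thesis using t(2) by simp
  qed
  then have "(\<Sum>\<epsilon>\<in>signs J. (?b \<epsilon>) ^ (2 * p))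
      \<le> (\<Sum>\<epsilon>\<in>signs J. (2 * real p) ^ p * (exp (t * ?b \<epsilon>) + exp (- t * ?b \<epsilon>)))" by (rule sum_mono)
  also have "\<dots> = (2 * real p) ^ p * ((\<Sum>\<epsilon>\<in>signs J. exp (t * ?b \<epsilon>)) + (\<Sum>\<epsilon>\<in>signs J. exp (- t * ?b \<epsilon>)))"
    by (simp only: sum_distrib_left[symmetric] sum.distrib)
  also have "\<dots> \<le> (2 * real p) ^ p * (2 ^ card J * exp (t\<^sup>2) + 2 ^ card J * exp ((- t)\<^sup>2))"
    by (intro mult_left_mono add_mono sum_signs_exp_le J c) auto
  also have "\<dots> = 2 ^ card J * (2 * (2 * real p) ^ p * exp (2 * real p))" by (simp add: t(1))
  finally show ?thesis .
qed

text \<open>The base of a \<open>p\<close>-th power: 4 from the squared factor 2 of the net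
  argument, \<open>(3 * 2 ^ 16) ^ 8\<close> from pairs of net points in dimension 4 p,
  \<open>2 * exp 2\<close> from the moment bound. The outer 2 swallows the factor 2 in front of that
  bound.\<close>

definition trace_const :: real where
  "trace_const = 2 * (4 * (3 * 2 ^ 16) ^ 8 * 2 * exp 2)"

lemma trace_const_pos: "trace_const > 0"
  by (simp add: trace_const_def)

text \<open>The norm is at most twice the maximum over pairs of net points, and the 2 p-th power of
  a maximum is at most the sum of the 2 p-th powers, whose means are controlled. The number of pairs
  is exponential in \<open>r = 4 * p\<close>, so it enters only the base of the \<open>p\<close>-th
  power.\<close>

lemma sign_matrix_trace_pow_le:
  assumes p: "p > 0" and r: "r = 4 * p"
  shows "(\<Sum>\<epsilon>\<in>signs ({..<r} \<times> {..<r}). trace_pow r p \<epsilon>) \<le> 2 ^ (r * r) * (real r * (trace_const * real p) ^ p)"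
proof -
  let ?J = "{..<r} \<times> {..<r}" and ?c = "\<lambda>z z' (i, j). net_point r z i * net_point r z' j"
  define b where "b \<epsilon> z z' = bilin r \<epsilon> (net_point r z) (net_point r z')" for \<epsilon> z z'
  define V where "V \<epsilon> = (\<Sum>z\<in>net r. \<Sum>z'\<in>net r. (b \<epsilon> z z') ^ (2 * p))" for \<epsilon>
  have b_sum: "b \<epsilon> z z' = (\<Sum>e\<in>?J. \<epsilon> e * ?c z z' e)" for \<epsilon> z z'
    by (simp add: b_def bilin_def sum.cartesian_product case_prod_unfold mult.assoc)
  have c: "(\<Sum>e\<in>?J. (?c z z' e)\<^sup>2) \<le> 1" if "z \<in> net r" "z' \<in> net r" for z z'
  proof -
    have "(\<Sum>e\<in>?J. (?c z z' e)\<^sup>2) = (\<Sum>i<r. (net_point r z i)\<^sup>2) * (\<Sum>j<r. (net_point r z' j)\<^sup>2)"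
      by (simp add: sum_product sum.cartesian_product case_prod_unfold power_mult_distrib)
    also have "\<dots> \<le> 1 * 1"
      using net_point_in_ball2[OF that(1)] net_point_in_ball2[OF that(2)]
      by (intro mult_mono) (auto simp: ball2_def intro: sum_nonneg)
    finally show ?thesis by simp
  qed
  have trace: "trace_pow r p \<epsilon> \<le> real r * (4 ^ p * V \<epsilon>)" for \<epsilon>
  proof -
    define m where "m = Max ((\<lambda>(z, z'). \<bar>b \<epsilon> z z'\<bar>) ` (net r \<times> net r))"
    have fin: "finite (net r \<times> net r)" using finite_net by simp
    have "(\<lambda>_. 0) \<in> ball2 r 1" by (simp add: ball2_def)
    then have ne: "net r \<times> net r \<noteq> {}" using net_approx by fast
    have m: "\<bar>b \<epsilon> z z'\<bar> \<le> m" if "z \<in> net r" "z' \<in> net r" for z z'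
      unfolding m_def using fin that by (intro Max_ge) force+
    have "m \<in> (\<lambda>(z, z'). \<bar>b \<epsilon> z z'\<bar>) ` (net r \<times> net r)"
      unfolding m_def using fin ne by (intro Max_in) auto
    then obtain z z' where z: "z \<in> net r" "z' \<in> net r" "m = \<bar>b \<epsilon> z z'\<bar>" by auto
    have "m ^ (2 * p) = (b \<epsilon> z z') ^ (2 * p)" by (simp add: z(3) power_mult)
    also have "\<dots> \<le> (\<Sum>z'\<in>net r. (b \<epsilon> z z') ^ (2 * p))"
      using z finite_net by (intro member_le_sum) (auto simp: power_mult)
    also have "\<dots> \<le> V \<epsilon>"
      unfolding V_def using z finite_net
      by (intro member_le_sum[of z "net r" "\<lambda>z. \<Sum>z'\<in>net r. (b \<epsilon> z z') ^ (2 * p)"])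
        (auto simp: power_mult intro!: sum_nonneg)
    finally have mV: "m ^ (2 * p) \<le> V \<epsilon>" .
    have "bilin r \<epsilon> u v \<le> 2 * m" if "u \<in> ball2 r 1" "v \<in> ball2 r 1" for u v
      using that m by (intro bilin_le_net) (auto simp: b_def abs_le_iff)
    from bilin_sq_le[OF this] have "trace_pow r p \<epsilon> \<le> real r * ((2 * m)\<^sup>2) ^ p"
      by (intro trace_pow_le) (auto simp: bilin_def)
    also have "((2 * m)\<^sup>2) ^ p = 4 ^ p * m ^ (2 * p)" by (simp add: power_mult_distrib power_mult)
    also have "real r * \<dots> \<le> real r * (4 ^ p * V \<epsilon>)" by (intro mult_left_mono mV) auto
    finally show ?thesis .
  qed
  let ?M = "2 * (2 * real p) ^ p * exp (2 * real p)"
  have "(\<Sum>\<epsilon>\<in>signs ?J. V \<epsilon>) = (\<Sum>z\<in>net r. \<Sum>\<epsilon>\<in>signs ?J. \<Sum>z'\<in>net r. (b \<epsilon> z z') ^ (2 * p))"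
    unfolding V_def by (rule sum.swap)
  also have "\<dots> = (\<Sum>z\<in>net r. \<Sum>z'\<in>net r. \<Sum>\<epsilon>\<in>signs ?J. (b \<epsilon> z z') ^ (2 * p))"
    by (intro sum.cong[OF refl] sum.swap)
  also have "\<dots> \<le> (\<Sum>z\<in>net r. \<Sum>z'\<in>net r. 2 ^ card ?J * ?M)"
    unfolding b_sum using c p by (intro sum_mono sum_signs_power_le) auto
  also have "\<dots> = (real (card (net r)))\<^sup>2 * (2 ^ (r * r) * ?M)"
    by (simp add: power2_eq_square)
  also have "\<dots> \<le> ((3 * 2 ^ 16) ^ r)\<^sup>2 * (2 ^ (r * r) * ?M)"
    using card_net_le by (intro mult_right_mono power_mono) auto
  finally have V: "(\<Sum>\<epsilon>\<in>signs ?J. V \<epsilon>) \<le> ((3 * 2 ^ 16) ^ r)\<^sup>2 * (2 ^ (r * r) * ?M)" .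
  have "(\<Sum>\<epsilon>\<in>signs ?J. trace_pow r p \<epsilon>) \<le> (\<Sum>\<epsilon>\<in>signs ?J. real r * (4 ^ p * V \<epsilon>))"
    by (intro sum_mono trace)
  also have "\<dots> = real r * 4 ^ p * (\<Sum>\<epsilon>\<in>signs ?J. V \<epsilon>)" by (simp add: sum_distrib_left mult.assoc)
  also have "\<dots> \<le> real r * 4 ^ p * (((3 * 2 ^ 16) ^ r)\<^sup>2 * (2 ^ (r * r) * ?M))"
    by (intro mult_left_mono V) auto
  also have "\<dots> = 2 ^ (r * r) * (real r * (2 * (4 * (3 * 2 ^ 16) ^ 8 * 2 * exp 2 * real p) ^ p))"
  proof -
    have 1: "((3 * 2 ^ 16 :: real) ^ r)\<^sup>2 = ((3 * 2 ^ 16) ^ 8) ^ p"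
      unfolding r power_mult[symmetric] by (simp add: mult.commute)
    have 2: "exp (2 * real p) = exp 2 ^ p" by (simp add: exp_of_nat2_mult)
    have "real r * 4 ^ p * (D ^ p * (2 ^ (r * r) * (2 * (2 * real p) ^ p * E ^ p)))
        = 2 ^ (r * r) * (real r * (2 * (4 * D * 2 * E * real p) ^ p))" for D E :: real
      unfolding power_mult_distrib by (simp only: mult_ac)
    then show ?thesis unfolding 1 2 .
  qed
  also have "\<dots> \<le> 2 ^ (r * r) * (real r * (trace_const * real p) ^ p)"
  proof -
    have double: "2 * x ^ p \<le> (2 * x) ^ p" if "x \<ge> 0" for x :: real
      using p that self_le_power[of "2 :: real" p] by (auto simp: power_mult_distrib intro!: mult_right_mono)
    show ?thesis
      unfolding trace_const_def mult.assoc[of "2 :: real" _ "real p"] by (intro mult_left_mono double) auto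
  qed
  finally show ?thesis .
qed

text \<open>\<open>B\<close> dominates the operator norm and has a controlled mean. It comes from x
  <= c * (1 + (x / c)^(2 p)), where c^(2 p) is an upper bound for the mean trace; the factor
  \<open>n\<close> of the trace disappears in exp p.\<close>

lemma light_matrix_bound:
  assumes I: "finite I" and a: "\<And>e. e \<notin> I \<Longrightarrow> a e = 0" "\<And>e. 0 \<le> a e" "\<And>e. a e \<le> 1"
    and p: "p = 2 ^ Suc k" "real n \<le> exp (real p)"
    and row: "\<And>i. (\<Sum>j<n. (a (i, j))\<^sup>2) \<le> real p" and col: "\<And>j. (\<Sum>i<n. (a (i, j))\<^sup>2) \<le> real p"
  shows "\<exists>B. (\<Sum>\<epsilon>\<in>signs I. B \<epsilon>) \<le> 2 ^ card I * (2 * sqrt (exp 1 * trace_const * real p)) \<and>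
    (\<forall>\<epsilon>. \<forall>u\<in>ball2 n 1. \<forall>v\<in>ball2 n 1. bilin n (\<lambda>e. \<epsilon> e * a e) u v \<le> B \<epsilon>)"
proof -
  define c where "c = sqrt (exp 1 * trace_const * real p)"
  have p0: "p > 0" using p by simp
  have c: "c > 0" "c\<^sup>2 = exp 1 * trace_const * real p"
    using p0 trace_const_pos by (auto simp: c_def)
  have cp: "c ^ (2 * p) = exp (real p) * (trace_const * real p) ^ p"
    by (simp add: power_mult c(2) power_mult_distrib mult.assoc flip: exp_of_nat_mult)
  let ?T = "\<lambda>\<epsilon>. trace_pow n p (\<lambda>e. \<epsilon> e * a e)"
  define B where "B \<epsilon> = c * (1 + ?T \<epsilon> / c ^ (2 * p))" for \<epsilon>
  have "(\<Sum>\<epsilon>\<in>signs I. ?T \<epsilon>) \<le> 2 ^ card I * (real n * (trace_const * real p) ^ p)"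
    \<comment> \<open>With \<open>D = p\<close> the comparison asks for size at least 3 p; 4 p is
      the size for which the sign matrix has been bounded.\<close>
    using trace_pow_comparison[OF I a row col, of p "4 * p" "(trace_const * real p) ^ p"]
      sign_matrix_trace_pow_le[OF p0 refl] p0 by simp
  also have "\<dots> \<le> 2 ^ card I * c ^ (2 * p)"
    unfolding cp using p(2) trace_const_pos by (intro mult_left_mono mult_right_mono) auto
  finally have T: "(\<Sum>\<epsilon>\<in>signs I. ?T \<epsilon>) / c ^ (2 * p) \<le> 2 ^ card I"
    using c(1) by (simp add: divide_le_eq)
  have "(\<Sum>\<epsilon>\<in>signs I. B \<epsilon>) = c * (2 ^ card I + (\<Sum>\<epsilon>\<in>signs I. ?T \<epsilon>) / c ^ (2 * p))"
    using I by (simp add: B_def sum_distrib_left[symmetric] sum.distrib card_signs sum_divide_distrib)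
  also have "\<dots> \<le> c * (2 ^ card I + 2 ^ card I)" using T c(1) by (intro mult_left_mono) auto
  finally have 1: "(\<Sum>\<epsilon>\<in>signs I. B \<epsilon>) \<le> 2 ^ card I * (2 * c)" by (simp add: mult_ac)
  have 2: "bilin n (\<lambda>e. \<epsilon> e * a e) u v \<le> B \<epsilon>" if "u \<in> ball2 n 1" "v \<in> ball2 n 1" for \<epsilon> u v
  proof -
    let ?x = "bilin n (\<lambda>e. \<epsilon> e * a e) u v"
    have le: "?x ^ (2 * p) \<le> ?T \<epsilon>"
      using bilinear_pow_le_trace_pow[of u n v "\<lambda>e. \<epsilon> e * a e" k] that
      by (simp only: bilin_def p(1) ball2_def) simp
    have "?x / c \<le> 1 + (?x / c) ^ (2 * p)"
    proof (cases "?x / c \<le> 1")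
      case True
      then show ?thesis by (rule order_trans) (simp add: power_mult)
    next
      case False
      then show ?thesis using self_le_power[of "?x / c" "2 * p"] p0 by linarith
    qed
    also have "\<dots> \<le> 1 + ?T \<epsilon> / c ^ (2 * p)"
      using le c(1) by (simp add: power_divide divide_right_mono)
    finally show ?thesis using c(1) by (simp add: B_def field_simps)
  qed
  show ?thesis using 1 2 unfolding c_def by (intro exI[of _ B]) blast
qed

section \<open>Splitting entries by size\<close>

lemma bilin_schur_test:
  assumes u: "u \<in> ball2 n 1" and v: "v \<in> ball2 n 1"
    and row: "\<And>i. (\<Sum>j<n. \<bar>Q (i, j)\<bar>) \<le> M" and col: "\<And>j. (\<Sum>i<n. \<bar>Q (i, j)\<bar>) \<le> M"
  shows "bilin n Q u v \<le> M"
proof -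
  have M: "M \<ge> 0" using order_trans[OF _ row] by (simp add: sum_nonneg)
  \<comment> \<open>The inequality of the means splits each term into one part to be summed along
    rows and one along columns.\<close>
  have am: "Q (i, j) * u i * v j \<le> \<bar>Q (i, j)\<bar> * (u i)\<^sup>2 / 2 + \<bar>Q (i, j)\<bar> * (v j)\<^sup>2 / 2" for i j
  proof -
    have "0 \<le> (\<bar>u i\<bar> - \<bar>v j\<bar>)\<^sup>2" by simp
    then have "\<bar>u i\<bar> * \<bar>v j\<bar> \<le> ((u i)\<^sup>2 + (v j)\<^sup>2) / 2"
      by (simp add: power2_diff)
    then have "\<bar>Q (i, j)\<bar> * (\<bar>u i\<bar> * \<bar>v j\<bar>) \<le> \<bar>Q (i, j)\<bar> * (((u i)\<^sup>2 + (v j)\<^sup>2) / 2)"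
      by (rule mult_left_mono) simp
    moreover have "Q (i, j) * u i * v j \<le> \<bar>Q (i, j)\<bar> * (\<bar>u i\<bar> * \<bar>v j\<bar>)"
      by (metis abs_ge_self abs_mult mult.assoc)
    ultimately show ?thesis by (simp add: distrib_left add_divide_distrib)
  qed
  have "bilin n Q u v \<le> (\<Sum>i<n. \<Sum>j<n. \<bar>Q (i, j)\<bar> * (u i)\<^sup>2 / 2 + \<bar>Q (i, j)\<bar> * (v j)\<^sup>2 / 2)"
    unfolding bilin_def by (intro sum_mono am)
  also have "\<dots> = (\<Sum>i<n. \<Sum>j<n. \<bar>Q (i, j)\<bar> * (u i)\<^sup>2 / 2) + (\<Sum>j<n. \<Sum>i<n. \<bar>Q (i, j)\<bar> * (v j)\<^sup>2 / 2)"
    unfolding sum.distrib by (subst (2) sum.swap) simp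
  also have "\<dots> = (\<Sum>i<n. (\<Sum>j<n. \<bar>Q (i, j)\<bar>) * ((u i)\<^sup>2 / 2)) + (\<Sum>j<n. (\<Sum>i<n. \<bar>Q (i, j)\<bar>) * ((v j)\<^sup>2 / 2))"
    unfolding sum_distrib_right unfolding times_divide_eq_right ..
  also have "\<dots> \<le> (\<Sum>i<n. M * ((u i)\<^sup>2 / 2)) + (\<Sum>j<n. M * ((v j)\<^sup>2 / 2))"
    by (intro add_mono sum_mono mult_right_mono row col) simp_all
  also have "\<dots> = M * ((\<Sum>i<n. (u i)\<^sup>2) + (\<Sum>j<n. (v j)\<^sup>2)) / 2"
    by (simp add: sum_distrib_left sum_divide_distrib distrib_left add_divide_distrib)
  also have "\<dots> \<le> M * (1 + 1) / 2"
    using u v M by (intro divide_right_mono mult_left_mono add_mono) (simp_all add: ball2_def)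
  finally show ?thesis by simp
qed

text \<open>Supplies the exponent that repeated squaring requires. When it is the smallest one, 2,
  the upper bound is the assumption \<open>x \<ge> 1\<close>.\<close>

lemma ex_power2_between:
  fixes x :: real
  assumes "x \<ge> 1"
  shows "\<exists>k. x \<le> real (2 ^ Suc k) \<and> real (2 ^ Suc k) \<le> 2 * x"
proof -
  define k where "k = (LEAST k. x \<le> real (2 ^ Suc k))"
  obtain m where "x < 2 ^ m" using real_arch_pow[of 2 x] by auto
  moreover have "(2 :: real) ^ m \<le> 2 ^ Suc m" by (rule power_increasing) simp_all
  ultimately have "x \<le> 2 ^ Suc m" by linarith
  then have "x \<le> real (2 ^ Suc m)" by (simp only: of_nat_power of_nat_numeral)
  then have k: "x \<le> real (2 ^ Suc k)" unfolding k_def by (rule LeastI)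
  moreover have "real (2 ^ Suc k) \<le> 2 * x"
  proof (cases k)
    case (Suc j)
    have "\<not> x \<le> real (2 ^ Suc j)"
      unfolding k_def by (rule not_less_Least) (use Suc in \<open>simp add: k_def\<close>)
    then show ?thesis using Suc by simp
  qed (use assms in simp)
  ultimately show ?thesis by blast
qed

lemma ln_ge_half:
  assumes "n \<ge> 2" shows "ln (real n) \<ge> 1 / 2"
proof -
  have "ln (1 / 2 :: real) \<le> 1 / 2 - 1" by (rule ln_le_minus_one) simp
  then have "ln (2 :: real) \<ge> 1 / 2" by (simp add: ln_div)
  also have "ln 2 \<le> ln (real n)" using assms by simp
  finally show ?thesis by simp
qed

text \<open>The first summand is the share of the light entries, the 1 that of the heavy
  ones.\<close>

definition matrix_const :: real where
  "matrix_const = 4 * sqrt (exp 1 * trace_const) + 1"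

lemma matrix_const_pos: "matrix_const > 0"
  using trace_const_pos by (simp add: matrix_const_def add_nonneg_pos)

text \<open>Entries below \<open>R / (ln n)\<^sup>1\<^sup>/\<^sup>4\<close> are handled by the trace method; since a row contains few larger
  entries, those are handled by the Schur test, whatever their signs.\<close>

lemma sign_matrix_bound:
  assumes I: "finite I" and a: "\<And>e. e \<notin> I \<Longrightarrow> a e = 0" "\<And>e. 0 \<le> a e" and n: "n \<ge> 2" and R: "R > 0"
    and row: "\<And>i. (\<Sum>j<n. (a (i, j))\<^sup>2) \<le> R\<^sup>2" and col: "\<And>j. (\<Sum>i<n. (a (i, j))\<^sup>2) \<le> R\<^sup>2"
  shows "\<exists>B. (\<Sum>\<epsilon>\<in>signs I. B \<epsilon>) \<le> 2 ^ card I * (matrix_const * R * sqrt (sqrt (ln (real n)))) \<and>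
    (\<forall>\<epsilon>\<in>signs I. \<forall>u\<in>ball2 n 1. \<forall>v\<in>ball2 n 1. bilin n (\<lambda>e. \<epsilon> e * a e) u v \<le> B \<epsilon>)"
proof -
  define L where "L = ln (real n)"
  have L: "L \<ge> 1 / 2" using ln_ge_half[OF n] by (simp add: L_def)
  define q where "q = sqrt (sqrt L)"
  have q: "q > 0" "q\<^sup>2 = sqrt L" using L by (auto simp: q_def)
  \<comment> \<open>The exponent must be at least 2 L, so that n = exp L is at most exp p and the
    rescaled row bound q^2 = sqrt L is at most p; being at most 4 L keeps sqrt p of order
    q^2.\<close>
  obtain k where k: "2 * L \<le> real (2 ^ Suc k)" "real (2 ^ Suc k) \<le> 2 * (2 * L)"
    using ex_power2_between[of "2 * L"] L by auto
  define p :: nat where "p = 2 ^ Suc k"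
  have p: "2 * L \<le> real p" "real p \<le> 4 * L" using k by (simp_all add: p_def)
  have "sqrt L \<le> real p"
  proof -
    have "L * 1 \<le> L * (4 * L)" using L by (intro mult_left_mono) auto
    then have "L \<le> (2 * L)\<^sup>2" by (simp add: power2_eq_square)
    then have "sqrt L \<le> 2 * L" using L by (intro real_le_lsqrt) auto
    then show ?thesis using p by simp
  qed
  then have qp: "q\<^sup>2 \<le> real p" using q by simp
  have "exp L \<le> exp (real p)" using p L by simp
  then have np: "real n \<le> exp (real p)" using n by (simp add: L_def)
  define al where "al e = (if a e \<le> R / q then a e * (q / R) else 0)" for e
  define ah where "ah e = (if a e \<le> R / q then 0 else a e)" for e
  have split: "a e = R / q * al e + ah e" for e using q R by (simp add: al_def ah_def)
  have al: "0 \<le> al e" "al e \<le> 1" "e \<notin> I \<Longrightarrow> al e = 0" for e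
    using a[of e] q R by (auto simp: al_def field_simps)
  have al_sq: "(al e)\<^sup>2 \<le> (a e)\<^sup>2 * (q\<^sup>2 / R\<^sup>2)" for e
    by (simp add: al_def power_mult_distrib power_divide)
  have al_sum: "(\<Sum>x<n. (al (g x))\<^sup>2) \<le> real p" if "(\<Sum>x<n. (a (g x))\<^sup>2) \<le> R\<^sup>2" for g
  proof -
    have "(\<Sum>x<n. (al (g x))\<^sup>2) \<le> (\<Sum>x<n. (a (g x))\<^sup>2) * (q\<^sup>2 / R\<^sup>2)"
      unfolding sum_distrib_right by (intro sum_mono al_sq)
    also have "\<dots> \<le> R\<^sup>2 * (q\<^sup>2 / R\<^sup>2)" using that by (intro mult_right_mono) auto
    also have "\<dots> \<le> real p" using qp R by simp
    finally show ?thesis .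
  qed
  \<comment> \<open>A heavy entry satisfies \<open>1 \<le> a e * (q / R)\<close>, hence is at most
    its square times q / R. Bounds on sums of squares thereby become bounds on plain sums.\<close>
  have ah_le: "ah e \<le> (a e)\<^sup>2 * (q / R)" for e
  proof (cases "a e \<le> R / q")
    case False
    then have "1 \<le> a e * (q / R)" using q R by (simp add: field_simps)
    then have "a e * 1 \<le> a e * (a e * (q / R))" by (intro mult_left_mono a)
    then show ?thesis using False by (simp add: ah_def power2_eq_square mult.assoc)
  qed (use q R in \<open>simp add: ah_def\<close>)
  have ah0: "0 \<le> ah e" "e \<notin> I \<Longrightarrow> ah e = 0" for e using a by (auto simp: ah_def)
  have ah_sum: "(\<Sum>x<n. ah (g x)) \<le> R * q" if "(\<Sum>x<n. (a (g x))\<^sup>2) \<le> R\<^sup>2" for g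
  proof -
    have "(\<Sum>x<n. ah (g x)) \<le> (\<Sum>x<n. (a (g x))\<^sup>2) * (q / R)"
      unfolding sum_distrib_right by (intro sum_mono ah_le)
    also have "\<dots> \<le> R\<^sup>2 * (q / R)" using that q R by (intro mult_right_mono) auto
    also have "\<dots> = R * q" using R by (simp add: power2_eq_square)
    finally show ?thesis .
  qed
  obtain B where B: "(\<Sum>\<epsilon>\<in>signs I. B \<epsilon>) \<le> 2 ^ card I * (2 * sqrt (exp 1 * trace_const * real p))"
    "\<And>\<epsilon> u v. u \<in> ball2 n 1 \<Longrightarrow> v \<in> ball2 n 1 \<Longrightarrow> bilin n (\<lambda>e. \<epsilon> e * al e) u v \<le> B \<epsilon>"
    using light_matrix_bound[OF I al(3) al(1,2) p_def np al_sum[OF row] al_sum[OF col]] by blast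
  define B' where "B' \<epsilon> = R / q * B \<epsilon> + R * q" for \<epsilon>
  have 1: "(\<Sum>\<epsilon>\<in>signs I. B' \<epsilon>) \<le> 2 ^ card I * (matrix_const * R * q)"
  proof -
    have "sqrt (exp 1 * trace_const * real p) \<le> sqrt (exp 1 * trace_const * (4 * L))"
      using p trace_const_pos by (intro real_sqrt_le_mono mult_left_mono) auto
    also have "\<dots> = 2 * sqrt (exp 1 * trace_const) * q\<^sup>2"
      unfolding q(2) by (simp add: real_sqrt_mult)
    finally have s: "2 * sqrt (exp 1 * trace_const * real p) \<le> 4 * sqrt (exp 1 * trace_const) * q\<^sup>2"
      by simp
    have "(\<Sum>\<epsilon>\<in>signs I. B' \<epsilon>) = R / q * (\<Sum>\<epsilon>\<in>signs I. B \<epsilon>) + 2 ^ card I * (R * q)"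
      unfolding B'_def sum.distrib using I by (simp add: sum_distrib_left card_signs)
    also have "\<dots> \<le> R / q * (2 ^ card I * (4 * sqrt (exp 1 * trace_const) * q\<^sup>2)) + 2 ^ card I * (R * q)"
    proof -
      have "(\<Sum>\<epsilon>\<in>signs I. B \<epsilon>) \<le> 2 ^ card I * (4 * sqrt (exp 1 * trace_const) * q\<^sup>2)"
        by (rule order_trans[OF B(1)]) (intro mult_left_mono s, simp)
      then show ?thesis using R q by (intro add_right_mono mult_left_mono) auto
    qed
    also have "\<dots> = 2 ^ card I * (matrix_const * R * q)"
      using q(1) R by (simp add: matrix_const_def power2_eq_square algebra_simps)
    finally show ?thesis .
  qed
  have 2: "bilin n (\<lambda>e. \<epsilon> e * a e) u v \<le> B' \<epsilon>" if \<epsilon>: "\<epsilon> \<in> signs I" and u: "u \<in> ball2 n 1" and v: "v \<in> ball2 n 1" for \<epsilon> u v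
  proof -
    have "bilin n (\<lambda>e. \<epsilon> e * a e) u v = R / q * bilin n (\<lambda>e. \<epsilon> e * al e) u v + bilin n (\<lambda>e. \<epsilon> e * ah e) u v"
      unfolding bilin_def sum_distrib_left sum.distrib[symmetric]
      by (intro sum.cong[OF refl]) (simp add: split algebra_simps)
    also have "R / q * bilin n (\<lambda>e. \<epsilon> e * al e) u v \<le> R / q * B \<epsilon>"
      using R q by (intro mult_left_mono B(2)[OF u v]) auto
    also have "bilin n (\<lambda>e. \<epsilon> e * ah e) u v \<le> R * q"
    proof (rule bilin_schur_test[OF u v])
      have abs: "\<bar>\<epsilon> e * ah e\<bar> = ah e" for e
        using signs_cases[OF \<epsilon>, of e] ah0[of e] by (cases "e \<in> I") (auto simp: abs_mult)
      show "(\<Sum>j<n. \<bar>\<epsilon> (i, j) * ah (i, j)\<bar>) \<le> R * q" for i unfolding abs by (rule ah_sum[OF row])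
      show "(\<Sum>i<n. \<bar>\<epsilon> (i, j) * ah (i, j)\<bar>) \<le> R * q" for j unfolding abs by (rule ah_sum[OF col])
    qed
    finally show ?thesis by (simp add: B'_def)
  qed
  show ?thesis using 1 2 unfolding q_def L_def by blast
qed

section \<open>The weighted trace-norm ball\<close>

lemma weighted_ball_duality:
  fixes P :: "nat \<Rightarrow> nat \<Rightarrow> real"
  assumes X: "X \<in> weighted_ball \<rho> qr qc" and dim: "dim_vec qr = n" "dim_vec qc = m"
    and bil: "\<And>u v. u \<in> ball2 n 1 \<Longrightarrow> v \<in> ball2 m 1 \<Longrightarrow> (\<Sum>i<n. \<Sum>j<m. P i j * u i * v j) \<le> B"
  shows "(\<Sum>i<n. \<Sum>j<m. P i j * (sqrt (qr $ i) * X $$ (i, j) * sqrt (qc $ j))) \<le> B * sqrt \<rho>"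
proof -
  have Xc: "X \<in> carrier_mat n m" and tn: "weighted_trace_norm qr qc X \<le> sqrt \<rho>"
    using X dim by (auto simp: weighted_ball_def)
  define A where "A = mat_diag n (\<lambda>i. sqrt (qr $ i)) * X * mat_diag m (\<lambda>j. sqrt (qc $ j))"
  have A: "A \<in> carrier_mat n m"
    unfolding A_def by (rule mult_carrier_mat[OF mult_carrier_mat[OF mat_diag_dim Xc] mat_diag_dim])
  have entry: "A $$ (i, j) = sqrt (qr $ i) * X $$ (i, j) * sqrt (qc $ j)" if "i < n" "j < m" for i j
    unfolding A_def using Xc that
    by (simp add: mat_diag_mult_left[of X n m] mat_diag_mult_right[of _ n m])
  have B: "B \<ge> 0" using bil[of "\<lambda>_. 0" "\<lambda>_. 0"] by (simp add: ball2_def)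
  have "(\<Sum>i<n. \<Sum>j<m. P i j * (sqrt (qr $ i) * X $$ (i, j) * sqrt (qc $ j))) = (\<Sum>i<n. \<Sum>j<m. P i j * A $$ (i, j))"
    by (intro sum.cong[OF refl]) (simp add: entry)
  also have "\<dots> \<le> B * trace_norm A"
    using bil by (intro trace_norm_duality[OF A]) (simp add: ball2_def)
  also have "\<dots> \<le> B * sqrt \<rho>"
    using tn B dim by (intro mult_left_mono) (auto simp: weighted_trace_norm_def A_def)
  finally show ?thesis .
qed

text \<open>Duality with the matrix whose only nonzero entry is 1 or -1 at \<open>(i, j)\<close>
  bounds the rescaled entry, and positive weights can be divided out. This is what makes linear
  suprema over the ball finite.\<close>

lemma weighted_ball_entry_bounded:
  assumes q: "qr $ i > 0" "qc $ j > 0" and ij: "i < dim_vec qr" "j < dim_vec qc"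
  shows "bounded ((\<lambda>X. X $$ (i, j)) ` weighted_ball \<rho> qr qc)"
proof -
  let ?c = "sqrt (qr $ i) * sqrt (qc $ j)"
  have c: "?c > 0" using q by simp
  have one: "\<sigma> * u i * v j \<le> 1" if "\<bar>\<sigma>\<bar> = 1" "u \<in> ball2 (dim_vec qr) 1" "v \<in> ball2 (dim_vec qc) 1" for \<sigma> u v
  proof -
    have "(u i)\<^sup>2 \<le> (\<Sum>i<dim_vec qr. (u i)\<^sup>2)" "(v j)\<^sup>2 \<le> (\<Sum>j<dim_vec qc. (v j)\<^sup>2)"
      using ij by (auto intro!: member_le_sum)
    then have "\<bar>u i\<bar> \<le> 1" "\<bar>v j\<bar> \<le> 1" using that by (auto simp: ball2_def simp flip: abs_square_le_1)
    then have "\<bar>u i\<bar> * \<bar>v j\<bar> \<le> 1" by (simp add: mult_le_one)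
    then have "\<bar>\<sigma> * u i * v j\<bar> \<le> 1" using that by (simp add: abs_mult)
    then show ?thesis by simp
  qed
  have "\<bar>X $$ (i, j)\<bar> \<le> sqrt \<rho> / ?c" if X: "X \<in> weighted_ball \<rho> qr qc" for X
  proof -
    have "\<sigma> * (?c * X $$ (i, j)) \<le> sqrt \<rho>" if \<sigma>: "\<bar>\<sigma>\<bar> = 1" for \<sigma>
    proof -
      define P where "P i' j' = (if i' = i then if j' = j then \<sigma> else 0 else 0)" for i' j'
      have pick: "(\<Sum>i'<dim_vec qr. \<Sum>j'<dim_vec qc. P i' j' * F i' j') = \<sigma> * F i j" for F :: "nat \<Rightarrow> nat \<Rightarrow> real"
      proof -
        have "(\<Sum>j'<dim_vec qc. P i' j' * F i' j') = (if i' = i then \<sigma> * F i' j else 0)" for i'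
        proof (cases "i' = i")
          case True
          have "(\<Sum>j'<dim_vec qc. P i' j' * F i' j') = (\<Sum>j'<dim_vec qc. if j' = j then \<sigma> * F i' j' else 0)"
            using True by (intro sum.cong[OF refl]) (simp add: P_def)
          then show ?thesis using True ij by (simp only: sum.delta finite_lessThan lessThan_iff if_True simp_thms)
        qed (simp add: P_def)
        then show ?thesis using ij by (simp only: sum.delta finite_lessThan lessThan_iff if_True)
      qed
      have "(\<Sum>i'<dim_vec qr. \<Sum>j'<dim_vec qc. P i' j' * u i' * v j') \<le> 1"
        if "u \<in> ball2 (dim_vec qr) 1" "v \<in> ball2 (dim_vec qc) 1" for u v
        using one[OF \<sigma> that] pick[of "\<lambda>i j. u i * v j"] by (simp add: mult.assoc)
      from weighted_ball_duality[OF X refl refl this]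
      show ?thesis unfolding pick by (simp add: mult_ac)
    qed
    from this[of 1] this[of "-1"] have "\<bar>?c * X $$ (i, j)\<bar> \<le> sqrt \<rho>" by (simp add: abs_le_iff)
    then have "?c * \<bar>X $$ (i, j)\<bar> \<le> sqrt \<rho>" using c q by (simp add: abs_mult)
    then show ?thesis using c by (simp add: pos_le_divide_eq mult.commute)
  qed
  then show ?thesis by (auto simp: bounded_iff)
qed


text \<open>Smoothed empirical marginals of a sample of size \<open>A / 2\<close> that contains \<open>I\<close> satisfy the
  hypotheses on \<open>A\<close>.\<close>

lemma weighted_ball_rademacher:
  assumes I: "I \<subseteq> {..<n} \<times> {..<m}" and m: "m \<le> n" "n \<ge> 2" and A: "A > 0" and \<rho>: "\<rho> \<ge> 0"
    and ne: "weighted_ball \<rho> qr qc \<noteq> {}"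
    and dim: "dim_vec qr = n" "dim_vec qc = m"
    and qr: "\<And>i. i < n \<Longrightarrow> 1 / (2 * real n) \<le> qr $ i"
    and qc: "\<And>j. j < m \<Longrightarrow> 1 / (2 * real n) \<le> qc $ j"
    and row: "\<And>i. i < n \<Longrightarrow> real (card {j. (i, j) \<in> I}) \<le> A * qr $ i"
    and col: "\<And>j. j < m \<Longrightarrow> real (card {i. (i, j) \<in> I}) \<le> A * qc $ j"
  shows "(\<Sum>\<epsilon>\<in>signs I. SUP X\<in>weighted_ball \<rho> qr qc. \<Sum>e\<in>I. \<epsilon> e * X $$ e)
    \<le> 2 ^ card I * (matrix_const * sqrt (2 * A * real n) * sqrt (sqrt (ln (real n))) * sqrt \<rho>)"
proof -
  have finI: "finite I" using I finite_subset by blast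
  have n0: "0 < 1 / (2 * real n)" using m by simp
  have pos: "qr $ i > 0" if "i < n" for i using less_le_trans[OF n0 qr[OF that]] .
  have pos': "qc $ j > 0" if "j < m" for j using less_le_trans[OF n0 qc[OF that]] .
  define a where "a e = (if e \<in> I then 1 / (sqrt (qr $ fst e) * sqrt (qc $ snd e)) else 0)" for e
  have a0: "0 \<le> a e" for e
    using I pos pos' by (auto simp: a_def less_imp_le)
  have a_sq: "(a (i, j))\<^sup>2 = (if (i, j) \<in> I then 1 / (qr $ i * qc $ j) else 0)" for i j
    using I pos[of i] pos'[of j] by (auto simp: a_def power_mult_distrib power_divide)
  have inv_le: "1 / x \<le> 2 * real n" if "1 / (2 * real n) \<le> x" for x
  proof -
    have x: "0 < x" using n0 that by (rule less_le_trans)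
    have "1 / x \<le> 1 / (1 / (2 * real n))"
      using n0 x by (intro divide_left_mono that mult_pos_pos) simp_all
    then show ?thesis by simp
  qed
  \<comment> \<open>A row has at most \<open>A * qr $ i\<close> cells in \<open>I\<close>, each with
    squared entry at most \<open>2 * real n / qr $ i\<close>, so the row marginal cancels; columns
    are symmetric.\<close>
  have R2: "(sqrt (2 * A * real n))\<^sup>2 = A * (2 * real n)" using A by simp
  have a_row: "(\<Sum>j<n. (a (i, j))\<^sup>2) \<le> (sqrt (2 * A * real n))\<^sup>2" for i
  proof (cases "i < n")
    case True
    have "(\<Sum>j<n. (a (i, j))\<^sup>2) = (\<Sum>j\<in>{j. (i, j) \<in> I}. 1 / (qr $ i * qc $ j))"
      unfolding a_sq using I m by (subst sum.inter_filter[symmetric]) (auto intro!: sum.cong)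
    also have "\<dots> \<le> (\<Sum>j\<in>{j. (i, j) \<in> I}. 1 / qr $ i * (2 * real n))"
    proof (rule sum_mono)
      fix j assume "j \<in> {j. (i, j) \<in> I}"
      then have "1 / qc $ j \<le> 2 * real n" using I by (intro inv_le qc) auto
      then have "1 / qr $ i * (1 / qc $ j) \<le> 1 / qr $ i * (2 * real n)"
        using pos[OF True] by (intro mult_left_mono) auto
      then show "1 / (qr $ i * qc $ j) \<le> 1 / qr $ i * (2 * real n)" by simp
    qed
    also have "\<dots> = real (card {j. (i, j) \<in> I}) * (1 / qr $ i) * (2 * real n)" by simp
    also have "\<dots> \<le> A * qr $ i * (1 / qr $ i) * (2 * real n)"
      using pos[OF True] by (intro mult_right_mono row True) auto
    also have "\<dots> = A * (2 * real n)" using pos[OF True] by simp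
    finally show ?thesis unfolding R2 .
  next
    case False
    then have "(\<Sum>j<n. (a (i, j))\<^sup>2) = 0" using I by (intro sum.neutral) (auto simp: a_def)
    then show ?thesis by simp
  qed
  have a_col: "(\<Sum>i<n. (a (i, j))\<^sup>2) \<le> (sqrt (2 * A * real n))\<^sup>2" for j
  proof (cases "j < m")
    case True
    have "(\<Sum>i<n. (a (i, j))\<^sup>2) = (\<Sum>i\<in>{i. (i, j) \<in> I}. 1 / (qr $ i * qc $ j))"
      unfolding a_sq using I m by (subst sum.inter_filter[symmetric]) (auto intro!: sum.cong)
    also have "\<dots> \<le> (\<Sum>i\<in>{i. (i, j) \<in> I}. 1 / qc $ j * (2 * real n))"
    proof (rule sum_mono)
      fix i assume "i \<in> {i. (i, j) \<in> I}"
      then have "1 / qr $ i \<le> 2 * real n" using I by (intro inv_le qr) auto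
      then have "1 / qc $ j * (1 / qr $ i) \<le> 1 / qc $ j * (2 * real n)"
        using pos'[OF True] by (intro mult_left_mono) auto
      then show "1 / (qr $ i * qc $ j) \<le> 1 / qc $ j * (2 * real n)" by (simp add: mult.commute)
    qed
    also have "\<dots> = real (card {i. (i, j) \<in> I}) * (1 / qc $ j) * (2 * real n)" by simp
    also have "\<dots> \<le> A * qc $ j * (1 / qc $ j) * (2 * real n)"
      using pos'[OF True] by (intro mult_right_mono col True) auto
    also have "\<dots> = A * (2 * real n)" using pos'[OF True] by simp
    finally show ?thesis unfolding R2 .
  next
    case False
    then have "(\<Sum>i<n. (a (i, j))\<^sup>2) = 0" using I by (intro sum.neutral) (auto simp: a_def)
    then show ?thesis by simp
  qed
  have "sqrt (2 * A * real n) > 0" using A m by simp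
  from sign_matrix_bound[OF finI _ a0 m(2) this a_row a_col]
  obtain B where B: "(\<Sum>\<epsilon>\<in>signs I. B \<epsilon>)
      \<le> 2 ^ card I * (matrix_const * sqrt (2 * A * real n) * sqrt (sqrt (ln (real n))))"
    "\<And>\<epsilon> u v. \<epsilon> \<in> signs I \<Longrightarrow> u \<in> ball2 n 1 \<Longrightarrow> v \<in> ball2 n 1 \<Longrightarrow> bilin n (\<lambda>e. \<epsilon> e * a e) u v \<le> B \<epsilon>"
    by (auto simp: a_def)
  have "(SUP X\<in>weighted_ball \<rho> qr qc. \<Sum>e\<in>I. \<epsilon> e * X $$ e) \<le> B \<epsilon> * sqrt \<rho>" if \<epsilon>: "\<epsilon> \<in> signs I" for \<epsilon>
  proof (rule cSUP_least[OF ne])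
    fix X assume X: "X \<in> weighted_ball \<rho> qr qc"
    have bil: "(\<Sum>i<n. \<Sum>j<m. \<epsilon> (i, j) * a (i, j) * u i * v j) \<le> B \<epsilon>"
      if u: "u \<in> ball2 n 1" and v: "v \<in> ball2 m 1" for u v
    proof -
      \<comment> \<open>The sign-matrix bound is for size \<open>n\<close> by \<open>n\<close>; the
        vector on the \<open>m\<close> columns is padded with zeros.\<close>
      define v' where "v' j = (if j < m then v j else 0)" for j
      have ext: "(\<Sum>j<n. F j) = (\<Sum>j<m. F j)" if "\<And>j. \<not> j < m \<Longrightarrow> F j = 0" for F :: "nat \<Rightarrow> real"
        using m that by (intro sum.mono_neutral_right) auto
      have "(\<Sum>j<n. (v' j)\<^sup>2) = (\<Sum>j<m. (v j)\<^sup>2)"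
        by (subst ext) (auto simp: v'_def)
      then have "v' \<in> ball2 n 1" using v by (simp add: ball2_def)
      from B(2)[OF \<epsilon> u this] show ?thesis
        unfolding bilin_def by (subst (asm) ext) (auto simp: v'_def)
    qed
    have "(\<Sum>e\<in>I. \<epsilon> e * X $$ e) = (\<Sum>e\<in>{..<n} \<times> {..<m}. if e \<in> I then \<epsilon> e * X $$ e else 0)"
      using I by (subst sum.inter_restrict[symmetric]) (auto simp: Int_absorb1)
    also have "\<dots> = (\<Sum>i<n. \<Sum>j<m. if (i, j) \<in> I then \<epsilon> (i, j) * X $$ (i, j) else 0)"
      unfolding sum.cartesian_product by (intro sum.cong[OF refl]) auto
    also have "\<dots> = (\<Sum>i<n. \<Sum>j<m. \<epsilon> (i, j) * a (i, j) * (sqrt (qr $ i) * X $$ (i, j) * sqrt (qc $ j)))"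
      using pos pos' by (intro sum.cong[OF refl]) (force simp: a_def)
    also have "\<dots> \<le> B \<epsilon> * sqrt \<rho>"
      by (rule weighted_ball_duality[OF X dim bil])
    finally show "(\<Sum>e\<in>I. \<epsilon> e * X $$ e) \<le> B \<epsilon> * sqrt \<rho>" .
  qed
  then have "(\<Sum>\<epsilon>\<in>signs I. SUP X\<in>weighted_ball \<rho> qr qc. \<Sum>e\<in>I. \<epsilon> e * X $$ e) \<le> (\<Sum>\<epsilon>\<in>signs I. B \<epsilon> * sqrt \<rho>)"
    by (rule sum_mono)
  also have "\<dots> = (\<Sum>\<epsilon>\<in>signs I. B \<epsilon>) * sqrt \<rho>" by (simp add: sum_distrib_right)
  also have "\<dots> \<le> 2 ^ card I * (matrix_const * sqrt (2 * A * real n) * sqrt (sqrt (ln (real n)))) * sqrt \<rho>"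
    using \<rho> by (intro mult_right_mono B) simp
  finally show ?thesis by (simp only: mult.assoc)
qed

section \<open>The transductive bound\<close>

text \<open>Exactly one cell of each matched pair lies in \<open>S\<close>, so the indicator sign
  \<open>\<tau>\<close> equals \<open>- \<epsilon> k\<close> at \<open>k\<close> and
  \<open>\<epsilon> k\<close> at \<open>\<theta> k\<close>.\<close>

lemma sum_diff_matching:
  fixes g :: "'a \<Rightarrow> real"
  assumes U: "finite U" and K: "K \<subseteq> U" and \<theta>: "bij_betw \<theta> K (U - K)" and \<epsilon>: "\<epsilon> \<in> signs K"
  defines "S \<equiv> {k \<in> K. \<epsilon> k = 1} \<union> \<theta> ` {k \<in> K. \<epsilon> k = - 1}"
  shows "(\<Sum>e\<in>U - S. g e) - (\<Sum>e\<in>S. g e) = (\<Sum>k\<in>K. \<epsilon> k * g (\<theta> k)) + (\<Sum>k\<in>K. \<epsilon> k * (- g k))"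
proof -
  define \<tau> where "\<tau> e = (if e \<in> S then - 1 else 1 :: real)" for e
  have S: "S \<subseteq> U" using K \<theta> by (auto simp: S_def bij_betw_def)
  have finK: "finite K" using U K finite_subset by blast
  have inj: "inj_on \<theta> K" and im: "\<theta> ` K = U - K" using \<theta> by (auto simp: bij_betw_def)
  have t1: "\<tau> k = - \<epsilon> k" if "k \<in> K" for k
    using that im signs_cases[OF \<epsilon> that] by (auto simp: \<tau>_def S_def)
  have t2: "\<tau> (\<theta> k) = \<epsilon> k" if "k \<in> K" for k
  proof -
    have "\<theta> k \<in> S \<longleftrightarrow> \<epsilon> k = - 1"
      using that im inj by (auto simp: S_def inj_on_def)
    then show ?thesis using signs_cases[OF \<epsilon> that] by (auto simp: \<tau>_def)
  qed
  have "(\<Sum>e\<in>U - S. g e) - (\<Sum>e\<in>S. g e) = (\<Sum>e\<in>U - S. \<tau> e * g e) + (\<Sum>e\<in>S. \<tau> e * g e)"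
    by (simp add: \<tau>_def sum_negf)
  also have "\<dots> = (\<Sum>e\<in>U. \<tau> e * g e)" by (rule sum.subset_diff[OF S U, symmetric])
  also have "\<dots> = (\<Sum>e\<in>U - K. \<tau> e * g e) + (\<Sum>e\<in>K. \<tau> e * g e)" by (rule sum.subset_diff[OF K U])
  also have "(\<Sum>e\<in>U - K. \<tau> e * g e) = (\<Sum>k\<in>K. \<tau> (\<theta> k) * g (\<theta> k))"
    unfolding im[symmetric] by (simp add: sum.reindex[OF inj])
  also have "\<dots> = (\<Sum>k\<in>K. \<epsilon> k * g (\<theta> k))" by (simp add: t2)
  also have "(\<Sum>e\<in>K. \<tau> e * g e) = (\<Sum>k\<in>K. \<epsilon> k * (- g k))" by (simp add: t1)
  finally show ?thesis .
qed

lemma sup_add_le: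
  fixes f g :: "'x \<Rightarrow> real"
  assumes "W \<noteq> {}" "bounded (f ` W)" "bounded (g ` W)"
  shows "(SUP x\<in>W. f x + g x) \<le> (SUP x\<in>W. f x) + (SUP x\<in>W. g x)"
  using assms by (intro cSUP_least add_mono cSUP_upper) (auto dest: bounded_imp_bdd_above)

text \<open>Each matched pair carries one sign but two cells. The gap splits into one sign sum over
  the image of \<open>\<theta>\<close> and one over \<open>K\<close>; each is a Rademacher average
  over \<open>s\<close> cells, open to contraction and \<open>rad\<close>. This accounts for the
  factor 2.\<close>

lemma sum_sup_gap_le:
  fixes f :: "'a \<Rightarrow> 'x \<Rightarrow> real" and v :: "'a \<Rightarrow> 'x \<Rightarrow> real"
  assumes U: "finite U" "card U = 2 * s" and W: "W \<noteq> {}" and l: "l \<ge> 0"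
    and lip: "\<And>e x y. \<bar>f e x - f e y\<bar> \<le> l * \<bar>v e x - v e y\<bar>"
    and bd: "\<And>e. e \<in> U \<Longrightarrow> bounded (f e ` W)" "\<And>e. e \<in> U \<Longrightarrow> bounded (v e ` W)"
    and rad: "\<And>I. I \<subseteq> U \<Longrightarrow> card I = s \<Longrightarrow>
      (\<Sum>\<epsilon>\<in>signs I. SUP x\<in>W. \<Sum>e\<in>I. \<epsilon> e * v e x) \<le> 2 ^ s * C"
  shows "(\<Sum>S | S \<subseteq> U \<and> card S = s. SUP x\<in>W. (\<Sum>e\<in>U - S. f e x) - (\<Sum>e\<in>S. f e x))
    \<le> real (card {S. S \<subseteq> U \<and> card S = s}) * (2 * l * C)"
proof (rule sum_subsets_le_matching[OF U])
  fix K \<theta> assume K: "K \<subseteq> U" "card K = s" and \<theta>: "bij_betw \<theta> K (U - K)"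
  have finK: "finite K" using U K finite_subset by blast
  \<comment> \<open>\<open>\<alpha>\<close> is the matching or the identity and moves the signs to
    the cells they multiply; \<open>c\<close> provides for the minus sign of the second sum.\<close>
  have half: "(\<Sum>\<epsilon>\<in>signs K. SUP x\<in>W. \<Sum>k\<in>K. \<epsilon> k * (c * f (\<alpha> k) x)) \<le> 2 ^ s * (l * C)"
    if \<alpha>: "inj_on \<alpha> K" "\<alpha> ` K \<subseteq> U" and c: "\<bar>c\<bar> = 1" for \<alpha> c
  proof -
    have b1: "bounded ((\<lambda>x. c * f (\<alpha> k) x) ` W)" and b2: "bounded ((\<lambda>x. l * v (\<alpha> k) x) ` W)" if "k \<in> K" for k
      using that \<alpha>(2) bounded_scaling[OF bd(1), of "\<alpha> k" c] bounded_scaling[OF bd(2), of "\<alpha> k" l]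
      by (auto simp: image_image image_subset_iff)
    have "(\<Sum>\<epsilon>\<in>signs K. SUP x\<in>W. \<Sum>k\<in>K. \<epsilon> k * (c * f (\<alpha> k) x))
        \<le> (\<Sum>\<epsilon>\<in>signs K. SUP x\<in>W. \<Sum>k\<in>K. \<epsilon> k * (l * v (\<alpha> k) x))"
    proof -
      have "\<bar>c * f e x - c * f e y\<bar> \<le> \<bar>l * v e x - l * v e y\<bar>" for e x y
        using lip[of e x y] c l by (simp add: abs_mult flip: right_diff_distrib)
      then show ?thesis
        using rademacher_contraction[of K W "\<lambda>k x. c * f (\<alpha> k) x" "\<lambda>k x. l * v (\<alpha> k) x" "\<lambda>_. 0"]
          finK W b1 b2 by (simp add: image_constant_conv)
    qed
    also have "\<dots> = (\<Sum>\<epsilon>\<in>signs (\<alpha> ` K). SUP x\<in>W. \<Sum>k\<in>K. restrict (\<epsilon> \<circ> \<alpha>) K k * (l * v (\<alpha> k) x))"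
      by (rule sum.reindex_bij_betw[OF bij_betw_signs[OF \<alpha>(1)], symmetric])
    also have "\<dots> = (\<Sum>\<epsilon>\<in>signs (\<alpha> ` K). SUP x\<in>W. l * (\<Sum>e\<in>\<alpha> ` K. \<epsilon> e * v e x))"
      by (intro sum.cong[OF refl] SUP_cong[OF refl])
        (simp add: sum.reindex[OF \<alpha>(1)] sum_distrib_left mult.left_commute)
    also have "\<dots> \<le> (\<Sum>\<epsilon>\<in>signs (\<alpha> ` K). l * (SUP x\<in>W. \<Sum>e\<in>\<alpha> ` K. \<epsilon> e * v e x))"
    proof (intro sum_mono cSUP_least W mult_left_mono l cSUP_upper)
      fix \<epsilon> :: "'a \<Rightarrow> real"
      have "bounded ((\<lambda>x. 0 + (\<Sum>e\<in>\<alpha> ` K. \<epsilon> e * v e x)) ` W)"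
        using finK \<alpha>(2) by (intro bounded_lincomb bd) (auto simp: image_constant_conv)
      then show "bdd_above ((\<lambda>x. \<Sum>e\<in>\<alpha> ` K. \<epsilon> e * v e x) ` W)"
        by (simp add: bounded_imp_bdd_above)
    qed
    also have "\<dots> = l * (\<Sum>\<epsilon>\<in>signs (\<alpha> ` K). SUP x\<in>W. \<Sum>e\<in>\<alpha> ` K. \<epsilon> e * v e x)"
      by (simp add: sum_distrib_left)
    also have "\<dots> \<le> l * (2 ^ s * C)"
      using \<alpha> K by (intro mult_left_mono rad l) (auto simp: card_image)
    finally show ?thesis by (simp add: mult.left_commute)
  qed
  have inj: "inj_on \<theta> K" and im: "\<theta> ` K \<subseteq> U" using \<theta> by (auto simp: bij_betw_def)
  have "(\<Sum>\<epsilon>\<in>signs K. SUP x\<in>W. (\<Sum>e\<in>U - ({k \<in> K. \<epsilon> k = 1} \<union> \<theta> ` {k \<in> K. \<epsilon> k = - 1}). f e x)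
        - (\<Sum>e\<in>{k \<in> K. \<epsilon> k = 1} \<union> \<theta> ` {k \<in> K. \<epsilon> k = - 1}. f e x))
      = (\<Sum>\<epsilon>\<in>signs K. SUP x\<in>W. (\<Sum>k\<in>K. \<epsilon> k * (1 * f (\<theta> k) x)) + (\<Sum>k\<in>K. \<epsilon> k * (- 1 * f k x)))"
    by (intro sum.cong[OF refl] SUP_cong[OF refl]) (simp add: sum_diff_matching[OF U(1) K(1) \<theta>])
  also have "\<dots> \<le> (\<Sum>\<epsilon>\<in>signs K. (SUP x\<in>W. \<Sum>k\<in>K. \<epsilon> k * (1 * f (\<theta> k) x)) + (SUP x\<in>W. \<Sum>k\<in>K. \<epsilon> k * (- 1 * f k x)))"
  proof (rule sum_mono, rule sup_add_le[OF W])
    fix \<epsilon> :: "'a \<Rightarrow> real"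
    have "bounded ((\<lambda>x. 0 + (\<Sum>k\<in>K. \<epsilon> k * f (\<theta> k) x)) ` W)"
      using finK im by (intro bounded_lincomb bd) (auto simp: image_constant_conv)
    then show "bounded ((\<lambda>x. \<Sum>k\<in>K. \<epsilon> k * (1 * f (\<theta> k) x)) ` W)" by simp
    have "bounded ((\<lambda>x. 0 + (\<Sum>k\<in>K. - \<epsilon> k * f k x)) ` W)"
      using finK K by (intro bounded_lincomb bd) (auto simp: image_constant_conv)
    then show "bounded ((\<lambda>x. \<Sum>k\<in>K. \<epsilon> k * (- 1 * f k x)) ` W)" by simp
  qed
  also have "\<dots> = (\<Sum>\<epsilon>\<in>signs K. SUP x\<in>W. \<Sum>k\<in>K. \<epsilon> k * (1 * f (\<theta> k) x))
      + (\<Sum>\<epsilon>\<in>signs K. SUP x\<in>W. \<Sum>k\<in>K. \<epsilon> k * (- 1 * f (id k) x))"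
    by (simp only: sum.distrib id_apply)
  also have "\<dots> \<le> 2 ^ s * (l * C) + 2 ^ s * (l * C)"
    using inj im K by (intro add_mono half) auto
  finally show "(\<Sum>\<epsilon>\<in>signs K. SUP x\<in>W. (\<Sum>e\<in>U - ({k \<in> K. \<epsilon> k = 1} \<union> \<theta> ` {k \<in> K. \<epsilon> k = - 1}). f e x)
        - (\<Sum>e\<in>{k \<in> K. \<epsilon> k = 1} \<union> \<theta> ` {k \<in> K. \<epsilon> k = - 1}. f e x)) \<le> 2 ^ s * (2 * l * C)"
    by (simp add: mult_ac)
qed

lemma card_fibre_le:
  assumes "finite U" "I \<subseteq> U"
  shows "card {j. (i, j) \<in> I} \<le> card {j. (i, j) \<in> U}" "card {i. (i, j) \<in> I} \<le> card {i. (i, j) \<in> U}"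
proof -
  have "finite {j. (i, j) \<in> U}" "finite {i. (i, j) \<in> U}"
    using assms(1) finite_subset[of "{j. (i, j) \<in> U}" "snd ` U"] finite_subset[of "{i. (i, j) \<in> U}" "fst ` U"]
    by force+
  then show "card {j. (i, j) \<in> I} \<le> card {j. (i, j) \<in> U}" "card {i. (i, j) \<in> I} \<le> card {i. (i, j) \<in> U}"
    using assms(2) by (auto intro!: card_mono)
qed

text \<open>The chain LT x0 <= LS x0 + gap <= LS x + gap <= LT x + gap + gap' holds for every
  competitor x of the same split, so the infimum can stand inside the expectation.\<close>

lemma minimiser_le_inf_add_gaps:
  fixes LS LT :: "'x \<Rightarrow> real"
  assumes min: "is_arg_min LS (\<lambda>x. x \<in> W) x0"
    and bd: "bounded (LS ` W)" "bounded (LT ` W)"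
  shows "LT x0 \<le> (INF x\<in>W. LT x) + (SUP x\<in>W. LT x - LS x) + (SUP x\<in>W. LS x - LT x)"
proof -
  have x0: "x0 \<in> W" "\<And>x. x \<in> W \<Longrightarrow> LS x0 \<le> LS x"
    using min by (auto simp: is_arg_min_def not_less)
  have u1: "LT x - LS x \<le> (SUP x\<in>W. LT x - LS x)" if "x \<in> W" for x
    using that bounded_minus_comp[OF bd(2,1)] by (intro cSUP_upper) (auto dest: bounded_imp_bdd_above)
  have u2: "LS x - LT x \<le> (SUP x\<in>W. LS x - LT x)" if "x \<in> W" for x
    using that bounded_minus_comp[OF bd] by (intro cSUP_upper) (auto dest: bounded_imp_bdd_above)
  have "LT x0 - (SUP x\<in>W. LT x - LS x) - (SUP x\<in>W. LS x - LT x) \<le> (INF x\<in>W. LT x)"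
  proof (rule cINF_greatest)
    fix x assume "x \<in> W"
    then show "LT x0 - (SUP x\<in>W. LT x - LS x) - (SUP x\<in>W. LS x - LT x) \<le> LT x"
      using u1[OF x0(1)] u2[of x] x0(2)[of x] by linarith
  qed (use x0 in blast)
  then show ?thesis by linarith
qed

text \<open>The factor 4 counts two gaps with two halves of the matching in each; sqrt 8 comes from
  R^2 = 8 s n.\<close>

lemma expected_excess_risk_bound:
  fixes loss :: "real \<Rightarrow> real \<Rightarrow> real" and Xhat :: "(nat \<times> nat) set \<Rightarrow> real mat"
  assumes m: "m \<ge> 1" "n \<ge> m" and s: "s \<ge> 1" and r: "r > 0"
    and lip: "lipschitz_loss l loss" and bdl: "bounded_loss b loss"
    and U: "U \<subseteq> {..<n} \<times> {..<m}" "card U = 2 * s"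
    and W: "W = weighted_ball r (smoothed_row_marginal n U) (smoothed_col_marginal m U)"
    and min: "\<And>S. S \<subseteq> U \<Longrightarrow> card S = s \<Longrightarrow> is_arg_min (empirical_loss loss Y S) (\<lambda>X. X \<in> W) (Xhat S)"
  shows "measure_pmf.expectation (random_split s U) (\<lambda>S. empirical_loss loss Y (U - S) (Xhat S))
    \<le> measure_pmf.expectation (random_split s U) (\<lambda>S. INF X\<in>W. empirical_loss loss Y (U - S) X)
      + 4 * sqrt 8 * matrix_const * (l * sqrt (r * real n * sqrt (ln (real n)) / real s))"
proof -
  let ?qr = "smoothed_row_marginal n U" and ?qc = "smoothed_col_marginal m U"
  let ?\<S> = "{S. S \<subseteq> U \<and> card S = s}"
  have finU: "finite U" using U(1) finite_subset by blast
  \<comment> \<open>A single cell cannot hold a sample of size \<open>2 * s\<close>; the lower bound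
    keeps ln n away from 0.\<close>
  have n2: "n \<ge> 2"
  proof (rule ccontr)
    assume "\<not> n \<ge> 2"
    then have "{..<n} \<times> {..<m} \<subseteq> {(0, 0)}" using m by auto
    then have "U \<subseteq> {(0, 0)}" using U(1) by blast
    then have "card U \<le> 1" using card_mono[of "{(0, 0)}" U] by simp
    then show False using U(2) s by simp
  qed
  have dim: "dim_vec ?qr = n" "dim_vec ?qc = m"
    by (simp_all add: smoothed_row_marginal_def smoothed_col_marginal_def)
  \<comment> \<open>\<open>card U = 2 * s\<close> and the factor 1 / 2 of the smoothing combine to
    the denominator 4 s, which becomes the \<open>A\<close> of
    \<open>weighted_ball_rademacher\<close>.\<close>
  have qr: "?qr $ i = real (card {j. (i, j) \<in> U}) / (4 * real s) + 1 / (2 * real n)" if "i < n" for i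
    using that by (simp add: smoothed_row_marginal_def U(2) field_simps)
  have qc: "?qc $ j = real (card {i. (i, j) \<in> U}) / (4 * real s) + 1 / (2 * real m)" if "j < m" for j
    using that by (simp add: smoothed_col_marginal_def U(2) field_simps)
  have qr1: "1 / (2 * real n) \<le> ?qr $ i" if "i < n" for i unfolding qr[OF that] by simp
  have qc1: "1 / (2 * real n) \<le> ?qc $ j" if "j < m" for j
  proof -
    have "1 / (2 * real n) \<le> 1 / (2 * real m)" using m by (intro divide_left_mono) auto
    then show ?thesis unfolding qc[OF that] by (simp add: add_increasing)
  qed
  have qr2: "real (card {j. (i, j) \<in> U}) \<le> 4 * real s * ?qr $ i" if "i < n" for i
    unfolding qr[OF that] using s by (simp add: distrib_left)
  have qc2: "real (card {i. (i, j) \<in> U}) \<le> 4 * real s * ?qc $ j" if "j < m" for j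
    unfolding qc[OF that] using s by (simp add: distrib_left)
  have n0: "0 < 1 / (2 * real n)" using n2 by simp
  define C where "C = matrix_const * sqrt (2 * (4 * real s) * real n) * sqrt (sqrt (ln (real n))) * sqrt r"
  have "\<exists>S \<subseteq> U. card S = s" using obtain_subset_with_card_n[of s U] U(2) by auto
  then have \<S>: "finite ?\<S>" "?\<S> \<noteq> {}" using finU by auto
  then obtain S0 where "S0 \<subseteq> U" "card S0 = s" by auto
  from min[OF this] have ne: "W \<noteq> {}" by (auto simp: is_arg_min_def)
  have rad: "(\<Sum>\<epsilon>\<in>signs I. SUP X\<in>W. \<Sum>e\<in>I. \<epsilon> e * X $$ e) \<le> 2 ^ s * C" if I: "I \<subseteq> U" "card I = s" for I
  proof -
    have "real (card {j. (i, j) \<in> I}) \<le> 4 * real s * ?qr $ i" if "i < n" for i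
      using qr2[OF that] card_fibre_le(1)[OF finU I(1), of i] by linarith
    moreover have "real (card {i. (i, j) \<in> I}) \<le> 4 * real s * ?qc $ j" if "j < m" for j
      using qc2[OF that] card_fibre_le(2)[OF finU I(1), of j] by linarith
    ultimately show ?thesis
      using weighted_ball_rademacher[OF _ m(2) n2 _ _ ne[unfolded W] dim qr1 qc1, of I "4 * real s"]
        I U(1) s r by (auto simp: C_def W)
  qed
  define f where "f e X = loss (X $$ e) (Y $$ e)" for e and X :: "real mat"
  have bf: "bounded (f e ` W)" for e
    using bdl unfolding bounded_loss_def bounded_iff f_def by auto
  have bv: "bounded ((\<lambda>X. X $$ e) ` W)" if "e \<in> U" for e
  proof -
    have "e \<in> {..<n} \<times> {..<m}" using U(1) that by blast
    then obtain i j where e: "e = (i, j)" "i < n" "j < m" by auto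
    show ?thesis unfolding e(1) W
      using less_le_trans[OF n0 qr1] less_le_trans[OF n0 qc1] e
      by (intro weighted_ball_entry_bounded) (auto simp: dim)
  qed
  have l: "l \<ge> 0"
  proof -
    have "\<bar>loss 1 0 - loss 0 0\<bar> \<le> l * \<bar>1 - 0\<bar>" using lip unfolding lipschitz_loss_def by blast
    then have "0 \<le> l * \<bar>1 - 0\<bar>" by (rule order_trans[OF abs_ge_zero])
    then show ?thesis by simp
  qed
  \<comment> \<open>\<open>c = 1\<close> and \<open>c = - 1\<close> give the two gaps: negating the
    loss exchanges training and test part.\<close>
  have gap: "(\<Sum>S\<in>?\<S>. SUP X\<in>W. (\<Sum>e\<in>U - S. c * f e X) - (\<Sum>e\<in>S. c * f e X)) \<le> real (card ?\<S>) * (2 * l * C)"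
    if c: "\<bar>c\<bar> = 1" for c
  proof (rule sum_sup_gap_le[OF finU U(2) ne l])
    show "\<bar>c * f e X - c * f e X'\<bar> \<le> l * \<bar>X $$ e - X' $$ e\<bar>" for e X X'
      using lip c by (simp add: f_def lipschitz_loss_def abs_mult flip: right_diff_distrib)
    show "bounded ((\<lambda>X. c * f e X) ` W)" for e
      using bounded_scaling[OF bf, of c e] by (simp add: image_image)
  qed (use bv rad in auto)
  define h where "h c S = (SUP X\<in>W. (\<Sum>e\<in>U - S. c * f e X) - (\<Sum>e\<in>S. c * f e X))" for c S
  have emp: "empirical_loss loss Y A X = 1 / real s * (\<Sum>e\<in>A. f e X)" if "card A = s" for A X
    using that by (simp add: empirical_loss_def f_def case_prod_unfold)
  have point: "empirical_loss loss Y (U - S) (Xhat S)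
      \<le> (INF X\<in>W. empirical_loss loss Y (U - S) X) + (1 / real s * h 1 S + 1 / real s * h (- 1) S)"
    if S: "S \<in> ?\<S>" for S
  proof -
    have SU: "S \<subseteq> U" "card S = s" and finS: "finite S" using S finU finite_subset by auto
    have cT: "card (U - S) = s" using SU finS U(2) by (simp add: card_Diff_subset)
    have bdd: "bounded ((\<lambda>X. \<Sum>e\<in>A. k * f e X) ` W)" if "finite A" for A k
      using bounded_lincomb[OF that, of "\<lambda>_. 0" W f "\<lambda>_. k"] bf by (simp add: image_constant_conv)
    have scale: "(SUP X\<in>W. 1 / real s * F X) \<le> 1 / real s * (SUP X\<in>W. F X)" if "bounded (F ` W)" for F
      using that by (intro cSUP_least[OF ne] mult_left_mono cSUP_upper) (auto dest: bounded_imp_bdd_above)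
    have b1: "bounded ((\<lambda>X. (\<Sum>e\<in>U - S. c * f e X) - (\<Sum>e\<in>S. c * f e X)) ` W)" for c
      using finU finS by (intro bounded_minus_comp bdd) auto
    have bE: "bounded (empirical_loss loss Y A ` W)" if "finite A" "card A = s" for A
      using bdd[OF that(1), of "1 / real s"] unfolding emp[OF that(2), abs_def] by (simp add: sum_distrib_left)
    have "empirical_loss loss Y (U - S) (Xhat S) \<le> (INF X\<in>W. empirical_loss loss Y (U - S) X)
        + (SUP X\<in>W. empirical_loss loss Y (U - S) X - empirical_loss loss Y S X)
        + (SUP X\<in>W. empirical_loss loss Y S X - empirical_loss loss Y (U - S) X)"
      using finU finS cT SU by (intro minimiser_le_inf_add_gaps min bE) auto
    moreover have "(SUP X\<in>W. empirical_loss loss Y (U - S) X - empirical_loss loss Y S X) \<le> 1 / real s * h 1 S"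
      using scale[OF b1[of 1]] by (simp add: h_def emp cT SU(2) right_diff_distrib diff_divide_distrib)
    moreover have "(SUP X\<in>W. empirical_loss loss Y S X - empirical_loss loss Y (U - S) X) \<le> 1 / real s * h (- 1) S"
      using scale[OF b1[of "- 1"]]
      by (simp add: h_def emp cT SU(2) right_diff_distrib diff_divide_distrib sum_negf)
    ultimately show ?thesis by linarith
  qed
  have E: "measure_pmf.expectation (random_split s U) F = (\<Sum>S\<in>?\<S>. F S) / real (card ?\<S>)" for F :: "(nat \<times> nat) set \<Rightarrow> real"
    unfolding random_split_def using \<S>(2,1) by (rule integral_pmf_of_set)
  let ?N = "real (card ?\<S>)"
  have N: "?N > 0" using \<S> by (simp add: card_gt_0_iff)
  have "(\<Sum>S\<in>?\<S>. empirical_loss loss Y (U - S) (Xhat S))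
      \<le> (\<Sum>S\<in>?\<S>. (INF X\<in>W. empirical_loss loss Y (U - S) X) + (1 / real s * h 1 S + 1 / real s * h (- 1) S))"
    by (intro sum_mono point)
  also have "\<dots> = (\<Sum>S\<in>?\<S>. INF X\<in>W. empirical_loss loss Y (U - S) X)
      + (1 / real s * (\<Sum>S\<in>?\<S>. h 1 S) + 1 / real s * (\<Sum>S\<in>?\<S>. h (- 1) S))"
    by (simp only: sum.distrib sum_distrib_left)
  also have "\<dots> \<le> (\<Sum>S\<in>?\<S>. INF X\<in>W. empirical_loss loss Y (U - S) X)
      + (1 / real s * (?N * (2 * l * C)) + 1 / real s * (?N * (2 * l * C)))"
    unfolding h_def using gap[of 1] gap[of "- 1"]
    by (intro add_left_mono add_mono mult_left_mono) simp_all
  finally have "(\<Sum>S\<in>?\<S>. empirical_loss loss Y (U - S) (Xhat S)) / ?N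
      \<le> ((\<Sum>S\<in>?\<S>. INF X\<in>W. empirical_loss loss Y (U - S) X)
        + (1 / real s * (?N * (2 * l * C)) + 1 / real s * (?N * (2 * l * C)))) / ?N"
    using N by (intro divide_right_mono) auto
  also have "\<dots> = (\<Sum>S\<in>?\<S>. INF X\<in>W. empirical_loss loss Y (U - S) X) / ?N + 4 * l * (C / real s)"
    using N by (simp add: add_divide_distrib)
  also have "C / real s = sqrt 8 * matrix_const * sqrt (r * real n * sqrt (ln (real n)) / real s)"
  proof -
    have "sqrt (real s) * sqrt (real s) = real s" by simp
    then have ratio: "sqrt (real s) / real s = 1 / sqrt (real s)" using s by (simp add: field_simps)
    define D where "D = matrix_const * sqrt 8 * sqrt (real n) * sqrt (sqrt (ln (real n))) * sqrt r"
    have "C = D * sqrt (real s)"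
      unfolding C_def D_def by (simp add: real_sqrt_mult mult_ac)
    then have "C / real s = D * (1 / sqrt (real s))" by (simp flip: ratio)
    then show ?thesis by (simp add: D_def real_sqrt_mult real_sqrt_divide mult_ac)
  qed
  finally show ?thesis unfolding E by (simp add: mult_ac)
qed

theorem theorem5:
  shows "\<exists>K::real. \<forall>(n::nat) (m::nat) (s::nat) (r::real) (l::real) (b::real)
      (Y::real mat) (loss::real \<Rightarrow> real \<Rightarrow> real) (Sbar::(nat \<times> nat) set)
      (Xhat::(nat \<times> nat) set \<Rightarrow> real mat).
    m \<ge> 1 \<longrightarrow> n \<ge> m \<longrightarrow> s \<ge> 1 \<longrightarrow> r > 0 \<longrightarrow>
    Y \<in> carrier_mat n m \<longrightarrow> lipschitz_loss l loss \<longrightarrow> bounded_loss b loss \<longrightarrow>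
    Sbar \<subseteq> {..<n} \<times> {..<m} \<longrightarrow> card Sbar = 2 * s \<longrightarrow>
    (let W = weighted_ball r (smoothed_row_marginal n Sbar) (smoothed_col_marginal m Sbar) in
      (\<forall>S. S \<subseteq> Sbar \<and> card S = s \<longrightarrow>
         is_arg_min (empirical_loss loss Y S) (\<lambda>X. X \<in> W) (Xhat S)) \<longrightarrow>
      measure_pmf.expectation (random_split s Sbar)
        (\<lambda>S. empirical_loss loss Y (Sbar - S) (Xhat S))
      \<le> measure_pmf.expectation (random_split s Sbar)
          (\<lambda>S. INF X\<in>W. empirical_loss loss Y (Sbar - S) X)
        + K * (l * sqrt (r * real n * sqrt (ln (real n)) / real s) + b / sqrt (real s)))"
proof (intro exI[of _ "4 * sqrt 8 * matrix_const"] allI impI, unfold Let_def, intro impI)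
  fix n m s :: nat and r l b :: real and Y :: "real mat" and loss :: "real \<Rightarrow> real \<Rightarrow> real"
    and U :: "(nat \<times> nat) set" and Xhat :: "(nat \<times> nat) set \<Rightarrow> real mat"
  let ?W = "weighted_ball r (smoothed_row_marginal n U) (smoothed_col_marginal m U)"
  let ?A = "l * sqrt (r * real n * sqrt (ln (real n)) / real s)"
  assume *: "m \<ge> 1" "n \<ge> m" "s \<ge> 1" "r > 0" and "Y \<in> carrier_mat n m"
    and **: "lipschitz_loss l loss" "bounded_loss b loss" "U \<subseteq> {..<n} \<times> {..<m}" "card U = 2 * s"
    and min: "\<forall>S. S \<subseteq> U \<and> card S = s \<longrightarrow> is_arg_min (empirical_loss loss Y S) (\<lambda>X. X \<in> ?W) (Xhat S)"
  have "\<bar>loss 0 0\<bar> \<le> b" using **(2) unfolding bounded_loss_def by blast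
  then have "b \<ge> 0" by linarith
  then have le: "4 * sqrt 8 * matrix_const * ?A \<le> 4 * sqrt 8 * matrix_const * (?A + b / sqrt (real s))"
    using matrix_const_pos by (intro mult_left_mono) auto
  have "measure_pmf.expectation (random_split s U) (\<lambda>S. empirical_loss loss Y (U - S) (Xhat S))
      \<le> measure_pmf.expectation (random_split s U) (\<lambda>S. INF X\<in>?W. empirical_loss loss Y (U - S) X)
        + 4 * sqrt 8 * matrix_const * ?A"
    by (rule expected_excess_risk_bound[OF * ** refl]) (use min in blast)
  then show "measure_pmf.expectation (random_split s U) (\<lambda>S. empirical_loss loss Y (U - S) (Xhat S))
      \<le> measure_pmf.expectation (random_split s U) (\<lambda>S. INF X\<in>?W. empirical_loss loss Y (U - S) X)
        + 4 * sqrt 8 * matrix_const * (?A + b / sqrt (real s))"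
    using le by linarith
qed

end
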